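(* Fix $q\in\{2,3,4\}$ and a simply connected domain $\Omega\subset\mathbb R^2$ with a $C^1$-smooth boundary. For every $n$ and $\varepsilon>0$, there exists $\delta_0=\delta_0(q,n,\varepsilon,\Omega)>0$ such that for every $\alpha\in[0,2\pi]$, every $\delta\le\delta_0$, every $\tau_1,\dots,\tau_n\in\mathbb T_q$, and every $x_1,\dots,x_n\in\Omega_\delta$ at a distance at least $\varepsilon$ from each other and from the boundary of $\Omega$, $$\Big|\mu_{\Omega_\delta}[\sigma_{x_i}=\tau_i,\,1\le i\le n]-\mu_{(e^{i\alpha}\Omega)_\delta}[\sigma_{e^{i\alpha}x_i}=\tau_i,\,1\le i\le n]\Big|\le\varepsilon\,\mu_{\Omega_\delta}[\sigma_{x_i}=\tau_i,\,1\le i\le n],$$ where, in a slight abuse of notation, $e^{i\alpha}x_i$ denotes a vertex of $(e^{i\alpha}\Omega)_\delta$ within a distance $\delta$ from the image of $x_i$ under the rotation by the angle $\alpha$.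
   Context: Identify $\mathbb R^2$ with $\mathbb C$. A domain has $C^1$-smooth boundary if $\partial\Omega$ can be parametrized by a $C^1$-function whose differential does not vanish at any point. $\Omega_\delta$ is the intersection of $\Omega$ with $\delta\mathbb Z^2$ (as a graph). Potts model. $\mathbb T_q\subset\mathbb R^{q-1}$ is the simplex (set of $q$ points) containing $(1,0,\dots,0)$ such that for $a,b\in\mathbb T_q$, $a\cdot b=1$ if $a=b$ and $a\cdot b=-\frac1{q-1}$ otherwise, with $\cdot$ the scalar product. For a finite graph $G=(V,E)$ and a spin configuration $\sigma=(\sigma_x)_{x\in V}\in\mathbb T_q^V$, let $H_G(\sigma)=-\sum_{xy\in E}\sigma_x\cdot\sigma_y$. The Gibbs measure at inverse temperature $\beta\ge0$ is $\mu_{G,\beta,q}[f]=\frac1{Z}\sum_{\sigma\in\mathbb T_q^V}f(\sigma)\exp[-\beta H_G(\sigma)]$, where $Z$ is the normalising constant; for infinite $G$ take the weak limit over increasing finite subgraphs. Throughout $\beta=\beta_c(q)=\frac{q-1}{q}\log(1+\sqrt q)$ is the critical inverse temperature, and $\mu_G=\mu_{G,\beta_c(q),q}$. *)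

theory Defs
  imports "HOL-Complex_Analysis.Complex_Analysis"
begin

section \<open>Domains with smooth boundary\<close>

text \<open>
  The boundary is parametrized by a regular closed curve of class \<open>C\<^sup>1\<close>, that is, by a function on the
  circle \<open>\<real>/\<int>\<close>, written here as a function \<open>\<gamma>\<close> on the line. The condition on \<open>\<gamma> s = \<gamma> t\<close> says
  both that \<open>\<gamma>\<close> has period 1 and that it is injective on the circle. As the derivative is then
  periodic too, corners and cusps are excluded, also at the closing point.
\<close>

definition C1_smooth_boundary :: "complex set \<Rightarrow> bool" where
  "C1_smooth_boundary \<Omega> \<longleftrightarrow>
     (\<exists>\<gamma> \<gamma>' :: real \<Rightarrow> complex.
        (\<forall>t. (\<gamma> has_vector_derivative \<gamma>' t) (at t)) \<and>
        continuous_on UNIV \<gamma>' \<and>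
        (\<forall>t. \<gamma>' t \<noteq> 0) \<and>
        (\<forall>s t. \<gamma> s = \<gamma> t \<longleftrightarrow> s - t \<in> \<int>) \<and>
        frontier \<Omega> = range \<gamma>)"

section \<open>The square lattice and discretized domains\<close>

text \<open>
  A graph is given by its vertex set and its set of edges. An edge \<open>xy\<close> is represented by both
  ordered pairs \<open>(x, y)\<close> and \<open>(y, x)\<close>.
\<close>

definition lattice_verts :: "real \<Rightarrow> complex set" where
  "lattice_verts \<delta> = {of_real \<delta> * Complex (of_int a) (of_int b) | a b :: int. True}"

definition domain_verts :: "complex set \<Rightarrow> real \<Rightarrow> complex set" where
  "domain_verts \<Omega> \<delta> = \<Omega> \<inter> lattice_verts \<delta>"

definition domain_edges :: "complex set \<Rightarrow> real \<Rightarrow> (complex \<times> complex) set" where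
  "domain_edges \<Omega> \<delta> =
     {(x, y). x \<in> domain_verts \<Omega> \<delta> \<and> y \<in> domain_verts \<Omega> \<delta> \<and> dist x y = \<delta>}"

definition rotate_domain :: "real \<Rightarrow> complex set \<Rightarrow> complex set" where
  "rotate_domain \<alpha> \<Omega> = (\<lambda>z. cis \<alpha> * z) ` \<Omega>"

section \<open>The Potts model\<close>

text \<open>
  The spin set. The index type \<open>'d\<close> stands for the \<open>q - 1\<close> coordinates; it carries no order, so the
  point \<open>(1, 0, \<dots>, 0)\<close> is a unit vector along some coordinate axis, and that coordinate
  plays the role of the first one.
\<close>

definition potts_simplex :: "nat \<Rightarrow> (real ^ 'd) set \<Rightarrow> bool" where
  "potts_simplex q T \<longleftrightarrow>
     CARD('d) = q - 1 \<and> card T = q \<and> (\<exists>k. axis k 1 \<in> T) \<and>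
     (\<forall>a\<in>T. \<forall>b\<in>T. a \<bullet> b = (if a = b then 1 else - 1 / (real q - 1)))"

text \<open>The factor \<open>1 / 2\<close> is there because each edge occurs in \<open>E\<close> as two ordered pairs.\<close>

definition potts_hamiltonian ::
  "('v \<times> 'v) set \<Rightarrow> ('v \<Rightarrow> real ^ 'd) \<Rightarrow> real" where
  "potts_hamiltonian E \<sigma> = - (1 / 2) * (\<Sum>(x, y)\<in>E. \<sigma> x \<bullet> \<sigma> y)"

text \<open>Spin configurations on \<open>V\<close> are the extensional functions in \<open>V \<rightarrow>\<^sub>E T\<close>.\<close>

definition potts_partition ::
  "'v set \<Rightarrow> ('v \<times> 'v) set \<Rightarrow> real \<Rightarrow> (real ^ 'd) set \<Rightarrow> real" where
  "potts_partition V E \<beta> T = (\<Sum>\<sigma>\<in>V \<rightarrow>\<^sub>E T. exp (- \<beta> * potts_hamiltonian E \<sigma>))"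

definition potts_expectation ::
  "'v set \<Rightarrow> ('v \<times> 'v) set \<Rightarrow> real \<Rightarrow> (real ^ 'd) set \<Rightarrow>
     (('v \<Rightarrow> real ^ 'd) \<Rightarrow> real) \<Rightarrow> real" where
  "potts_expectation V E \<beta> T f =
     (\<Sum>\<sigma>\<in>V \<rightarrow>\<^sub>E T. f \<sigma> * exp (- \<beta> * potts_hamiltonian E \<sigma>)) / potts_partition V E \<beta> T"

definition potts_beta_c :: "nat \<Rightarrow> real" where
  "potts_beta_c q = (real q - 1) / real q * ln (1 + sqrt (real q))"

definition critical_potts_prob ::
  "nat \<Rightarrow> (real ^ 'd) set \<Rightarrow> complex set \<Rightarrow> real \<Rightarrow>
     ((complex \<Rightarrow> real ^ 'd) \<Rightarrow> bool) \<Rightarrow> real" where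
  "critical_potts_prob q T \<Omega> \<delta> A =
     potts_expectation (domain_verts \<Omega> \<delta>) (domain_edges \<Omega> \<delta>) (potts_beta_c q) T
       (\<lambda>\<sigma>. of_bool (A \<sigma>))"

section \<open>Discretized domains are finite\<close>

text \<open>
  The domains considered are automatically bounded, so that the finite-volume Gibbs measures
  above are all that is needed.
\<close>

lemma C1_smooth_boundary_imp_bounded:
  assumes "open \<Omega>" "simply_connected \<Omega>" "C1_smooth_boundary \<Omega>"
  shows "bounded \<Omega>"
proof (rule ccontr)
  assume unb: "\<not> bounded \<Omega>"
  from assms(3) obtain \<gamma> \<gamma>' :: "real \<Rightarrow> complex" where
    d: "\<And>t. (\<gamma> has_vector_derivative \<gamma>' t) (at t)" and
    p: "\<And>s t. \<gamma> s = \<gamma> t \<longleftrightarrow> s - t \<in> \<int>" and f: "frontier \<Omega> = range \<gamma>"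
    unfolding C1_smooth_boundary_def by blast
  have "\<gamma> t = \<gamma> (frac t)" for t
    by (simp add: p frac_def)
  then have "range \<gamma> \<subseteq> \<gamma> ` {0..1}"
    by (metis atLeastAtMost_iff frac_ge_0 frac_lt_1 image_eqI image_subsetI less_imp_le)
  moreover have "continuous_on {0..1} \<gamma>"
    by (meson continuous_at_imp_continuous_on d has_vector_derivative_continuous)
  then have "bounded (\<gamma> ` {0..1})"
    by (simp add: compact_continuous_image compact_imp_bounded)
  ultimately have bf: "bounded (frontier \<Omega>)"
    using f bounded_subset by metis
  obtain C where C: "C \<in> components (frontier \<Omega>)"
    using f components_eq_empty by (metis UNIV_not_empty empty_is_image ex_in_conv)
  then have "bounded C"
    using bf bounded_subset in_components_subset by metis
  with C unb assms show False
    by (simp add: simply_connected_eq_frontier_properties)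
qed

lemma finite_domain_verts:
  assumes "bounded \<Omega>" "0 < \<delta>"
  shows "finite (domain_verts \<Omega> \<delta>)"
proof -
  obtain B where B: "\<And>z. z \<in> \<Omega> \<Longrightarrow> norm z \<le> B"
    using assms(1) by (auto simp: bounded_iff)
  let ?I = "{- \<lceil>B / \<delta>\<rceil> .. \<lceil>B / \<delta>\<rceil>}"
  have "domain_verts \<Omega> \<delta> \<subseteq>
      (\<lambda>(a, b). of_real \<delta> * Complex (of_int a) (of_int b)) ` (?I \<times> ?I)"
  proof
    fix z assume "z \<in> domain_verts \<Omega> \<delta>"
    then obtain a b where z: "z = of_real \<delta> * Complex (of_int a) (of_int b)" and "z \<in> \<Omega>"
      by (auto simp: domain_verts_def lattice_verts_def)
    then have "\<bar>Re z\<bar> \<le> B" "\<bar>Im z\<bar> \<le> B"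
      using B abs_Re_le_cmod abs_Im_le_cmod order_trans by blast+
    then have "\<bar>of_int a\<bar> \<le> B / \<delta>" "\<bar>of_int b\<bar> \<le> B / \<delta>"
      using assms(2) by (simp_all add: z abs_mult field_simps)
    then have "a \<in> ?I" "b \<in> ?I"
      by (auto; linarith)+
    then show "z \<in> (\<lambda>(a, b). of_real \<delta> * Complex (of_int a) (of_int b)) ` (?I \<times> ?I)"
      by (auto simp: z)
  qed
  then show ?thesis
    by (rule finite_subset) simp
qed

end

(* Both probabilities converge to q^-n, since at the self-dual point the correlations of the Potts
   model with free boundary conditions decay.

   In the random-cluster representation this says that the infinite-volume free two-point function G
   tends to 0. Suppose not. By reflection positivity G is log-convex along the axes, so it is bounded
   below everywhere, and the mean ergodic theorem yields a positive limit density: the average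
   connectivity of a large box concentrates at a constant gam > 0. Hence a large box meets a dense
   cluster with probability close to 1, and by the square-root trick and the uniqueness of the dense
   cluster (opening the box would otherwise increase the average connectivity) opposite sides of the
   box are connected outside the box with probability close to 1. The dual model dominates the free
   model, so the other two sides are connected by a dual path with probability close to 1 too. By
   planarity these events are disjoint, a contradiction. *)

theory Submission
  imports Defs
begin

section \<open>Holley's inequality\<close>

text \<open>Failure of decay by itself only provides a sparse family of distant pairs with large
  \<open>G\<close>, which could average out to nothing; reflection positivity has to come first and
  turn them into a uniform lower bound. No measure on infinite configurations is built. Infinite
  volume enters only through \<open>G\<close>, a supremum over finite volumes, and
  \<open>gam\<close>, an infimum of a quadratic form; all probabilistic statements concern boxes
  \<open>lbox p N\<close> with N eventually large, where the free measure is monotone in the domain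
  but not translation invariant. Every stochastic comparison reduces to Holley's criterion for the
  ratio of weights when one edge is added. At the self-dual point this ratio is sqrt q or 1 / sqrt
  q, and passing to the dual exchanges the two values, so the dual box obeys the same criterion. The
  index p in {0, 1} is a parity: the faces inside a box of even side form a box of odd side, and
  both kinds must admit a quarter turn. The bound 5/8 in the crossing estimates serves because twice
  5/8 exceeds 1.\<close>

lemma sum_Pow_insert:
  fixes g :: "'a set \<Rightarrow> 'b::comm_monoid_add"
  assumes "finite E" "e \<notin> E"
  shows "(\<Sum>\<omega>\<in>Pow (insert e E). g \<omega>) = (\<Sum>\<omega>\<in>Pow E. g \<omega>) + (\<Sum>\<omega>\<in>Pow E. g (insert e \<omega>))"
proof -
  have "inj_on (insert e) (Pow E)"
    using assms(2) by (intro inj_onI) (metis Diff_insert_absorb PowD subsetD)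
  moreover have "Pow E \<inter> insert e ` Pow E = {}"
    using assms(2) by auto
  ultimately show ?thesis
    using assms(1) by (simp add: Pow_insert sum.union_disjoint sum.reindex)
qed

text \<open>Induction on the edges, conditioning on the state of one edge \<open>e\<close>. The mean
  of \<open>f\<close> under either weight is a mixture of its means given \<open>e\<close> open and
  given \<open>e\<close> closed; these conditional means compare by induction, and it remains to
  compare the probabilities that \<open>e\<close> is open.\<close>

lemma holley:
  fixes W W' f :: "'e set \<Rightarrow> real"
  assumes "finite E"
    and "\<And>\<eta>. \<eta> \<subseteq> E \<Longrightarrow> 0 < W \<eta>" "\<And>\<eta>. \<eta> \<subseteq> E \<Longrightarrow> 0 < W' \<eta>"
    and "\<And>\<eta> \<eta>' e. \<lbrakk>\<eta>' \<subseteq> \<eta>; \<eta> \<subseteq> E; e \<in> E - \<eta>\<rbrakk>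
           \<Longrightarrow> W \<eta> * W' (insert e \<eta>') \<le> W (insert e \<eta>) * W' \<eta>'"
    and "\<And>\<eta> \<eta>'. \<lbrakk>\<eta>' \<subseteq> \<eta>; \<eta> \<subseteq> E\<rbrakk> \<Longrightarrow> f \<eta>' \<le> f \<eta>"
  shows "(\<Sum>\<eta>\<in>Pow E. W' \<eta> * f \<eta>) / (\<Sum>\<eta>\<in>Pow E. W' \<eta>) \<le> (\<Sum>\<eta>\<in>Pow E. W \<eta> * f \<eta>) / (\<Sum>\<eta>\<in>Pow E. W \<eta>)"
  using assms
proof (induction E arbitrary: W W' f rule: finite_induct)
  case empty
  then show ?case by (simp add: less_imp_neq[symmetric])
next
  case (insert e E W W' f)
  note fin = insert.hyps(1) and nin = insert.hyps(2)
  note W = insert.prems(1) and W' = insert.prems(2) and R = insert.prems(3) and M = insert.prems(4)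
  define a0 a1 b0 b1 where
    "a0 = (\<Sum>\<eta>\<in>Pow E. W \<eta>)" and "a1 = (\<Sum>\<eta>\<in>Pow E. W (insert e \<eta>))" and
    "b0 = (\<Sum>\<eta>\<in>Pow E. W' \<eta>)" and "b1 = (\<Sum>\<eta>\<in>Pow E. W' (insert e \<eta>))"
  have ne: "Pow E \<noteq> {}" by auto
  have pos: "0 < a0" "0 < a1" "0 < b0" "0 < b1"
    unfolding a0_def a1_def b0_def b1_def using fin ne
    by (auto intro!: sum_pos W W')
  define A0 A1 A01 B0 B1 where
    "A0 = (\<Sum>\<eta>\<in>Pow E. W \<eta> * f \<eta>) / a0" and "A1 = (\<Sum>\<eta>\<in>Pow E. W (insert e \<eta>) * f (insert e \<eta>)) / a1"
    and "A01 = (\<Sum>\<eta>\<in>Pow E. W (insert e \<eta>) * f \<eta>) / a1"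
    and "B0 = (\<Sum>\<eta>\<in>Pow E. W' \<eta> * f \<eta>) / b0" and "B1 = (\<Sum>\<eta>\<in>Pow E. W' (insert e \<eta>) * f (insert e \<eta>)) / b1"
  have sub: "\<eta> \<subseteq> insert e E" "insert e \<eta> \<subseteq> insert e E" "e \<notin> \<eta>" if "\<eta> \<subseteq> E" for \<eta>
    using that nin by auto
  have 00: "B0 \<le> A0" unfolding A0_def B0_def a0_def b0_def
  proof (rule insert.IH)
    fix \<eta> \<eta>' d assume *: "\<eta>' \<subseteq> \<eta>" "\<eta> \<subseteq> E" "d \<in> E - \<eta>"
    then show "W \<eta> * W' (insert d \<eta>') \<le> W (insert d \<eta>) * W' \<eta>'" by (intro R) auto
  qed (use W W' M sub in auto)
  have 11: "B1 \<le> A1" unfolding A1_def B1_def a1_def b1_def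
  proof (rule insert.IH)
    fix \<eta> \<eta>' d assume *: "\<eta>' \<subseteq> \<eta>" "\<eta> \<subseteq> E" "d \<in> E - \<eta>"
    then have "W (insert e \<eta>) * W' (insert d (insert e \<eta>')) \<le> W (insert d (insert e \<eta>)) * W' (insert e \<eta>')"
      using nin by (intro R) auto
    then show "W (insert e \<eta>) * W' (insert e (insert d \<eta>')) \<le> W (insert e (insert d \<eta>)) * W' (insert e \<eta>')"
      by (simp add: insert_commute)
  qed (use W W' M sub in \<open>auto intro!: M\<close>)
  \<comment> \<open>Here \<open>e\<close> is open for \<open>W\<close> and closed for
    \<open>W'\<close>. Comparing the same \<open>f\<close> on both sides and then using monotonicity
    of \<open>f\<close> in \<open>e\<close> gives \<open>B0 \<le> A1\<close>.\<close>
  have 01: "B0 \<le> A01" unfolding A01_def B0_def a1_def b0_def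
  proof (rule insert.IH)
    fix \<eta> \<eta>' d assume *: "\<eta>' \<subseteq> \<eta>" "\<eta> \<subseteq> E" "d \<in> E - \<eta>"
    then have "W (insert e \<eta>) * W' (insert d \<eta>') \<le> W (insert d (insert e \<eta>)) * W' \<eta>'"
      using nin by (intro R) auto
    then show "W (insert e \<eta>) * W' (insert d \<eta>') \<le> W (insert e (insert d \<eta>)) * W' \<eta>'"
      by (simp add: insert_commute)
  qed (use W W' M sub in auto)
  have "A01 \<le> A1" unfolding A01_def A1_def using pos(2) W sub
    by (intro divide_right_mono sum_mono mult_left_mono M) (auto simp: less_imp_le)
  with 01 have B0A1: "B0 \<le> A1" by simp
  \<comment> \<open>The odds of opening \<open>e\<close> need not be monotone in the remaining
    edges, neither for \<open>W\<close> nor for \<open>W'\<close>. The maximum of the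
    \<open>W'\<close> odds over all subsets is monotone and lies between the \<open>W'\<close> odds
    and the \<open>W\<close> odds, so the induction hypothesis applies to it.\<close>
  define r where "r \<eta> = Max ((\<lambda>\<eta>'. W' (insert e \<eta>') / W' \<eta>') ` Pow \<eta>)" for \<eta>
  have finP: "finite (Pow \<eta>)" if "\<eta> \<subseteq> E" for \<eta> using that fin finite_subset by auto
  have r_mono: "r \<eta>' \<le> r \<eta>" if "\<eta>' \<subseteq> \<eta>" "\<eta> \<subseteq> E" for \<eta> \<eta>'
    unfolding r_def using that finP by (intro Max_mono) auto
  have r_ge: "W' (insert e \<eta>) \<le> W' \<eta> * r \<eta>" if "\<eta> \<subseteq> E" for \<eta>
  proof -
    have "W' (insert e \<eta>) / W' \<eta> \<le> r \<eta>" unfolding r_def using that finP by (intro Max_ge) auto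
    then show ?thesis using W'[of \<eta>] sub[OF that] by (simp add: field_simps)
  qed
  have r_le: "W \<eta> * r \<eta> \<le> W (insert e \<eta>)" if "\<eta> \<subseteq> E" for \<eta>
  proof -
    have "r \<eta> \<in> (\<lambda>\<eta>'. W' (insert e \<eta>') / W' \<eta>') ` Pow \<eta>"
      unfolding r_def using that finP by (intro Max_in) auto
    then obtain \<eta>' where \<eta>': "\<eta>' \<subseteq> \<eta>" "r \<eta> = W' (insert e \<eta>') / W' \<eta>'" by auto
    have "W \<eta> * W' (insert e \<eta>') \<le> W (insert e \<eta>) * W' \<eta>'"
      using \<eta>' that nin by (intro R) auto
    moreover have "0 < W' \<eta>'" using W'[of \<eta>'] sub[of \<eta>'] \<eta>' that by auto
    ultimately show ?thesis by (simp add: \<eta>'(2) pos_divide_le_eq)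
  qed
  have "b1 / b0 \<le> (\<Sum>\<eta>\<in>Pow E. W' \<eta> * r \<eta>) / b0"
    unfolding b1_def using pos by (intro divide_right_mono sum_mono r_ge) auto
  also have "\<dots> \<le> (\<Sum>\<eta>\<in>Pow E. W \<eta> * r \<eta>) / a0" unfolding a0_def b0_def
  proof (rule insert.IH)
    fix \<eta> \<eta>' d assume *: "\<eta>' \<subseteq> \<eta>" "\<eta> \<subseteq> E" "d \<in> E - \<eta>"
    then show "W \<eta> * W' (insert d \<eta>') \<le> W (insert d \<eta>) * W' \<eta>'" by (intro R) auto
  qed (use W W' r_mono sub in auto)
  also have "\<dots> \<le> a1 / a0"
    unfolding a1_def using pos by (intro divide_right_mono sum_mono r_le) auto
  finally have odds: "b1 * a0 \<le> a1 * b0" using pos by (simp add: field_simps)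
  define p p' where "p = a1 / (a0 + a1)" and "p' = b1 / (b0 + b1)"
  have pp: "0 \<le> p'" "p' \<le> p" "p \<le> 1"
    using odds pos by (auto simp: p_def p'_def field_simps)
  have "(\<Sum>\<eta>\<in>Pow (insert e E). W' \<eta> * f \<eta>) / (\<Sum>\<eta>\<in>Pow (insert e E). W' \<eta>) = (b0 * B0 + b1 * B1) / (b0 + b1)"
    using pos by (simp add: sum_Pow_insert fin nin B0_def B1_def b0_def[symmetric] b1_def[symmetric])
  also have "\<dots> = p' * B1 + (1 - p') * B0"
  proof -
    have "1 - p' = b0 / (b0 + b1)" using pos by (simp add: p'_def field_simps)
    then show ?thesis by (simp add: p'_def add_divide_distrib mult.commute)
  qed
  \<comment> \<open>The mixture for \<open>W'\<close> turns into the one for \<open>W\<close> by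
    moving the mass p - p' from the closed to the open state.\<close>
  also have "\<dots> \<le> p' * A1 + (p - p') * A1 + (1 - p) * A0"
  proof -
    have "p' * B1 \<le> p' * A1" "(p - p') * B0 \<le> (p - p') * A1" "(1 - p) * B0 \<le> (1 - p) * A0"
      using pp 11 00 B0A1 by (auto intro: mult_left_mono)
    then show ?thesis by (simp add: algebra_simps)
  qed
  also have "\<dots> = (a0 * A0 + a1 * A1) / (a0 + a1)"
  proof -
    have p1: "1 - p = a0 / (a0 + a1)" using pos by (simp add: p_def field_simps)
    have "p' * A1 + (p - p') * A1 + (1 - p) * A0 = p * A1 + (1 - p) * A0"
      by (simp add: algebra_simps)
    also have "\<dots> = (a0 * A0 + a1 * A1) / (a0 + a1)"
      unfolding p1 by (simp add: p_def add_divide_distrib mult.commute)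
    finally show ?thesis .
  qed
  also have "\<dots> = (\<Sum>\<eta>\<in>Pow (insert e E). W \<eta> * f \<eta>) / (\<Sum>\<eta>\<in>Pow (insert e E). W \<eta>)"
    using pos by (simp add: sum_Pow_insert fin nin A0_def A1_def a0_def[symmetric] a1_def[symmetric])
  finally show ?case .
qed

section \<open>Random-cluster weights\<close>

definition conn :: "'v set set \<Rightarrow> 'v \<Rightarrow> 'v \<Rightarrow> bool" where
  "conn \<omega> x y \<longleftrightarrow> (x, y) \<in> {(u, v). {u, v} \<in> \<omega>}\<^sup>*"

definition col :: "'c set \<Rightarrow> 'v set \<Rightarrow> 'v set set \<Rightarrow> ('v \<Rightarrow> 'c) set" where
  "col T V \<omega> = {\<sigma> \<in> V \<rightarrow>\<^sub>E T. \<forall>x y. {x, y} \<in> \<omega> \<longrightarrow> \<sigma> x = \<sigma> y}"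

lemma conn_refl [simp]: "conn \<omega> x x"
  by (simp add: conn_def)

lemma conn_edge: "{x, y} \<in> \<omega> \<Longrightarrow> conn \<omega> x y"
  by (auto simp: conn_def)

lemma conn_trans: "conn \<omega> x y \<Longrightarrow> conn \<omega> y z \<Longrightarrow> conn \<omega> x z"
  unfolding conn_def by (rule rtrancl_trans)

lemma conn_sym: "conn \<omega> x y \<longleftrightarrow> conn \<omega> y x"
proof -
  have "sym {(u, v). {u, v} \<in> \<omega>}" by (auto simp: sym_def insert_commute)
  then show ?thesis unfolding conn_def by (meson sym_rtrancl symE)
qed

lemma conn_mono: "\<omega> \<subseteq> \<omega>' \<Longrightarrow> conn \<omega> x y \<Longrightarrow> conn \<omega>' x y"
  unfolding conn_def by (erule rtrancl_mono[THEN subsetD, rotated]) auto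

lemma conn_induct [consumes 1, case_names refl step]:
  assumes "conn \<omega> x y" "P x"
    "\<And>y z. conn \<omega> x y \<Longrightarrow> P y \<Longrightarrow> {y, z} \<in> \<omega> \<Longrightarrow> P z"
  shows "P y"
  using assms(1) unfolding conn_def
proof (induction rule: rtrancl_induct)
  case base
  show ?case by (rule assms(2))
next
  case (step y z)
  then show ?case using assms(3)[of y z] by (simp add: conn_def)
qed

lemma col_conn:
  assumes "\<sigma> \<in> col T V \<omega>" "conn \<omega> x y"
  shows "\<sigma> x = \<sigma> y"
  using assms(2)
proof (induction rule: conn_induct)
  case refl
  show ?case by simp
next
  case (step y z)
  then show ?case using assms(1) by (auto simp: col_def)
qed

lemma finite_col: "finite V \<Longrightarrow> finite T \<Longrightarrow> finite (col T V \<omega>)"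
  by (rule finite_subset[of _ "V \<rightarrow>\<^sub>E T"]) (auto simp: col_def finite_PiE)

lemma const_in_col: "\<omega> \<subseteq> Pow V \<Longrightarrow> t \<in> T \<Longrightarrow> (\<lambda>v\<in>V. t) \<in> col T V \<omega>"
  by (auto simp: col_def)

text \<open>Exchanging two colours on the cluster of one pinned point is a bijection of colourings
  that leaves the other pinned clusters alone, so each pinned point takes every colour equally
  often. The product form avoids a division.\<close>

lemma card_col_pinned:
  assumes "finite V" "finite T" "\<omega> \<subseteq> Pow V" "finite X" "X \<subseteq> V"
    and "\<And>x y. x \<in> X \<Longrightarrow> y \<in> X \<Longrightarrow> x \<noteq> y \<Longrightarrow> \<not> conn \<omega> x y"
    and "\<And>x. x \<in> X \<Longrightarrow> \<tau> x \<in> T"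
  shows "card {\<sigma> \<in> col T V \<omega>. \<forall>x\<in>X. \<sigma> x = \<tau> x} * card T ^ card X = card (col T V \<omega>)"
  using assms(4-7)
proof (induction X rule: finite_induct)
  case empty
  then show ?case by simp
next
  case (insert x X)
  define C where "C t = {\<sigma> \<in> col T V \<omega>. (\<forall>y\<in>X. \<sigma> y = \<tau> y) \<and> \<sigma> x = t}" for t
  have finC: "finite (C t)" for t unfolding C_def using finite_col[OF assms(1,2)] by simp
  \<comment> \<open>Transposes t and t' on the cluster of \<open>x\<close>; the restriction to
    \<open>V\<close> keeps the result extensional.\<close>
  define F where "F t t' \<sigma> = (\<lambda>v\<in>V. if conn \<omega> x v then Transposition.transpose t t' (\<sigma> v) else \<sigma> v)" for t t' and \<sigma> :: "'a \<Rightarrow> 'b"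
  have F_in: "F t t' \<sigma> \<in> C t'" if "\<sigma> \<in> C t" "t \<in> T" "t' \<in> T" for t t' \<sigma>
  proof -
    have \<sigma>: "\<sigma> \<in> V \<rightarrow>\<^sub>E T" "\<And>u v. {u, v} \<in> \<omega> \<Longrightarrow> \<sigma> u = \<sigma> v" "\<And>y. y \<in> X \<Longrightarrow> \<sigma> y = \<tau> y" "\<sigma> x = t"
      using that by (auto simp: C_def col_def)
    have "F t t' \<sigma> \<in> V \<rightarrow>\<^sub>E T"
      unfolding F_def using \<sigma>(1) that by (auto simp: Transposition.transpose_def)
    moreover have "F t t' \<sigma> u = F t t' \<sigma> v" if "{u, v} \<in> \<omega>" for u v
    proof -
      have "u \<in> V" "v \<in> V" using that assms(3) by auto
      moreover have "conn \<omega> x u \<longleftrightarrow> conn \<omega> x v"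
        using that conn_edge[of u v] conn_trans conn_sym by metis
      ultimately show ?thesis using \<sigma>(2)[OF that] by (simp add: F_def)
    qed
    moreover have "F t t' \<sigma> y = \<tau> y" if "y \<in> X" for y
    proof -
      have "\<not> conn \<omega> x y" using insert.prems(2) insert.hyps(2) that by auto
      then show ?thesis using that insert.prems(1) \<sigma>(3) by (auto simp: F_def)
    qed
    moreover have "F t t' \<sigma> x = t'" using insert.prems(1) \<sigma>(4) by (simp add: F_def)
    ultimately show ?thesis by (auto simp: C_def col_def)
  qed
  have F_inv: "F t' t (F t t' \<sigma>) = \<sigma>" if "\<sigma> \<in> C t" for t t' \<sigma>
  proof
    fix v
    have "\<sigma> \<in> extensional V" using that by (auto simp: C_def col_def PiE_def)
    moreover have "Transposition.transpose t' t (Transposition.transpose t t' a) = a" for a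
      by (simp add: Transposition.transpose_def)
    ultimately show "F t' t (F t t' \<sigma>) v = \<sigma> v"
      using extensional_arb[of \<sigma> V v] by (cases "v \<in> V") (simp_all add: F_def)
  qed
  have cc: "card (C t) = card (C t')" if "t \<in> T" "t' \<in> T" for t t'
    by (rule bij_betw_same_card[of "F t t'"], rule bij_betw_byWitness[where f' = "F t' t"])
       (use F_in F_inv that in auto)
  have "card (C t) = card (C (\<tau> x))" if "t \<in> T" for t
    by (rule cc[OF that]) (use insert.prems(3) in simp)
  moreover have "{\<sigma> \<in> col T V \<omega>. \<forall>y\<in>X. \<sigma> y = \<tau> y} = (\<Union>t\<in>T. C t)"
    using insert.prems(1) by (auto simp: C_def col_def)
  moreover have "card (\<Union>t\<in>T. C t) = (\<Sum>t\<in>T. card (C t))"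
    using assms(2) finC by (intro card_UN_disjoint) (auto simp: C_def)
  ultimately have "card {\<sigma> \<in> col T V \<omega>. \<forall>y\<in>X. \<sigma> y = \<tau> y} = card T * card (C (\<tau> x))"
    by simp
  moreover have "C (\<tau> x) = {\<sigma> \<in> col T V \<omega>. \<forall>y\<in>insert x X. \<sigma> y = \<tau> y}"
    by (auto simp: C_def)
  moreover have "card {\<sigma> \<in> col T V \<omega>. \<forall>y\<in>X. \<sigma> y = \<tau> y} * card T ^ card X = card (col T V \<omega>)"
    using insert by auto
  ultimately show ?case using insert.hyps by (simp add: ac_simps)
qed

text \<open>Sum over the common colour of the case of two pinned points.\<close>

lemma card_col_agree:
  assumes "finite V" "finite T" "\<omega> \<subseteq> Pow V" "x \<in> V" "y \<in> V" "\<not> conn \<omega> x y"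
  shows "card {\<sigma> \<in> col T V \<omega>. \<sigma> x = \<sigma> y} * card T = card (col T V \<omega>)"
proof -
  have xy: "x \<noteq> y" using assms(6) by auto
  define C where "C t = {\<sigma> \<in> col T V \<omega>. \<sigma> x = t \<and> \<sigma> y = t}" for t
  have "card (C t) * (card T * card T) = card (col T V \<omega>)" if "t \<in> T" for t
  proof -
    have "card {\<sigma> \<in> col T V \<omega>. \<forall>z\<in>{x, y}. \<sigma> z = t} * card T ^ card {x, y} = card (col T V \<omega>)"
      by (rule card_col_pinned) (use assms that conn_sym[of \<omega> y x] in auto)
    then show ?thesis using xy by (simp add: C_def power2_eq_square)
  qed
  then have "(\<Sum>t\<in>T. card (C t)) * (card T * card T) = card T * card (col T V \<omega>)"
    by (simp add: sum_distrib_right)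
  moreover have "{\<sigma> \<in> col T V \<omega>. \<sigma> x = \<sigma> y} = (\<Union>t\<in>T. C t)"
    using assms(4,5) by (auto simp: C_def col_def)
  moreover have "card (\<Union>t\<in>T. C t) = (\<Sum>t\<in>T. card (C t))"
    using assms(2) finite_col[OF assms(1,2)] by (intro card_UN_disjoint) (auto simp: C_def)
  ultimately have "card T * (card {\<sigma> \<in> col T V \<omega>. \<sigma> x = \<sigma> y} * card T) = card T * card (col T V \<omega>)"
    by (simp add: ac_simps)
  \<comment> \<open>The factor to be cancelled may vanish; without colours the nonempty
    \<open>V\<close> has no colouring either.\<close>
  moreover have "card (col T V \<omega>) = 0" if "card T = 0"
    using that assms(2,4) by (auto simp: col_def)
  ultimately show ?thesis by (cases "card T = 0") auto
qed

lemma sum_Pow_split: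
  fixes g :: "'a set \<Rightarrow> 'b::comm_monoid_add"
  assumes "finite E'" "E \<subseteq> E'"
  shows "(\<Sum>\<omega>\<in>Pow E'. g \<omega>) = (\<Sum>\<xi>\<in>Pow (E' - E). \<Sum>\<eta>\<in>Pow E. g (\<xi> \<union> \<eta>))"
proof -
  have "(\<Sum>\<xi>\<in>Pow (E' - E). \<Sum>\<eta>\<in>Pow E. g (\<xi> \<union> \<eta>)) = (\<Sum>(\<xi>, \<eta>)\<in>Pow (E' - E) \<times> Pow E. g (\<xi> \<union> \<eta>))"
    by (rule sum.cartesian_product)
  also have "\<dots> = (\<Sum>\<omega>\<in>Pow E'. g \<omega>)"
    by (rule sum.reindex_bij_witness[where i = "\<lambda>\<omega>. (\<omega> - E, \<omega> \<inter> E)" and j = "\<lambda>(\<xi>, \<eta>). \<xi> \<union> \<eta>"])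
       (use assms(2) in auto)
  finally show ?thesis by simp
qed

definition graph :: "'v set \<Rightarrow> 'v set set \<Rightarrow> bool" where
  "graph V E \<longleftrightarrow> finite V \<and> (\<forall>e\<in>E. \<exists>x\<in>V. \<exists>y\<in>V. e = {x, y})"

lemma graph_subset_Pow: "graph V E \<Longrightarrow> E \<subseteq> Pow V"
  by (auto simp: graph_def)

lemma graph_finite: "graph V E \<Longrightarrow> finite V" "graph V E \<Longrightarrow> finite E"
  using graph_subset_Pow[of V E] by (auto simp: graph_def intro: finite_subset)

lemma graph_edge:
  assumes "graph V E" "e \<in> E"
  obtains x y where "e = {x, y}" "x \<in> V" "y \<in> V"
  using assms by (auto simp: graph_def)

lemma conn_image:
  assumes "inj \<phi>"
  shows "conn ((`) \<phi> ` \<omega>) (\<phi> x) (\<phi> y) \<longleftrightarrow> conn \<omega> x y"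
proof
  assume "conn \<omega> x y"
  then show "conn ((`) \<phi> ` \<omega>) (\<phi> x) (\<phi> y)"
  proof (induction rule: conn_induct)
    case (step y z)
    then have "{\<phi> y, \<phi> z} \<in> (`) \<phi> ` \<omega>" by (metis image_eqI image_empty image_insert)
    with step show ?case using conn_edge conn_trans by metis
  qed simp
next
  have "\<exists>z. \<phi> z = w \<and> conn \<omega> x z" if "conn ((`) \<phi> ` \<omega>) (\<phi> x) w" for w
    using that
  proof (induction rule: conn_induct)
    case refl
    then show ?case by auto
  next
    case (step v w)
    then obtain z where z: "\<phi> z = v" "conn \<omega> x z" by auto
    from step obtain e where e: "e \<in> \<omega>" "{v, w} = \<phi> ` e" by auto
    then obtain w' where w': "w' \<in> e" "\<phi> w' = w" by (metis imageE insertCI)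
    have "\<phi> ` e = \<phi> ` {z, w'}" using e z w' by auto
    then have "e = {z, w'}" by (rule inj_image_eq_iff[OF assms, THEN iffD1])
    then have "conn \<omega> x w'" using z e conn_edge conn_trans by metis
    then show ?case using w' by auto
  qed
  moreover assume "conn ((`) \<phi> ` \<omega>) (\<phi> x) (\<phi> y)"
  ultimately show "conn \<omega> x y" using assms by (auto dest: injD)
qed

section \<open>The free random-cluster measure at the self-dual point: domination, FKG, finite
  energy\<close>

locale fk =
  fixes q :: nat
  assumes q_ge_2: "2 \<le> q"
begin

text \<open>The factor \<open>q ^ (number of clusters)\<close> is obtained as the number of colourings that are constant
  on clusters. The edge weight \<open>p / (1 - p) = sqrt q\<close> is the self-dual one, which is also the one
  given by \<^const>\<open>potts_beta_c\<close>.\<close>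

definition wt :: "'v set \<Rightarrow> 'v set set \<Rightarrow> real" where
  "wt V \<omega> = sqrt q ^ card \<omega> * card (col {..<q} V \<omega>)"

text \<open>Expectation under the random-cluster measure with free boundary conditions.\<close>

definition ex :: "'v set \<Rightarrow> 'v set set \<Rightarrow> ('v set set \<Rightarrow> real) \<Rightarrow> real" where
  "ex V E f = (\<Sum>\<omega>\<in>Pow E. wt V \<omega> * f \<omega>) / (\<Sum>\<omega>\<in>Pow E. wt V \<omega>)"

lemma sqrt_q: "1 \<le> sqrt q" "0 < sqrt q" "1 / sqrt q \<le> sqrt q" "sqrt q * sqrt q = q"
proof -
  show *: "1 \<le> sqrt q" using q_ge_2 by simp
  then show "0 < sqrt q" by linarith
  then show "1 / sqrt q \<le> sqrt q" using q_ge_2 by (simp add: field_simps)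
qed simp

lemma wt_pos:
  assumes "graph V E" "\<omega> \<subseteq> E"
  shows "0 < wt V \<omega>"
proof -
  have "(\<lambda>v\<in>V. 0) \<in> col {..<q} V \<omega>"
    using assms graph_subset_Pow[OF assms(1)] q_ge_2 by (intro const_in_col) auto
  then have "card (col {..<q} V \<omega>) \<noteq> 0"
    using finite_col[of V "{..<q}"] graph_finite[OF assms(1)] by auto
  then show ?thesis using q_ge_2 by (simp add: wt_def)
qed

text \<open>A new edge contributes sqrt q; if it joins two clusters, one factor q is lost as well.
  The stochastic comparisons below use the weights only through this ratio.\<close>

lemma wt_insert:
  assumes "graph V E" "\<omega> \<subseteq> E" "{x, y} \<in> E - \<omega>"
  shows "wt V (insert {x, y} \<omega>) = wt V \<omega> * (if conn \<omega> x y then sqrt q else 1 / sqrt q)"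
proof -
  have fin: "finite \<omega>" "finite V" using graph_finite assms finite_subset by blast+
  have sub: "\<omega> \<subseteq> Pow V" "x \<in> V" "y \<in> V" using graph_subset_Pow[OF assms(1)] assms by auto
  have eq: "col {..<q} V (insert {x, y} \<omega>) = {\<sigma> \<in> col {..<q} V \<omega>. \<sigma> x = \<sigma> y}"
    by (auto simp: col_def doubleton_eq_iff)
  have c: "card (insert {x, y} \<omega>) = Suc (card \<omega>)" using fin assms(3) by simp
  show ?thesis
  proof (cases "conn \<omega> x y")
    case True
    then have "col {..<q} V (insert {x, y} \<omega>) = col {..<q} V \<omega>"
      unfolding eq using col_conn[of _ "{..<q}" V \<omega> x y] by auto
    with True show ?thesis by (simp add: wt_def c)
  next
    case False
    define a b where "a = card (col {..<q} V (insert {x, y} \<omega>))" and "b = card (col {..<q} V \<omega>)"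
    have "a * card {..<q} = b"
      unfolding a_def b_def eq by (rule card_col_agree) (use fin sub False in auto)
    then have "real b = real a * (sqrt q * sqrt q)"
      unfolding sqrt_q(4) by (metis card_lessThan of_nat_mult)
    then have "real b * (1 / sqrt q) = sqrt q * real a"
      using sqrt_q(2) by (simp only: mult.assoc) (simp add: field_simps)
    then have "sqrt q ^ card \<omega> * (real b * (1 / sqrt q)) = sqrt q ^ card \<omega> * (sqrt q * real a)" by simp
    with False show ?thesis
      by (simp add: wt_def c a_def[symmetric] b_def[symmetric] mult.assoc[symmetric] del: real_sqrt_mult_self)
  qed
qed

lemma Z_pos: "graph V E \<Longrightarrow> 0 < (\<Sum>\<omega>\<in>Pow E. wt V \<omega>)"
  using graph_finite by (intro sum_pos) (auto intro: wt_pos)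

lemma ex_const [simp]: "graph V E \<Longrightarrow> ex V E (\<lambda>\<omega>. c) = c"
  using Z_pos[of V E] by (simp add: ex_def sum_distrib_right[symmetric])

lemma ex_add: "ex V E (\<lambda>\<omega>. f \<omega> + g \<omega>) = ex V E f + ex V E g"
  by (simp add: ex_def distrib_left sum.distrib add_divide_distrib)

lemma ex_cmult: "ex V E (\<lambda>\<omega>. c * f \<omega>) = c * ex V E f"
  by (simp add: ex_def sum_distrib_left mult.left_commute)

lemma ex_diff: "ex V E (\<lambda>\<omega>. f \<omega> - g \<omega>) = ex V E f - ex V E g"
  by (simp add: ex_def right_diff_distrib sum_subtractf diff_divide_distrib)

lemma ex_sum: "ex V E (\<lambda>\<omega>. \<Sum>i\<in>I. f i \<omega>) = (\<Sum>i\<in>I. ex V E (f i))"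
proof -
  have "(\<Sum>\<omega>\<in>Pow E. wt V \<omega> * (\<Sum>i\<in>I. f i \<omega>)) = (\<Sum>i\<in>I. \<Sum>\<omega>\<in>Pow E. wt V \<omega> * f i \<omega>)"
    by (simp add: sum_distrib_left sum.swap[of _ "Pow E"])
  then show ?thesis by (simp add: ex_def sum_divide_distrib)
qed

lemma ex_mono:
  assumes "graph V E" "\<And>\<omega>. \<omega> \<subseteq> E \<Longrightarrow> f \<omega> \<le> g \<omega>"
  shows "ex V E f \<le> ex V E g"
  unfolding ex_def using Z_pos[OF assms(1)] wt_pos[OF assms(1)]
  by (intro divide_right_mono sum_mono mult_left_mono assms) (auto simp: less_imp_le)

lemma ex_nonneg: "graph V E \<Longrightarrow> (\<And>\<omega>. \<omega> \<subseteq> E \<Longrightarrow> 0 \<le> f \<omega>) \<Longrightarrow> 0 \<le> ex V E f"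
  using ex_mono[of V E "\<lambda>_. 0" f] by simp

text \<open>Holley's criterion with the free measure as the smaller one: \<open>W\<close> has to
  give each edge at least the odds that \<open>wt\<close> gives it at every smaller
  configuration.\<close>

lemma ex_le_of_ratio:
  fixes W f :: "'v set set \<Rightarrow> real"
  assumes "graph V E"
    and "\<And>\<eta>. \<eta> \<subseteq> E \<Longrightarrow> 0 < W \<eta>"
    and "\<And>\<eta> \<eta>' x y. \<lbrakk>\<eta>' \<subseteq> \<eta>; \<eta> \<subseteq> E; {x, y} \<in> E - \<eta>\<rbrakk>
      \<Longrightarrow> W \<eta> * (if conn \<eta>' x y then sqrt q else 1 / sqrt q) \<le> W (insert {x, y} \<eta>)"
    and "\<And>\<eta> \<eta>'. \<lbrakk>\<eta>' \<subseteq> \<eta>; \<eta> \<subseteq> E\<rbrakk> \<Longrightarrow> f \<eta>' \<le> f \<eta>"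
  shows "ex V E f \<le> (\<Sum>\<eta>\<in>Pow E. W \<eta> * f \<eta>) / (\<Sum>\<eta>\<in>Pow E. W \<eta>)"
  unfolding ex_def
proof (rule holley)
  fix \<eta> \<eta>' e assume *: "\<eta>' \<subseteq> \<eta>" "\<eta> \<subseteq> E" "e \<in> E - \<eta>"
  obtain x y where e: "e = {x, y}" using * graph_edge[OF assms(1), of e] by blast
  have "W \<eta> * wt V (insert e \<eta>') = W \<eta> * (if conn \<eta>' x y then sqrt q else 1 / sqrt q) * wt V \<eta>'"
    unfolding e by (subst wt_insert[OF assms(1)]) (use * e in auto)
  also have "\<dots> \<le> W (insert e \<eta>) * wt V \<eta>'"
    unfolding e by (intro mult_right_mono assms(3)) (use * e wt_pos[OF assms(1), of \<eta>'] in \<open>auto simp: less_imp_le\<close>)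
  finally show "W \<eta> * wt V (insert e \<eta>') \<le> W (insert e \<eta>) * wt V \<eta>'" .
qed (use assms wt_pos[OF assms(1)] graph_finite in auto)

text \<open>Given the configuration outside \<open>E\<close>, connections through it can only raise
  the odds of an edge of \<open>E\<close>, so the conditional measure inside dominates the free one.
  The weight \<open>h\<close> on the outside expresses this conditional statement without
  conditioning.\<close>

lemma domain_markov:
  fixes f h :: "'v set set \<Rightarrow> real"
  assumes "graph V E" "graph V' E'" "E \<subseteq> E'"
    and f: "\<And>\<eta> \<eta>'. \<lbrakk>\<eta>' \<subseteq> \<eta>; \<eta> \<subseteq> E\<rbrakk> \<Longrightarrow> f \<eta>' \<le> f \<eta>"
    and h: "\<And>\<xi>. \<xi> \<subseteq> E' - E \<Longrightarrow> 0 \<le> h \<xi>"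
  shows "ex V E f * ex V' E' (\<lambda>\<omega>. h (\<omega> - E)) \<le> ex V' E' (\<lambda>\<omega>. f (\<omega> \<inter> E) * h (\<omega> - E))"
proof -
  have fin: "finite E'" using graph_finite assms(2) by blast
  have cut: "(\<xi> \<union> \<eta>) \<inter> E = \<eta>" "(\<xi> \<union> \<eta>) - E = \<xi>" if "\<xi> \<in> Pow (E' - E)" "\<eta> \<in> Pow E" for \<xi> \<eta>
    using that by auto
  have le: "ex V E f * (\<Sum>\<eta>\<in>Pow E. wt V' (\<xi> \<union> \<eta>)) \<le> (\<Sum>\<eta>\<in>Pow E. wt V' (\<xi> \<union> \<eta>) * f \<eta>)"
    if \<xi>: "\<xi> \<in> Pow (E' - E)" for \<xi>
  proof -
    have pos: "0 < wt V' (\<xi> \<union> \<eta>)" if "\<eta> \<subseteq> E" for \<eta>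
      using that \<xi> assms(3) by (intro wt_pos[OF assms(2)]) auto
    have "ex V E f \<le> (\<Sum>\<eta>\<in>Pow E. wt V' (\<xi> \<union> \<eta>) * f \<eta>) / (\<Sum>\<eta>\<in>Pow E. wt V' (\<xi> \<union> \<eta>))"
    proof (rule ex_le_of_ratio[OF assms(1)])
      fix \<eta> \<eta>' x y assume *: "\<eta>' \<subseteq> \<eta>" "\<eta> \<subseteq> E" "{x, y} \<in> E - \<eta>"
      have "wt V' (\<xi> \<union> insert {x, y} \<eta>) = wt V' (insert {x, y} (\<xi> \<union> \<eta>))" by simp
      also have "\<dots> = wt V' (\<xi> \<union> \<eta>) * (if conn (\<xi> \<union> \<eta>) x y then sqrt q else 1 / sqrt q)"
        using * \<xi> assms(3) by (intro wt_insert[OF assms(2)]) auto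
      also have "\<dots> \<ge> wt V' (\<xi> \<union> \<eta>) * (if conn \<eta>' x y then sqrt q else 1 / sqrt q)"
        using pos[OF *(2)] conn_mono[of \<eta>' "\<xi> \<union> \<eta>" x y] * sqrt_q(3) by (intro mult_left_mono) auto
      finally show "wt V' (\<xi> \<union> \<eta>) * (if conn \<eta>' x y then sqrt q else 1 / sqrt q) \<le> wt V' (\<xi> \<union> insert {x, y} \<eta>)" .
    qed (rule pos f; assumption)+
    moreover have "0 < (\<Sum>\<eta>\<in>Pow E. wt V' (\<xi> \<union> \<eta>))"
      using pos graph_finite[OF assms(1)] by (intro sum_pos) auto
    ultimately show ?thesis by (simp add: pos_le_divide_eq)
  qed
  have "ex V E f * (\<Sum>\<omega>\<in>Pow E'. wt V' \<omega> * h (\<omega> - E))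
      = (\<Sum>\<xi>\<in>Pow (E' - E). h \<xi> * (ex V E f * (\<Sum>\<eta>\<in>Pow E. wt V' (\<xi> \<union> \<eta>))))"
    unfolding sum_Pow_split[OF fin assms(3)] sum_distrib_left
    by (intro sum.cong refl) (simp add: cut(2) ac_simps)
  also have "\<dots> \<le> (\<Sum>\<xi>\<in>Pow (E' - E). h \<xi> * (\<Sum>\<eta>\<in>Pow E. wt V' (\<xi> \<union> \<eta>) * f \<eta>))"
    by (intro sum_mono mult_left_mono le h) auto
  also have "\<dots> = (\<Sum>\<omega>\<in>Pow E'. wt V' \<omega> * (f (\<omega> \<inter> E) * h (\<omega> - E)))"
    unfolding sum_Pow_split[OF fin assms(3)] sum_distrib_left
    by (intro sum.cong refl) (simp only: cut, simp only: mult_ac)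
  finally show ?thesis
    using Z_pos[OF assms(2)] unfolding ex_def[of V'] by (simp add: divide_right_mono)
qed

lemma domain_mono:
  fixes f :: "'v set set \<Rightarrow> real"
  assumes "graph V E" "graph V' E'" "E \<subseteq> E'"
    and "\<And>\<eta> \<eta>'. \<lbrakk>\<eta>' \<subseteq> \<eta>; \<eta> \<subseteq> E\<rbrakk> \<Longrightarrow> f \<eta>' \<le> f \<eta>"
  shows "ex V E f \<le> ex V' E' (\<lambda>\<omega>. f (\<omega> \<inter> E))"
proof -
  have "ex V E f * ex V' E' (\<lambda>\<omega>. 1) \<le> ex V' E' (\<lambda>\<omega>. f (\<omega> \<inter> E) * 1)"
    by (rule domain_markov[OF assms(1-3), of f "\<lambda>_. 1", OF assms(4)]) auto
  then show ?thesis using assms(2) by simp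
qed

text \<open>Reweighting by an increasing positive density raises the odds of every edge, so the
  reweighted measure dominates the original one; its mean of \<open>f\<close> is E[f g] /
  E[g].\<close>

lemma fkg:
  fixes f g :: "'v set set \<Rightarrow> real"
  assumes "graph V E"
    and f: "\<And>\<eta> \<eta>'. \<lbrakk>\<eta>' \<subseteq> \<eta>; \<eta> \<subseteq> E\<rbrakk> \<Longrightarrow> f \<eta>' \<le> f \<eta>"
    and g: "\<And>\<eta> \<eta>'. \<lbrakk>\<eta>' \<subseteq> \<eta>; \<eta> \<subseteq> E\<rbrakk> \<Longrightarrow> g \<eta>' \<le> g \<eta>"
  shows "ex V E f * ex V E g \<le> ex V E (\<lambda>\<omega>. f \<omega> * g \<omega>)"
proof -
  \<comment> \<open>Shifts \<open>g\<close> to be at least 1, since a density must be positive; the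
    shift contributes equally to both sides of the claim.\<close>
  define c where "c = 1 - g {}"
  have gc: "1 \<le> g \<eta> + c" if "\<eta> \<subseteq> E" for \<eta>
    using g[of "{}" \<eta>] that by (simp add: c_def)
  define W where "W \<eta> = wt V \<eta> * (g \<eta> + c)" for \<eta>
  have W: "0 < W \<eta>" if "\<eta> \<subseteq> E" for \<eta>
    using gc[OF that] wt_pos[OF assms(1) that] by (simp add: W_def)
  have "ex V E f \<le> (\<Sum>\<eta>\<in>Pow E. W \<eta> * f \<eta>) / (\<Sum>\<eta>\<in>Pow E. W \<eta>)"
  proof (rule ex_le_of_ratio[OF assms(1) W _ f])
    fix \<eta> \<eta>' x y assume *: "\<eta>' \<subseteq> \<eta>" "\<eta> \<subseteq> E" "{x, y} \<in> E - \<eta>"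
    have "W \<eta> * (if conn \<eta>' x y then sqrt q else 1 / sqrt q)
        \<le> wt V \<eta> * (g \<eta> + c) * (if conn \<eta> x y then sqrt q else 1 / sqrt q)"
      using W[OF *(2)] conn_mono[OF *(1), of x y] sqrt_q(3)
      unfolding W_def by (intro mult_left_mono) auto
    also have "\<dots> = wt V (insert {x, y} \<eta>) * (g \<eta> + c)"
      using * by (simp add: wt_insert[OF assms(1)])
    also have "\<dots> \<le> W (insert {x, y} \<eta>)"
      unfolding W_def using * g[of \<eta> "insert {x, y} \<eta>"] wt_pos[OF assms(1), of "insert {x, y} \<eta>"]
      by (intro mult_left_mono) auto
    finally show "W \<eta> * (if conn \<eta>' x y then sqrt q else 1 / sqrt q) \<le> W (insert {x, y} \<eta>)" .
  qed
  moreover have WP: "0 < (\<Sum>\<eta>\<in>Pow E. W \<eta>)"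
    using W graph_finite[OF assms(1)] by (intro sum_pos) auto
  ultimately have "ex V E f * (\<Sum>\<eta>\<in>Pow E. W \<eta>) \<le> (\<Sum>\<eta>\<in>Pow E. W \<eta> * f \<eta>)"
    by (simp add: pos_le_divide_eq)
  then have "ex V E f * (\<Sum>\<eta>\<in>Pow E. W \<eta>) / (\<Sum>\<omega>\<in>Pow E. wt V \<omega>)
      \<le> (\<Sum>\<eta>\<in>Pow E. W \<eta> * f \<eta>) / (\<Sum>\<omega>\<in>Pow E. wt V \<omega>)"
    using Z_pos[OF assms(1)] by (intro divide_right_mono) auto
  moreover have "(\<Sum>\<eta>\<in>Pow E. W \<eta>) / (\<Sum>\<omega>\<in>Pow E. wt V \<omega>) = ex V E (\<lambda>\<omega>. g \<omega> + c)"
    by (simp add: ex_def W_def)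
  moreover have "(\<Sum>\<eta>\<in>Pow E. W \<eta> * f \<eta>) / (\<Sum>\<omega>\<in>Pow E. wt V \<omega>) = ex V E (\<lambda>\<omega>. f \<omega> * g \<omega> + c * f \<omega>)"
    by (simp add: ex_def W_def algebra_simps)
  ultimately have "ex V E f * ex V E (\<lambda>\<omega>. g \<omega> + c) \<le> ex V E (\<lambda>\<omega>. f \<omega> * g \<omega> + c * f \<omega>)"
    by (metis times_divide_eq_right)
  then show ?thesis using assms(1) by (simp add: ex_add ex_cmult algebra_simps)
qed

lemma fkg_antimono:
  fixes f g :: "'v set set \<Rightarrow> real"
  assumes "graph V E"
    and f: "\<And>\<eta> \<eta>'. \<lbrakk>\<eta>' \<subseteq> \<eta>; \<eta> \<subseteq> E\<rbrakk> \<Longrightarrow> f \<eta> \<le> f \<eta>'"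
    and g: "\<And>\<eta> \<eta>'. \<lbrakk>\<eta>' \<subseteq> \<eta>; \<eta> \<subseteq> E\<rbrakk> \<Longrightarrow> g \<eta> \<le> g \<eta>'"
  shows "ex V E f * ex V E g \<le> ex V E (\<lambda>\<omega>. f \<omega> * g \<omega>)"
proof -
  have "ex V E (\<lambda>\<omega>. (-1) * f \<omega>) * ex V E (\<lambda>\<omega>. (-1) * g \<omega>) \<le> ex V E (\<lambda>\<omega>. ((-1) * f \<omega>) * ((-1) * g \<omega>))"
    by (rule fkg[OF assms(1)]) (simp_all add: f g)
  then show ?thesis unfolding ex_cmult by simp
qed

lemma wt_image:
  assumes "inj \<phi>" "\<omega> \<subseteq> Pow V"
  shows "wt (\<phi> ` V) ((`) \<phi> ` \<omega>) = wt V \<omega>"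
proof -
  have inj: "inj ((`) \<phi>)" using assms(1) by (simp add: inj_def inj_image_eq_iff)
  have "bij_betw (\<lambda>\<sigma>. \<lambda>v\<in>V. \<sigma> (\<phi> v)) (col {..<q} (\<phi> ` V) ((`) \<phi> ` \<omega>)) (col {..<q} V \<omega>)"
  proof (rule bij_betw_byWitness[where f' = "\<lambda>\<sigma>. \<lambda>w\<in>\<phi> ` V. \<sigma> (inv \<phi> w)"])
    show "\<forall>\<sigma>\<in>col {..<q} (\<phi> ` V) ((`) \<phi> ` \<omega>). (\<lambda>w\<in>\<phi> ` V. (\<lambda>v\<in>V. \<sigma> (\<phi> v)) (inv \<phi> w)) = \<sigma>"
    proof (intro ballI ext)
      fix \<sigma> w assume "\<sigma> \<in> col {..<q} (\<phi> ` V) ((`) \<phi> ` \<omega>)"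
      then have "\<sigma> \<in> extensional (\<phi> ` V)" by (auto simp: col_def PiE_def)
      then show "(\<lambda>w\<in>\<phi> ` V. (\<lambda>v\<in>V. \<sigma> (\<phi> v)) (inv \<phi> w)) w = \<sigma> w"
        using assms(1) extensional_arb[of \<sigma> "\<phi> ` V" w] by (auto simp: restrict_def)
    qed
    show "\<forall>\<sigma>\<in>col {..<q} V \<omega>. (\<lambda>v\<in>V. (\<lambda>w\<in>\<phi> ` V. \<sigma> (inv \<phi> w)) (\<phi> v)) = \<sigma>"
    proof (intro ballI ext)
      fix \<sigma> v assume "\<sigma> \<in> col {..<q} V \<omega>"
      then have "\<sigma> \<in> extensional V" by (auto simp: col_def PiE_def)
      then show "(\<lambda>v\<in>V. (\<lambda>w\<in>\<phi> ` V. \<sigma> (inv \<phi> w)) (\<phi> v)) v = \<sigma> v"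
        using assms(1) extensional_arb[of \<sigma> V v] by (auto simp: restrict_def)
    qed
    show "(\<lambda>\<sigma>. \<lambda>v\<in>V. \<sigma> (\<phi> v)) ` col {..<q} (\<phi> ` V) ((`) \<phi> ` \<omega>) \<subseteq> col {..<q} V \<omega>"
    proof
      fix \<tau> assume "\<tau> \<in> (\<lambda>\<sigma>. \<lambda>v\<in>V. \<sigma> (\<phi> v)) ` col {..<q} (\<phi> ` V) ((`) \<phi> ` \<omega>)"
      then obtain \<sigma> where \<sigma>: "\<sigma> \<in> \<phi> ` V \<rightarrow>\<^sub>E {..<q}" "\<And>x y. {x, y} \<in> (`) \<phi> ` \<omega> \<Longrightarrow> \<sigma> x = \<sigma> y"
        and \<tau>: "\<tau> = (\<lambda>v\<in>V. \<sigma> (\<phi> v))"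
        by (auto simp: col_def)
      have "\<tau> x = \<tau> y" if "{x, y} \<in> \<omega>" for x y
      proof -
        have "{\<phi> x, \<phi> y} \<in> (`) \<phi> ` \<omega>" using that by (metis image_eqI image_empty image_insert)
        moreover have "x \<in> V" "y \<in> V" using that assms(2) by auto
        ultimately show ?thesis using \<sigma>(2) by (simp add: \<tau>)
      qed
      then show "\<tau> \<in> col {..<q} V \<omega>" using \<sigma>(1) by (auto simp: col_def \<tau>)
    qed
    show "(\<lambda>\<sigma>. \<lambda>w\<in>\<phi> ` V. \<sigma> (inv \<phi> w)) ` col {..<q} V \<omega> \<subseteq> col {..<q} (\<phi> ` V) ((`) \<phi> ` \<omega>)"
    proof
      fix \<tau> assume "\<tau> \<in> (\<lambda>\<sigma>. \<lambda>w\<in>\<phi> ` V. \<sigma> (inv \<phi> w)) ` col {..<q} V \<omega>"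
      then obtain \<sigma> where \<sigma>: "\<sigma> \<in> V \<rightarrow>\<^sub>E {..<q}" "\<And>x y. {x, y} \<in> \<omega> \<Longrightarrow> \<sigma> x = \<sigma> y"
        and \<tau>: "\<tau> = (\<lambda>w\<in>\<phi> ` V. \<sigma> (inv \<phi> w))"
        by (auto simp: col_def)
      have "\<tau> x = \<tau> y" if xy: "{x, y} \<in> (`) \<phi> ` \<omega>" for x y
      proof -
        obtain e where e: "e \<in> \<omega>" "{x, y} = \<phi> ` e" using xy by auto
        then obtain x' y' where xy': "x' \<in> e" "\<phi> x' = x" "y' \<in> e" "\<phi> y' = y"
          by (metis imageE insertCI)
        have "\<phi> ` e = \<phi> ` {x', y'}" using e xy' by auto
        then have "e = {x', y'}" by (rule inj_image_eq_iff[OF assms(1), THEN iffD1])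
        then have "\<sigma> x' = \<sigma> y'" "x' \<in> V" "y' \<in> V" using \<sigma>(2) e assms(2) by auto
        then show ?thesis unfolding xy'(2,4)[symmetric] \<tau> using assms(1) by simp
      qed
      moreover have "\<tau> \<in> \<phi> ` V \<rightarrow>\<^sub>E {..<q}" using \<sigma>(1) assms(1) by (auto simp: \<tau>)
      ultimately show "\<tau> \<in> col {..<q} (\<phi> ` V) ((`) \<phi> ` \<omega>)" by (auto simp: col_def)
    qed
  qed
  then have "card (col {..<q} (\<phi> ` V) ((`) \<phi> ` \<omega>)) = card (col {..<q} V \<omega>)"
    by (rule bij_betw_same_card)
  moreover have "card ((`) \<phi> ` \<omega>) = card \<omega>"
    using inj by (intro card_image) (auto intro: inj_on_subset)
  ultimately show ?thesis by (simp add: wt_def)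
qed

lemma ex_image:
  assumes "inj \<phi>" "graph V E"
  shows "ex (\<phi> ` V) ((`) \<phi> ` E) f = ex V E (\<lambda>\<omega>. f ((`) \<phi> ` \<omega>))"
proof -
  have inj: "inj ((`) \<phi>)" using assms(1) by (simp add: inj_def inj_image_eq_iff)
  have "inj_on ((`) ((`) \<phi>)) (Pow E)" using inj by (simp add: inj_on_def inj_image_eq_iff)
  moreover have "Pow ((`) \<phi> ` E) = (`) ((`) \<phi>) ` Pow E" by (rule image_Pow_surj[symmetric]) simp
  moreover have "wt (\<phi> ` V) ((`) \<phi> ` \<omega>) = wt V \<omega>" if "\<omega> \<subseteq> E" for \<omega>
    using that graph_subset_Pow[OF assms(2)] by (intro wt_image assms(1)) auto
  ultimately show ?thesis by (simp add: ex_def sum.reindex)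
qed

lemma graph_image: "graph V E \<Longrightarrow> graph (\<phi> ` V) ((`) \<phi> ` E)"
  unfolding graph_def by (auto 4 4)

text \<open>Each edge changes the weight by a factor between 1 / sqrt q and sqrt q.\<close>

lemma wt_le_wt_Un:
  assumes "graph V E" "\<xi> \<subseteq> E" "F \<subseteq> E"
  shows "wt V \<xi> \<le> sqrt q ^ card F * wt V (\<xi> \<union> F)" "wt V (\<xi> \<union> F) \<le> sqrt q ^ card F * wt V \<xi>"
proof -
  have "finite F" using assms graph_finite finite_subset by blast
  then have "wt V \<xi> \<le> sqrt q ^ card F * wt V (\<xi> \<union> F) \<and> wt V (\<xi> \<union> F) \<le> sqrt q ^ card F * wt V \<xi>"
    using assms(3)
  proof (induction F rule: finite_induct)
    case (insert e F)
    obtain x y where e: "e = {x, y}" using insert graph_edge[OF assms(1), of e] by blast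
    have pos: "0 < wt V (\<xi> \<union> F)" "0 < wt V (\<xi> \<union> insert e F)" using insert assms by (auto intro!: wt_pos)
    have one: "wt V (\<xi> \<union> F) \<le> sqrt q * wt V (\<xi> \<union> insert e F) \<and> wt V (\<xi> \<union> insert e F) \<le> sqrt q * wt V (\<xi> \<union> F)"
    proof (cases "e \<in> \<xi> \<union> F")
      case True
      then have "\<xi> \<union> insert e F = \<xi> \<union> F" by auto
      moreover have "wt V (\<xi> \<union> F) \<le> sqrt q * wt V (\<xi> \<union> F)"
        using sqrt_q(1) pos mult_right_mono[of 1 "sqrt q" "wt V (\<xi> \<union> F)"] by linarith
      ultimately show ?thesis by simp
    next
      case False
      then have "wt V (insert e (\<xi> \<union> F)) = wt V (\<xi> \<union> F) * (if conn (\<xi> \<union> F) x y then sqrt q else 1 / sqrt q)"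
        unfolding e using insert assms e by (intro wt_insert[OF assms(1)]) auto
      moreover have "wt V (\<xi> \<union> F) \<le> sqrt q * (wt V (\<xi> \<union> F) * (if conn (\<xi> \<union> F) x y then sqrt q else 1 / sqrt q))"
      proof -
        have "1 \<le> sqrt q * (if conn (\<xi> \<union> F) x y then sqrt q else 1 / sqrt q)"
          using q_ge_2 by simp
        then show ?thesis using mult_left_mono[of 1 _ "wt V (\<xi> \<union> F)"] pos by (simp add: ac_simps)
      qed
      moreover have "wt V (\<xi> \<union> F) * (if conn (\<xi> \<union> F) x y then sqrt q else 1 / sqrt q) \<le> sqrt q * wt V (\<xi> \<union> F)"
        using sqrt_q(3) pos by (simp add: mult.commute mult_right_mono)
      ultimately show ?thesis by simp
    qed
    have IH: "wt V \<xi> \<le> sqrt q ^ card F * wt V (\<xi> \<union> F)" "wt V (\<xi> \<union> F) \<le> sqrt q ^ card F * wt V \<xi>"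
      using insert by auto
    have "wt V \<xi> \<le> sqrt q ^ card F * (sqrt q * wt V (\<xi> \<union> insert e F))"
      using IH(1) one by (meson mult_left_mono order_trans real_sqrt_ge_zero zero_le_power of_nat_0_le_iff)
    moreover have "wt V (\<xi> \<union> insert e F) \<le> sqrt q * (sqrt q ^ card F * wt V \<xi>)"
      using IH(2) one by (meson mult_left_mono order_trans real_sqrt_ge_zero of_nat_0_le_iff)
    ultimately show ?case using insert.hyps by (simp add: ac_simps)
  qed simp
  then show "wt V \<xi> \<le> sqrt q ^ card F * wt V (\<xi> \<union> F)" "wt V (\<xi> \<union> F) \<le> sqrt q ^ card F * wt V \<xi>"
    by auto
qed

text \<open>A change confined to \<open>F\<close> costs at most q ^ card F in weight, as all edges
  of \<open>F\<close> may have to be closed and reopened, and at most 2 ^ card F configurations have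
  the same image under \<open>m\<close>.\<close>

lemma finite_energy:
  fixes g :: "'v set set \<Rightarrow> real"
  assumes "graph V E" "F \<subseteq> E"
    and Tm: "\<And>\<omega>. \<omega> \<subseteq> E \<Longrightarrow> m \<omega> \<subseteq> E \<and> m \<omega> - F = \<omega> - F"
    and g: "\<And>\<omega>. \<omega> \<subseteq> E \<Longrightarrow> 0 \<le> g \<omega>"
  shows "ex V E (\<lambda>\<omega>. g (m \<omega>)) \<le> (2 * real q) ^ card F * ex V E g"
proof -
  have fin: "finite E" "finite F" using graph_finite assms finite_subset by blast+
  have "wt V \<omega> \<le> real q ^ card F * wt V (m \<omega>)" if \<omega>: "\<omega> \<subseteq> E" for \<omega>
  proof -
    have up: "wt V \<omega> \<le> sqrt q ^ card F * wt V (\<omega> - F)"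
    proof -
      have "wt V ((\<omega> - F) \<union> (\<omega> \<inter> F)) \<le> sqrt q ^ card (\<omega> \<inter> F) * wt V (\<omega> - F)"
        using \<omega> by (intro wt_le_wt_Un[OF assms(1)]) auto
      also have "\<dots> \<le> sqrt q ^ card F * wt V (\<omega> - F)"
        using sqrt_q(1) fin wt_pos[OF assms(1), of "\<omega> - F"] \<omega>
        by (intro mult_right_mono power_increasing card_mono) (auto simp: less_imp_le Diff_subset_conv le_supI2)
      finally show ?thesis by (simp add: Diff_Int_distrib2 Un_Diff_Int)
    qed
    have "wt V (m \<omega> - F) \<le> sqrt q ^ card (m \<omega> \<inter> F) * wt V ((m \<omega> - F) \<union> (m \<omega> \<inter> F))"
      using Tm[OF \<omega>] by (intro wt_le_wt_Un[OF assms(1)]) auto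
    also have "\<dots> \<le> sqrt q ^ card F * wt V (m \<omega>)"
    proof -
      have "(m \<omega> - F) \<union> (m \<omega> \<inter> F) = m \<omega>" by auto
      moreover have "sqrt q ^ card (m \<omega> \<inter> F) \<le> sqrt q ^ card F"
        using sqrt_q(1) fin by (intro power_increasing card_mono) auto
      moreover have "0 \<le> wt V (m \<omega>)" using wt_pos[OF assms(1), of "m \<omega>"] Tm[OF \<omega>] by simp
      ultimately show ?thesis by (simp add: mult_right_mono)
    qed
    finally have "wt V (\<omega> - F) \<le> sqrt q ^ card F * wt V (m \<omega>)" using Tm[OF \<omega>] by simp
    then have "sqrt q ^ card F * wt V (\<omega> - F) \<le> sqrt q ^ card F * (sqrt q ^ card F * wt V (m \<omega>))"
      by (intro mult_left_mono) auto
    also have "\<dots> = real q ^ card F * wt V (m \<omega>)"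
      by (simp add: mult.assoc[symmetric] power_mult_distrib[symmetric])
    finally show ?thesis using up by simp
  qed
  note up = this
  \<comment> \<open>The term at \<open>m \<omega>\<close> is one of those in the sum over all
    configurations that agree with \<omega> off \<open>F\<close>; after this, \<open>m\<close> has
    disappeared.\<close>
  have "(\<Sum>\<omega>\<in>Pow E. wt V \<omega> * g (m \<omega>)) \<le> (\<Sum>\<omega>\<in>Pow E. \<Sum>A\<in>Pow F. real q ^ card F * (wt V ((\<omega> - F) \<union> A) * g ((\<omega> - F) \<union> A)))"
  proof (rule sum_mono)
    fix \<omega> assume "\<omega> \<in> Pow E"
    then have \<omega>: "\<omega> \<subseteq> E" by simp
    let ?h = "\<lambda>A. real q ^ card F * (wt V ((\<omega> - F) \<union> A) * g ((\<omega> - F) \<union> A))"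
    have eq: "(\<omega> - F) \<union> (m \<omega> \<inter> F) = m \<omega>" using Tm[OF \<omega>] by auto
    have "wt V \<omega> * g (m \<omega>) \<le> ?h (m \<omega> \<inter> F)"
      unfolding eq using mult_right_mono[OF up[OF \<omega>] g[of "m \<omega>"]] Tm[OF \<omega>] by (simp add: ac_simps)
    also have "\<dots> \<le> (\<Sum>A\<in>Pow F. ?h A)"
    proof (rule member_le_sum)
      fix A assume "A \<in> Pow F - {m \<omega> \<inter> F}"
      then have "(\<omega> - F) \<union> A \<subseteq> E" using \<omega> assms(2) by auto
      then show "0 \<le> ?h A" using wt_pos[OF assms(1)] g by (simp add: less_imp_le)
    qed (use fin in auto)
    finally show "wt V \<omega> * g (m \<omega>) \<le> (\<Sum>A\<in>Pow F. ?h A)" .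
  qed
  also have "\<dots> = real q ^ card F * (\<Sum>\<omega>\<in>Pow E. \<Sum>A\<in>Pow F. wt V ((\<omega> - F) \<union> A) * g ((\<omega> - F) \<union> A))"
    by (simp add: sum_distrib_left)
  also have "(\<Sum>\<omega>\<in>Pow E. \<Sum>A\<in>Pow F. wt V ((\<omega> - F) \<union> A) * g ((\<omega> - F) \<union> A))
      = (\<Sum>\<xi>\<in>Pow (E - F). \<Sum>\<eta>\<in>Pow F. \<Sum>A\<in>Pow F. wt V (\<xi> \<union> A) * g (\<xi> \<union> A))"
  proof (subst sum_Pow_split[OF fin(1) assms(2)], intro sum.cong refl)
    fix \<xi> \<eta> A assume "\<xi> \<in> Pow (E - F)" "\<eta> \<in> Pow F"
    then have "\<xi> \<union> \<eta> - F = \<xi>" by auto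
    then show "wt V (\<xi> \<union> \<eta> - F \<union> A) * g (\<xi> \<union> \<eta> - F \<union> A) = wt V (\<xi> \<union> A) * g (\<xi> \<union> A)" by simp
  qed
  also have "\<dots> = 2 ^ card F * (\<Sum>\<omega>\<in>Pow E. wt V \<omega> * g \<omega>)"
    unfolding sum_Pow_split[OF fin(1) assms(2)] by (simp add: card_Pow fin sum_distrib_left)
  finally have "(\<Sum>\<omega>\<in>Pow E. wt V \<omega> * g (m \<omega>)) \<le> (2 * real q) ^ card F * (\<Sum>\<omega>\<in>Pow E. wt V \<omega> * g \<omega>)"
    by (simp add: power_mult_distrib ac_simps)
  then show ?thesis
    using Z_pos[OF assms(1)] unfolding ex_def by (simp add: divide_right_mono)
qed

lemma markov:
  assumes "graph V E" "\<And>\<omega>. \<omega> \<subseteq> E \<Longrightarrow> 0 \<le> f \<omega>" "0 < t"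
  shows "ex V E (\<lambda>\<omega>. of_bool (t \<le> f \<omega>)) \<le> ex V E f / t"
proof -
  have "ex V E (\<lambda>\<omega>. t * of_bool (t \<le> f \<omega>)) \<le> ex V E f"
    by (rule ex_mono[OF assms(1)]) (use assms(2) in auto)
  then show ?thesis using assms(3) by (simp add: ex_cmult field_simps)
qed

end

section \<open>Averages of positive semidefinite kernels\<close>

lemma kernel_sum_squares:
  fixes c :: "'i \<Rightarrow> real"
  assumes "finite I"
  shows "(\<Sum>i\<in>I. \<Sum>j\<in>I. c i * c j * of_bool (f i = f j)) = (\<Sum>k\<in>f ` I. (\<Sum>i | i \<in> I \<and> f i = k. c i)\<^sup>2)"
proof -
  define S where "S k = (\<Sum>i | i \<in> I \<and> f i = k. c i)" for k
  have "(\<Sum>j\<in>I. c i * c j * of_bool (f i = f j)) = c i * S (f i)" for i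
  proof -
    have "(\<Sum>j\<in>I. c i * c j * of_bool (f i = f j)) = (\<Sum>j\<in>I. if f j = f i then c i * c j else 0)"
      by (intro sum.cong) auto
    also have "\<dots> = (\<Sum>j | j \<in> I \<and> f j = f i. c i * c j)"
      using assms by (simp add: sum.inter_filter)
    finally show ?thesis by (simp add: S_def sum_distrib_left)
  qed
  then have "(\<Sum>i\<in>I. \<Sum>j\<in>I. c i * c j * of_bool (f i = f j)) = (\<Sum>i\<in>I. c i * S (f i))"
    by simp
  also have "\<dots> = (\<Sum>k\<in>f ` I. \<Sum>i | i \<in> I \<and> f i = k. c i * S (f i))"
    by (rule sum.image_gen[OF assms])
  also have "\<dots> = (\<Sum>k\<in>f ` I. (S k)\<^sup>2)"
  proof (intro sum.cong refl)
    fix k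
    have "(\<Sum>i | i \<in> I \<and> f i = k. c i * S (f i)) = (\<Sum>i | i \<in> I \<and> f i = k. c i * S k)"
      by (intro sum.cong) auto
    then show "(\<Sum>i | i \<in> I \<and> f i = k. c i * S (f i)) = (S k)\<^sup>2"
      by (simp add: S_def sum_distrib_right power2_eq_square)
  qed
  finally show ?thesis by (simp add: S_def)
qed

lemma kernel_psd:
  fixes c :: "'i \<Rightarrow> real"
  assumes "finite I"
  shows "0 \<le> (\<Sum>i\<in>I. \<Sum>j\<in>I. c i * c j * of_bool (f i = f j))"
  unfolding kernel_sum_squares[OF assms] by (intro sum_nonneg) simp

lemma conn_iff_cluster_eq: "conn \<omega> x y \<longleftrightarrow> {z. conn \<omega> x z} = {z. conn \<omega> y z}"
proof
  assume "conn \<omega> x y"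
  then show "{z. conn \<omega> x z} = {z. conn \<omega> y z}"
    using conn_trans conn_sym by (metis (no_types, opaque_lifting))
next
  assume "{z. conn \<omega> x z} = {z. conn \<omega> y z}"
  moreover have "y \<in> {z. conn \<omega> y z}" by simp
  ultimately show "conn \<omega> x y" by auto
qed

text \<open>Being connected means lying in the same cluster, so the connectivity matrix is the Gram
  matrix of cluster indicators.\<close>

lemma conn_psd:
  fixes c :: "'i \<Rightarrow> real"
  assumes "finite I"
  shows "0 \<le> (\<Sum>i\<in>I. \<Sum>j\<in>I. c i * c j * of_bool (conn \<omega> (p i) (p j)))"
  using kernel_psd[OF assms, of c "\<lambda>i. {z. conn \<omega> (p i) z}"]
  unfolding conn_iff_cluster_eq[symmetric] .

text \<open>The form k evaluated at the uniform distributions on A and B; it is 0 if one of them is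
  empty.\<close>

definition kav :: "('v \<Rightarrow> 'v \<Rightarrow> real) \<Rightarrow> 'v set \<Rightarrow> 'v set \<Rightarrow> real" where
  "kav k A B = (\<Sum>x\<in>A. \<Sum>y\<in>B. k x y) / (real (card A) * real (card B))"

definition unif :: "'v set \<Rightarrow> 'v \<Rightarrow> real" where
  "unif A x = of_bool (x \<in> A) / real (card A)"

lemma sum_unif:
  assumes "finite V" "A \<subseteq> V"
  shows "(\<Sum>x\<in>V. unif A x * g x) = (\<Sum>x\<in>A. g x) / card A"
proof -
  have "(\<Sum>x\<in>V. unif A x * g x) = (\<Sum>x\<in>V. if x \<in> A then g x / card A else 0)"
    by (intro sum.cong) (auto simp: unif_def)
  also have "\<dots> = (\<Sum>x\<in>V \<inter> A. g x / card A)" using assms by (simp add: sum.inter_restrict)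
  finally show ?thesis using assms by (simp add: Int_absorb1 sum_divide_distrib)
qed

lemma kernel_unif:
  assumes "finite V" "A \<subseteq> V" "B \<subseteq> V"
  shows "(\<Sum>x\<in>V. \<Sum>y\<in>V. unif A x * unif B y * k x y) = kav k A B"
proof -
  have "(\<Sum>x\<in>V. \<Sum>y\<in>V. unif A x * unif B y * k x y) = (\<Sum>x\<in>V. unif A x * (\<Sum>y\<in>V. unif B y * k x y))"
    by (simp add: sum_distrib_left mult.assoc)
  also have "\<dots> = (\<Sum>x\<in>A. (\<Sum>y\<in>B. k x y) / card B) / card A"
    by (simp only: sum_unif[OF assms(1,2)] sum_unif[OF assms(1,3)])
  finally show ?thesis by (simp add: kav_def sum_divide_distrib[symmetric] mult.commute)
qed

lemma kav_commute:
  assumes "\<And>x y. k x y = k y x"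
  shows "kav k B A = kav k A B"
proof -
  have "(\<Sum>x\<in>B. \<Sum>y\<in>A. k x y) = (\<Sum>y\<in>A. \<Sum>x\<in>B. k x y)" by (rule sum.swap)
  also have "\<dots> = (\<Sum>x\<in>A. \<Sum>y\<in>B. k x y)" by (intro sum.cong refl assms)
  finally show ?thesis by (simp add: kav_def mult.commute)
qed

text \<open>The form is tested on the difference of the uniform distributions on A and B.\<close>

lemma kav_mixed:
  fixes k :: "'v \<Rightarrow> 'v \<Rightarrow> real"
  assumes fin: "finite A" "finite B"
    and sym: "\<And>x y. k x y = k y x"
    and psd: "\<And>V c. finite V \<Longrightarrow> 0 \<le> (\<Sum>x\<in>V. \<Sum>y\<in>V. c x * c y * k x y)"
  shows "2 * kav k A B \<le> kav k A A + kav k B B"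
proof -
  define V where "V = A \<union> B"
  define u where "u = (unif :: 'v set \<Rightarrow> _)"
  have V: "finite V" "A \<subseteq> V" "B \<subseteq> V" using fin by (auto simp: V_def)
  have "0 \<le> (\<Sum>x\<in>V. \<Sum>y\<in>V. (u A x - u B x) * (u A y - u B y) * k x y)"
    by (rule psd[OF V(1)])
  also have "\<dots> = (\<Sum>x\<in>V. \<Sum>y\<in>V. u A x * u A y * k x y + u B x * u B y * k x y - u A x * u B y * k x y - u B x * u A y * k x y)"
    by (intro sum.cong refl) (simp add: algebra_simps)
  also have "\<dots> = kav k A A + kav k B B - kav k A B - kav k B A"
    unfolding u_def using V by (simp only: sum.distrib sum_subtractf kernel_unif)
  finally show ?thesis using kav_commute[of k B A, OF sym] by simp
qed

section \<open>The square lattice\<close>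

type_synonym pt = "int \<times> int"

definition ladj :: "pt \<Rightarrow> pt \<Rightarrow> bool" where
  "ladj x y \<longleftrightarrow> \<bar>fst x - fst y\<bar> + \<bar>snd x - snd y\<bar> = 1"

definition lat :: "pt set \<Rightarrow> pt set set" where
  "lat S = {{x, y} | x y. x \<in> S \<and> y \<in> S \<and> ladj x y}"

text \<open>The parameter p is a parity. For p = 0 the side has 2 N + 1 points and the centre is the
  origin; for p = 1 it has 2 N points and the centre is (-1/2, -1/2), so that the middle lines run
  between lattice lines.\<close>

definition lbox :: "int \<Rightarrow> nat \<Rightarrow> pt set" where
  "lbox p N = {- int N..int N - p} \<times> {- int N..int N - p}"

lemma ladj_sym: "ladj x y \<longleftrightarrow> ladj y x"
  by (simp add: ladj_def abs_minus_commute)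

lemma lat_mono: "S \<subseteq> S' \<Longrightarrow> lat S \<subseteq> lat S'"
  unfolding lat_def by blast

lemma lat_edge: "{x, y} \<in> lat S \<longleftrightarrow> x \<in> S \<and> y \<in> S \<and> ladj x y"
proof -
  have "{x, y} \<in> lat S \<longleftrightarrow> (\<exists>u v. {x, y} = {u, v} \<and> u \<in> S \<and> v \<in> S \<and> ladj u v)"
    unfolding lat_def by blast
  then show ?thesis using ladj_sym unfolding doubleton_eq_iff by blast
qed

lemma lat_cases:
  assumes "e \<in> lat S"
  obtains x y where "e = {x, y}" "x \<in> S" "y \<in> S" "ladj x y"
  using assms unfolding lat_def by blast

lemma graph_lat: "finite S \<Longrightarrow> graph S (lat S)"
  unfolding graph_def lat_def by blast

lemma lat_image:
  assumes "\<And>x y. ladj (\<phi> x) (\<phi> y) \<longleftrightarrow> ladj x y"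
  shows "(`) \<phi> ` lat S = lat (\<phi> ` S)"
proof
  show "(`) \<phi> ` lat S \<subseteq> lat (\<phi> ` S)"
  proof
    fix e assume "e \<in> (`) \<phi> ` lat S"
    then obtain x y where "e = \<phi> ` {x, y}" "x \<in> S" "y \<in> S" "ladj x y"
      by (auto elim: lat_cases)
    then show "e \<in> lat (\<phi> ` S)" using assms lat_edge[of "\<phi> x" "\<phi> y" "\<phi> ` S"] by simp
  qed
  show "lat (\<phi> ` S) \<subseteq> (`) \<phi> ` lat S"
  proof
    fix e assume "e \<in> lat (\<phi> ` S)"
    then obtain u v where e: "e = {u, v}" "u \<in> \<phi> ` S" "v \<in> \<phi> ` S" "ladj u v"
      by (rule lat_cases)
    then obtain x y where xy: "u = \<phi> x" "v = \<phi> y" "x \<in> S" "y \<in> S" by blast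
    then have "{x, y} \<in> lat S" using e assms lat_edge by blast
    then show "e \<in> (`) \<phi> ` lat S" using e xy by (intro image_eqI[of _ _ "{x, y}"]) auto
  qed
qed

lemma finite_lbox [simp]: "finite (lbox p N)"
  by (simp add: lbox_def)

lemma card_lbox: "p \<le> 1 \<Longrightarrow> card (lbox p N) = nat (2 * int N + 1 - p) ^ 2"
  by (simp add: lbox_def card_cartesian_product power2_eq_square algebra_simps)

lemma lbox_mono: "M \<le> N \<Longrightarrow> lbox p M \<subseteq> lbox p N"
  by (auto simp: lbox_def)

lemma finite_subset_lbox:
  assumes "finite S"
  shows "\<forall>\<^sub>F N in sequentially. S \<subseteq> lbox p N"
proof -
  have "\<exists>M::nat. S \<subseteq> lbox p M"
    using assms
  proof (induction S rule: finite_induct)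
    case (insert x S)
    then obtain M where M: "S \<subseteq> lbox p M" by auto
    define M' where "M' = M + nat (\<bar>fst x\<bar> + \<bar>snd x\<bar> + \<bar>p\<bar>)"
    have "x \<in> lbox p M'" by (cases x) (auto simp: lbox_def M'_def)
    moreover have "lbox p M \<subseteq> lbox p M'" by (rule lbox_mono) (simp add: M'_def)
    ultimately show ?case using M by (intro exI[of _ M']) auto
  qed auto
  then obtain M where "S \<subseteq> lbox p M" by auto
  then show ?thesis using lbox_mono unfolding eventually_sequentially by blast
qed

section \<open>The infinite-volume two-point function and its asymptotic mean\<close>

context fk begin

abbreviation lex :: "pt set \<Rightarrow> (pt set set \<Rightarrow> real) \<Rightarrow> real" where
  "lex S \<equiv> ex S (lat S)"

definition tp :: "pt set \<Rightarrow> pt \<Rightarrow> pt \<Rightarrow> real" where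
  "tp S x y = lex S (\<lambda>\<omega>. of_bool (conn \<omega> x y))"

text \<open>The infinite-volume two-point function with free boundary conditions.\<close>

definition G :: "pt \<Rightarrow> pt \<Rightarrow> real" where
  "G x y = (SUP S\<in>{S. finite S}. tp S x y)"

lemma tp_le_1: "finite S \<Longrightarrow> tp S x y \<le> 1"
  using ex_mono[OF graph_lat, of S "\<lambda>\<omega>. of_bool (conn \<omega> x y)" "\<lambda>_. 1"] graph_lat[of S]
  by (simp add: tp_def)

lemma tp_nonneg: "finite S \<Longrightarrow> 0 \<le> tp S x y"
  unfolding tp_def by (rule ex_nonneg) (auto intro: graph_lat)

lemma tp_refl: "finite S \<Longrightarrow> tp S x x = 1"
  using graph_lat[of S] by (simp add: tp_def)

lemma tp_sym: "tp S x y = tp S y x"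
  unfolding tp_def by (subst conn_sym) simp

lemma tp_mono:
  assumes "finite S'" "S \<subseteq> S'"
  shows "tp S x y \<le> tp S' x y"
proof -
  have g: "graph S (lat S)" "graph S' (lat S')" using assms finite_subset graph_lat by blast+
  have "tp S x y \<le> lex S' (\<lambda>\<omega>. of_bool (conn (\<omega> \<inter> lat S) x y))"
    unfolding tp_def by (rule domain_mono[OF g lat_mono[OF assms(2)]]) (auto intro: conn_mono)
  also have "\<dots> \<le> tp S' x y"
    unfolding tp_def by (rule ex_mono[OF g(2)]) (auto intro: conn_mono[of "_ \<inter> lat S"])
  finally show ?thesis .
qed

lemma tp_image:
  assumes "finite S" "inj \<phi>" "\<And>x y. ladj (\<phi> x) (\<phi> y) \<longleftrightarrow> ladj x y"
  shows "tp (\<phi> ` S) (\<phi> x) (\<phi> y) = tp S x y"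
  unfolding tp_def lat_image[OF assms(3), symmetric] ex_image[OF assms(2) graph_lat[OF assms(1)]]
  by (simp add: conn_image[OF assms(2)])

lemma tp_bdd: "bdd_above ((\<lambda>S. tp S x y) ` {S. finite S})"
  by (rule bdd_aboveI2[of _ _ 1]) (simp add: tp_le_1)

lemma tp_le_G: "finite S \<Longrightarrow> tp S x y \<le> G x y"
  unfolding G_def by (rule cSUP_upper[OF _ tp_bdd]) simp

lemma G_le_1: "G x y \<le> 1"
  unfolding G_def by (rule cSUP_least) (auto intro: tp_le_1)

lemma G_nonneg: "0 \<le> G x y"
  using tp_le_G[of "{}" x y] tp_nonneg[of "{}" x y] by simp

lemma G_refl: "G x x = 1"
  using tp_le_G[of "{}" x x] tp_refl[of "{}" x] G_le_1[of x x] by simp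

lemma G_sym: "G x y = G y x"
  unfolding G_def by (subst tp_sym) simp

lemma ladj_shift: "ladj (v + x) (v + y) \<longleftrightarrow> ladj x y"
  by (simp add: ladj_def)

text \<open>A finite volume is not translation invariant, but the supremum over all of them
  is.\<close>

lemma G_shift: "G (v + x) (v + y) = G x y"
proof -
  have le: "G (v + x) (v + y) \<le> G x y" for v x y
    unfolding G_def[of "v + x"]
  proof (rule cSUP_least)
    fix S :: "pt set" assume "S \<in> {S. finite S}"
    then have "tp ((+) (- v) ` S) (- v + (v + x)) (- v + (v + y)) = tp S (v + x) (v + y)"
      by (intro tp_image) (auto simp: ladj_def)
    then show "tp S (v + x) (v + y) \<le> G x y"
      using tp_le_G[of "(+) (- v) ` S" x y] \<open>S \<in> {S. finite S}\<close> by simp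
  qed auto
  show ?thesis using le[of v x y] le[of "- v" "v + x" "v + y"] by simp
qed

lemma tp_tendsto_G: "(\<lambda>N. tp (lbox p N) x y) \<longlonglongrightarrow> G x y"
proof (rule LIMSEQ_I)
  fix r :: real assume "0 < r"
  then obtain S where S: "finite S" "G x y - r < tp S x y"
    unfolding G_def using less_cSUP_iff[OF _ tp_bdd, of "G x y - r" x y] unfolding G_def by fastforce
  obtain M where M: "\<And>N. N \<ge> M \<Longrightarrow> S \<subseteq> lbox p N"
    using finite_subset_lbox[OF S(1), of p] by (auto simp: eventually_sequentially)
  have "norm (tp (lbox p N) x y - G x y) < r" if "N \<ge> M" for N
    using S(2) tp_mono[OF finite_lbox M[OF that], of x y] tp_le_G[of "lbox p N" x y] by simp
  then show "\<exists>M. \<forall>N\<ge>M. norm (tp (lbox p N) x y - G x y) < r" by blast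
qed

text \<open>FKG: the two connections are increasing events, and together they connect x to
  z.\<close>

lemma G_triangle: "G x y * G y z \<le> G x z"
proof (rule LIMSEQ_le)
  show "(\<lambda>N. tp (lbox 0 N) x y * tp (lbox 0 N) y z) \<longlonglongrightarrow> G x y * G y z"
    by (intro tendsto_mult tp_tendsto_G)
  show "(\<lambda>N. tp (lbox 0 N) x z) \<longlonglongrightarrow> G x z" by (rule tp_tendsto_G)
  have "tp (lbox 0 N) x y * tp (lbox 0 N) y z \<le> tp (lbox 0 N) x z" for N
  proof -
    have g: "graph (lbox 0 N) (lat (lbox 0 N))" by (simp add: graph_lat)
    have "tp (lbox 0 N) x y * tp (lbox 0 N) y z
        \<le> lex (lbox 0 N) (\<lambda>\<omega>. of_bool (conn \<omega> x y) * of_bool (conn \<omega> y z))"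
      unfolding tp_def by (rule fkg[OF g]) (auto intro: conn_mono)
    also have "\<dots> \<le> tp (lbox 0 N) x z"
      unfolding tp_def by (rule ex_mono[OF g]) (auto intro: conn_trans)
    finally show ?thesis .
  qed
  then show "\<exists>N. \<forall>n\<ge>N. tp (lbox 0 n) x y * tp (lbox 0 n) y z \<le> tp (lbox 0 n) x z" by blast
qed

lemma tp_psd:
  fixes c :: "'i \<Rightarrow> real"
  assumes "finite I" "finite S"
  shows "0 \<le> (\<Sum>i\<in>I. \<Sum>j\<in>I. c i * c j * tp S (f i) (f j))"
proof -
  have "(\<Sum>i\<in>I. \<Sum>j\<in>I. c i * c j * tp S (f i) (f j))
      = lex S (\<lambda>\<omega>. \<Sum>i\<in>I. \<Sum>j\<in>I. c i * c j * of_bool (conn \<omega> (f i) (f j)))"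
    by (simp add: ex_sum ex_cmult tp_def)
  also have "\<dots> \<ge> 0" by (intro ex_nonneg graph_lat assms conn_psd)
  finally show ?thesis .
qed

lemma G_psd:
  fixes c :: "'i \<Rightarrow> real"
  assumes "finite I"
  shows "0 \<le> (\<Sum>i\<in>I. \<Sum>j\<in>I. c i * c j * G (f i) (f j))"
proof (rule LIMSEQ_le_const)
  show "(\<lambda>N. \<Sum>i\<in>I. \<Sum>j\<in>I. c i * c j * tp (lbox 0 N) (f i) (f j)) \<longlonglongrightarrow> (\<Sum>i\<in>I. \<Sum>j\<in>I. c i * c j * G (f i) (f j))"
    by (intro tendsto_sum tendsto_mult tendsto_const tp_tendsto_G)
  show "\<exists>N. \<forall>n\<ge>N. 0 \<le> (\<Sum>i\<in>I. \<Sum>j\<in>I. c i * c j * tp (lbox 0 n) (f i) (f j))"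
    using tp_psd[OF assms finite_lbox] by blast
qed

text \<open>\<open>gam\<close> is the squared norm of the projection of a spin onto the translation invariant vectors, in
  the Hilbert space with inner product \<open>G\<close>.\<close>

definition gam_set :: "real set" where
  "gam_set = {\<Sum>x\<in>V. \<Sum>y\<in>V. c x * c y * G x y | V c. finite V \<and> (\<forall>x\<in>V. 0 \<le> c x) \<and> sum c V = 1}"

definition gam :: real where
  "gam = Inf gam_set"

lemma gam_set_bdd: "bdd_below gam_set"
proof (rule bdd_belowI[of _ 0])
  fix t assume "t \<in> gam_set"
  then obtain V c where "t = (\<Sum>x\<in>V. \<Sum>y\<in>V. c x * c y * G x y)" "finite V"
    unfolding gam_set_def by blast
  then show "0 \<le> t" using G_psd[of V c "\<lambda>x. x"] by simp
qed

lemma gam_le: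
  assumes "finite V" "\<And>x. x \<in> V \<Longrightarrow> 0 \<le> c x" "sum c V = 1"
  shows "gam \<le> (\<Sum>x\<in>V. \<Sum>y\<in>V. c x * c y * G x y)"
  unfolding gam_def by (rule cInf_lower[OF _ gam_set_bdd]) (use assms in \<open>unfold gam_set_def, blast\<close>)

lemma gam_set_nonempty: "gam_set \<noteq> {}"
proof -
  have "(\<Sum>x\<in>{0}. \<Sum>y\<in>{0}. (\<lambda>_. 1) x * (\<lambda>_. 1) y * G x y) \<in> gam_set"
    unfolding gam_set_def by (rule CollectI, rule exI[of _ "{0}"], rule exI[of _ "\<lambda>_. 1"]) simp
  then show ?thesis by blast
qed

lemma gam_approx:
  assumes "0 < \<eta>"
  obtains V c where "finite V" "\<And>x. x \<in> V \<Longrightarrow> 0 \<le> c x" "sum c V = 1"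
    "(\<Sum>x\<in>V. \<Sum>y\<in>V. c x * c y * G x y) < gam + \<eta>"
proof -
  have "Inf gam_set < gam + \<eta>" using assms by (simp add: gam_def)
  then obtain t where "t \<in> gam_set" "t < gam + \<eta>"
    using cInf_less_iff[OF gam_set_nonempty gam_set_bdd] by blast
  then show ?thesis using that unfolding gam_set_def by blast
qed

abbreviation Gav :: "pt set \<Rightarrow> pt set \<Rightarrow> real" where
  "Gav \<equiv> kav G"

text \<open>\<open>gam\<close> bounds the form at the midpoint of the two uniform distributions.
  Once both diagonal averages are close to \<open>gam\<close>, the mixed one cannot be much smaller;
  this ties boxes of different sizes together.\<close>

lemma Gav_mixed:
  assumes "finite A" "A \<noteq> {}" "finite B" "B \<noteq> {}"
  shows "4 * gam \<le> Gav A A + Gav B B + 2 * Gav A B"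
proof -
  define V where "V = A \<union> B"
  define u where "u = (unif :: pt set \<Rightarrow> _)"
  have V: "finite V" "A \<subseteq> V" "B \<subseteq> V" using assms by (auto simp: V_def)
  have u1: "(\<Sum>x\<in>V. u A x) = 1" if "A \<subseteq> V" "A \<noteq> {}" for A
    using sum_unif[OF V(1) that(1), of "\<lambda>_. 1"] that V(1) finite_subset[OF that(1)] by (simp add: u_def)
  have "gam \<le> (\<Sum>x\<in>V. \<Sum>y\<in>V. ((u A x + u B x) / 2) * ((u A y + u B y) / 2) * G x y)"
  proof (rule gam_le)
    show "(\<Sum>x\<in>V. (u A x + u B x) / 2) = 1"
      using u1[of A] u1[of B] V assms by (simp add: sum.distrib sum_divide_distrib[symmetric])
  qed (auto simp: V u_def unif_def)
  also have "\<dots> = (\<Sum>x\<in>V. \<Sum>y\<in>V. (u A x * u A y * G x y + u B x * u B y * G x y + u A x * u B y * G x y + u B x * u A y * G x y) / 4)"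
    by (intro sum.cong refl) (simp add: algebra_simps)
  also have "\<dots> = (Gav A A + Gav B B + Gav A B + Gav B A) / 4"
    unfolding u_def using V by (simp only: sum_divide_distrib[symmetric] sum.distrib kernel_unif)
  finally show ?thesis using kav_commute[of G B A, OF G_sym] by simp
qed

lemma gam_le_Gav:
  assumes "finite A" "A \<noteq> {}"
  shows "gam \<le> Gav A A"
  using Gav_mixed[OF assms assms] by simp

text \<open>Convolving the uniform distribution on a large box with a nearly optimal distribution
  barely changes it, while by positivity the form of the convolution is at most that of the nearly
  optimal distribution.\<close>

lemma mean_ergodic:
  assumes p: "p \<in> {0, 1}" and "0 < \<eta>"
  shows "\<exists>K. \<forall>k\<ge>K. Gav (lbox p k) (lbox p k) \<le> gam + \<eta>"
proof -
  obtain V c where V: "finite V" "\<And>x. x \<in> V \<Longrightarrow> 0 \<le> c x" "sum c V = 1"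
    and Q: "(\<Sum>x\<in>V. \<Sum>y\<in>V. c x * c y * G x y) < gam + \<eta> / 2"
    using gam_approx[of "\<eta> / 2"] assms by auto
  define Qc where "Qc = (\<Sum>x\<in>V. \<Sum>y\<in>V. c x * c y * G x y)"
  obtain r where r: "V \<subseteq> lbox p r"
    using finite_subset_lbox[OF V(1), of p] unfolding eventually_sequentially by blast
  \<comment> \<open>Cauchy-Schwarz for two translates of c, both of squared norm \<open>Qc\<close>
    by translation invariance.\<close>
  have t: "(\<Sum>x\<in>V. \<Sum>y\<in>V. c x * c y * G (b + x) (b' + y)) \<le> Qc" for b b'
  proof -
    define T where "T b b' = (\<Sum>x\<in>V. \<Sum>y\<in>V. c x * c y * G (b + x) (b' + y))" for b b'
    have T_sym: "T b b' = T b' b" for b b'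
      unfolding T_def by (subst sum.swap) (simp add: G_sym[of "b + _"] mult.commute)
    have T_diag: "T b b = Qc" for b by (simp add: T_def Qc_def G_shift)
    \<comment> \<open>The form is tested on two copies of V, translated by b and b' and carrying
      opposite signs; the boolean selects the copy.\<close>
    define d where "d i x = (if i then c x else - c x)" for i x
    define f where "f = (\<lambda>(i, x). (if i then b else b') + x)"
    have "0 \<le> (\<Sum>i\<in>UNIV \<times> V. \<Sum>j\<in>UNIV \<times> V. d (fst i) (snd i) * d (fst j) (snd j) * G (f i) (f j))"
      using G_psd[of "UNIV \<times> V" "\<lambda>i. d (fst i) (snd i)" f] V(1) by simp
    also have "\<dots> = (\<Sum>i\<in>UNIV. \<Sum>x\<in>V. \<Sum>j\<in>UNIV. \<Sum>y\<in>V. d i x * d j y * G (f (i, x)) (f (j, y)))"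
      by (simp add: sum.cartesian_product')
    also have "\<dots> = T b b - T b b' - T b' b + T b' b'"
      by (simp add: UNIV_bool d_def f_def T_def sum.distrib sum_negf sum_subtractf algebra_simps)
    finally show ?thesis using T_sym[of b b'] by (simp add: T_diag flip: T_def)
  qed
  \<comment> \<open>A translation by at most r in each coordinate loses at most a fraction 4 (r + 1)
    / L of a box of side L; the 32 makes this at most \<eta> / 8.\<close>
  define K where "K = r + nat \<lceil>32 * real (Suc r) / \<eta>\<rceil>"
  have "Gav (lbox p k) (lbox p k) \<le> gam + \<eta>" if k: "k \<ge> K" for k
  proof -
    define B where "B = lbox p k"
    define L where "L = nat (2 * int k + 1 - p)"
    define n where "n = real (card B)"
    have nL: "n = real L ^ 2" using p by (auto simp: n_def B_def L_def card_lbox)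
    have kr: "r \<le> k" "32 * real (Suc r) / \<eta> \<le> real k" using k by (auto simp: K_def) linarith
    then have k0: "0 < k" using \<open>0 < \<eta>\<close> by (cases k) (auto simp: field_simps)
    have Lk: "k \<le> L" "2 * r \<le> L" using p kr(1) k0 by (auto simp: L_def)
    have n0: "0 < n" using Lk k0 by (simp add: nL)
    have miss: "real (card (B - (+) x ` B)) \<le> \<eta> / 8 * n" if "x \<in> V" for x
    proof -
      \<comment> \<open>The box shrunk by r on each side lies both in B and in its
        translate.\<close>
      define I where "I = {- int k + int r..int k - p - int r} \<times> {- int k + int r..int k - p - int r}"
      have xr: "\<bar>fst x\<bar> \<le> int r" "\<bar>snd x\<bar> \<le> int r"
        using subsetD[OF r that] p by (auto simp: lbox_def mem_Times_iff)
      have IB: "I \<subseteq> B" by (auto simp: I_def B_def lbox_def)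
      have "I \<subseteq> (+) x ` B"
      proof
        fix z assume "z \<in> I"
        then have "z - x \<in> B" using xr by (auto simp: I_def B_def lbox_def mem_Times_iff)
        then show "z \<in> (+) x ` B" by (intro image_eqI[of _ _ "z - x"]) auto
      qed
      then have "card (B - (+) x ` B) \<le> card (B - I)"
        by (intro card_mono) (auto simp: B_def)
      also have "\<dots> = card B - card I" using IB by (intro card_Diff_subset) (auto simp: I_def)
      also have "card I = (L - 2 * r)\<^sup>2"
      proof -
        have "card {- int k + int r..int k - p - int r} = L - 2 * r" using p by (auto simp: L_def)
        then show ?thesis by (simp add: I_def power2_eq_square card_cartesian_product)
      qed
      finally have "real (card (B - (+) x ` B)) \<le> real (card B - (L - 2 * r)\<^sup>2)" by simp
      also have "\<dots> = real L ^ 2 - real (L - 2 * r) ^ 2"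
      proof -
        have "card B = L\<^sup>2" using nL unfolding n_def by (metis of_nat_eq_iff of_nat_power)
        moreover have "(L - 2 * r)\<^sup>2 \<le> L\<^sup>2" by (simp add: power_mono)
        ultimately show ?thesis by (simp add: of_nat_diff)
      qed
      also have "\<dots> = 4 * real r * real L - 4 * real r ^ 2"
        using Lk(2) by (simp add: of_nat_diff power2_eq_square algebra_simps)
      also have "\<dots> \<le> 4 * real (Suc r) * real L" by (simp add: algebra_simps)
      also have "\<dots> \<le> \<eta> / 8 * n"
      proof -
        have "32 * real (Suc r) \<le> \<eta> * real L"
        proof -
          have "32 * real (Suc r) \<le> \<eta> * real k" using kr(2) \<open>0 < \<eta>\<close> by (simp add: field_simps)
          also have "\<dots> \<le> \<eta> * real L" using Lk(1) \<open>0 < \<eta>\<close> by (intro mult_left_mono) auto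
          finally show ?thesis .
        qed
        then have "32 * real (Suc r) * real L \<le> \<eta> * real L * real L" by (rule mult_right_mono) simp
        then show ?thesis by (simp add: nL power2_eq_square algebra_simps)
      qed
      finally show ?thesis .
    qed
    define R where "R = (\<Sum>b\<in>B. \<Sum>b'\<in>B. G b b')"
    \<comment> \<open>Each of the two translated boxes loses a fraction \<eta> / 8 of its points,
      and \<open>G\<close> is at most 1 on the lost pairs.\<close>
    have shift: "R - \<eta> / 4 * n\<^sup>2 \<le> (\<Sum>b\<in>B. \<Sum>b'\<in>B. G (b + x) (b' + y))" if "x \<in> V" "y \<in> V" for x y
    proof -
      have fB: "finite B" by (simp add: B_def)
      have "(\<Sum>b\<in>B. \<Sum>b'\<in>B. G (b + x) (b' + y)) = (\<Sum>(u, v)\<in>B \<times> B. G (u + x) (v + y))"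
        by (simp add: sum.cartesian_product)
      also have "\<dots> = (\<Sum>(u, v)\<in>((+) x ` B) \<times> ((+) y ` B). G u v)"
        by (rule sum.reindex_bij_witness[where j = "\<lambda>(u, v). (x + u, y + v)" and i = "\<lambda>(u, v). (u - x, v - y)"])
           (auto simp: add.commute)
      also have "\<dots> \<ge> (\<Sum>(u, v)\<in>(B \<inter> (+) x ` B) \<times> (B \<inter> (+) y ` B). G u v)"
        using fB by (intro sum_mono2) (auto simp: G_nonneg)
      finally have 1: "(\<Sum>(u, v)\<in>(B \<inter> (+) x ` B) \<times> (B \<inter> (+) y ` B). G u v) \<le> (\<Sum>b\<in>B. \<Sum>b'\<in>B. G (b + x) (b' + y))" .
      define M where "M = ((B - (+) x ` B) \<times> B) \<union> (B \<times> (B - (+) y ` B))"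
      have eq: "B \<times> B = (B \<inter> (+) x ` B) \<times> (B \<inter> (+) y ` B) \<union> M" unfolding M_def by blast
      have "R = (\<Sum>(u, v)\<in>B \<times> B. G u v)" by (simp add: R_def sum.cartesian_product)
      also have "\<dots> \<le> (\<Sum>(u, v)\<in>(B \<inter> (+) x ` B) \<times> (B \<inter> (+) y ` B). G u v) + (\<Sum>(u, v)\<in>M. G u v)"
      proof -
        have "0 \<le> (\<Sum>(u, v)\<in>(B \<inter> (+) x ` B) \<times> (B \<inter> (+) y ` B) \<inter> M. G u v)"
          by (intro sum_nonneg) (auto simp: G_nonneg)
        then show ?thesis unfolding eq using fB by (subst sum_Un) (auto simp: M_def)
      qed
      also have "(\<Sum>(u, v)\<in>M. G u v) \<le> (\<Sum>_\<in>M. 1)" by (intro sum_mono) (auto simp: G_le_1)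
      also have "\<dots> = real (card M)" by simp
      also have "\<dots> \<le> real (card ((B - (+) x ` B) \<times> B) + card (B \<times> (B - (+) y ` B)))"
        unfolding M_def by (intro of_nat_mono card_Un_le)
      also have "\<dots> = real (card (B - (+) x ` B)) * n + n * real (card (B - (+) y ` B))"
        by (simp add: card_cartesian_product n_def)
      also have "\<dots> \<le> \<eta> / 8 * n * n + n * (\<eta> / 8 * n)"
        using miss[OF that(1)] miss[OF that(2)] n0 by (intro add_mono mult_right_mono mult_left_mono) auto
      also have "\<dots> = \<eta> / 4 * n\<^sup>2" by (simp add: power2_eq_square)
      finally show ?thesis using 1 by linarith
    qed
    have "R - \<eta> / 4 * n\<^sup>2 = (\<Sum>x\<in>V. \<Sum>y\<in>V. c x * c y * (R - \<eta> / 4 * n\<^sup>2))"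
      by (simp add: sum_distrib_left[symmetric] sum_distrib_right[symmetric] V(3))
    also have "\<dots> \<le> (\<Sum>x\<in>V. \<Sum>y\<in>V. c x * c y * (\<Sum>b\<in>B. \<Sum>b'\<in>B. G (b + x) (b' + y)))"
      by (intro sum_mono mult_left_mono shift mult_nonneg_nonneg V(2))
    also have "\<dots> = (\<Sum>b\<in>B. \<Sum>b'\<in>B. \<Sum>x\<in>V. \<Sum>y\<in>V. c x * c y * G (b + x) (b' + y))"
    proof -
      have "(\<Sum>x\<in>V. \<Sum>y\<in>V. c x * c y * (\<Sum>b\<in>B. \<Sum>b'\<in>B. G (b + x) (b' + y)))
          = (\<Sum>(x, y)\<in>V \<times> V. \<Sum>(b, b')\<in>B \<times> B. c x * c y * G (b + x) (b' + y))"
        by (simp add: sum.cartesian_product[symmetric] sum_distrib_left)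
      also have "\<dots> = (\<Sum>(b, b')\<in>B \<times> B. \<Sum>(x, y)\<in>V \<times> V. c x * c y * G (b + x) (b' + y))"
        unfolding split_beta by (rule sum.swap)
      finally show ?thesis by (simp add: sum.cartesian_product[symmetric])
    qed
    also have "\<dots> \<le> (\<Sum>b\<in>B. \<Sum>b'\<in>B. Qc)" by (intro sum_mono t)
    also have "\<dots> = Qc * n\<^sup>2" by (simp add: n_def power2_eq_square)
    finally have "R \<le> (Qc + \<eta> / 4) * n\<^sup>2" by (simp add: algebra_simps)
    then have "R / n\<^sup>2 \<le> Qc + \<eta> / 4" using n0 by (simp add: pos_divide_le_eq)
    then show ?thesis using Q \<open>0 < \<eta>\<close> unfolding Qc_def[symmetric]
      by (simp add: kav_def B_def[symmetric] R_def[symmetric] n_def[symmetric] power2_eq_square)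
  qed
  then show ?thesis by blast
qed

end

section \<open>Reflection positivity\<close>

definition mono_on_edge :: "('v \<Rightarrow> 'c) \<Rightarrow> 'v set \<Rightarrow> bool" where
  "mono_on_edge \<sigma> e \<longleftrightarrow> (\<forall>x\<in>e. \<forall>y\<in>e. \<sigma> x = \<sigma> y)"

lemma col_eq:
  assumes "graph V E" "\<omega> \<subseteq> E"
  shows "col T V \<omega> = {\<sigma> \<in> V \<rightarrow>\<^sub>E T. \<forall>e\<in>\<omega>. mono_on_edge \<sigma> e}"
proof -
  have "(\<forall>x y. {x, y} \<in> \<omega> \<longrightarrow> \<sigma> x = \<sigma> y) \<longleftrightarrow> (\<forall>e\<in>\<omega>. mono_on_edge \<sigma> e)" for \<sigma> :: "'a \<Rightarrow> 'b"
  proof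
    assume *: "\<forall>x y. {x, y} \<in> \<omega> \<longrightarrow> \<sigma> x = \<sigma> y"
    show "\<forall>e\<in>\<omega>. mono_on_edge \<sigma> e"
    proof
      fix e assume "e \<in> \<omega>"
      moreover then obtain x y where "e = {x, y}" using graph_edge[OF assms(1), of e] assms(2) by blast
      ultimately show "mono_on_edge \<sigma> e" using * by (auto simp: mono_on_edge_def)
    qed
  qed (auto simp: mono_on_edge_def)
  then show ?thesis by (simp add: col_def)
qed

text \<open>In the product over edges, choosing the term s opens the edge and forces equal colours
  on it.\<close>

lemma edwards_sokal:
  fixes F :: "('v \<Rightarrow> 'c) \<Rightarrow> real"
  assumes "graph V E" "finite T"
  shows "(\<Sum>\<sigma>\<in>V \<rightarrow>\<^sub>E T. F \<sigma> * (\<Prod>e\<in>E. 1 + s * of_bool (mono_on_edge \<sigma> e)))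
    = (\<Sum>\<omega>\<in>Pow E. s ^ card \<omega> * (\<Sum>\<sigma>\<in>col T V \<omega>. F \<sigma>))"
proof -
  have fin: "finite V" "finite E" using graph_finite assms by auto
  have finP: "finite (V \<rightarrow>\<^sub>E T)" using fin assms(2) by (simp add: finite_PiE)
  have "(\<Prod>e\<in>E. 1 + s * of_bool (mono_on_edge \<sigma> e))
      = (\<Sum>\<omega>\<in>Pow E. s ^ card \<omega> * of_bool (\<forall>e\<in>\<omega>. mono_on_edge \<sigma> e))" for \<sigma> :: "'v \<Rightarrow> 'c"
  proof -
    have "(\<Prod>e\<in>E. s * of_bool (mono_on_edge \<sigma> e) + 1)
      = (\<Sum>\<omega>\<in>Pow E. (\<Prod>e\<in>\<omega>. s * of_bool (mono_on_edge \<sigma> e)) * (\<Prod>e\<in>E - \<omega>. 1))"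
      by (rule prod_add) (use fin in auto)
    also have "\<dots> = (\<Sum>\<omega>\<in>Pow E. s ^ card \<omega> * of_bool (\<forall>e\<in>\<omega>. mono_on_edge \<sigma> e))"
    proof (intro sum.cong refl)
      fix \<omega> assume "\<omega> \<in> Pow E"
      then have "finite \<omega>" using fin finite_subset by auto
      then have "(\<Prod>e\<in>\<omega>. of_bool (mono_on_edge \<sigma> e) :: real) = of_bool (\<forall>e\<in>\<omega>. mono_on_edge \<sigma> e)"
        by (induction \<omega> rule: finite_induct) auto
      then show "(\<Prod>e\<in>\<omega>. s * of_bool (mono_on_edge \<sigma> e)) * (\<Prod>e\<in>E - \<omega>. 1)
          = s ^ card \<omega> * of_bool (\<forall>e\<in>\<omega>. mono_on_edge \<sigma> e)"
        by (simp add: prod.distrib)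
    qed
    finally show ?thesis by (simp add: add.commute)
  qed
  then have "(\<Sum>\<sigma>\<in>V \<rightarrow>\<^sub>E T. F \<sigma> * (\<Prod>e\<in>E. 1 + s * of_bool (mono_on_edge \<sigma> e)))
      = (\<Sum>\<sigma>\<in>V \<rightarrow>\<^sub>E T. \<Sum>\<omega>\<in>Pow E. F \<sigma> * (s ^ card \<omega> * of_bool (\<forall>e\<in>\<omega>. mono_on_edge \<sigma> e)))"
    by (simp add: sum_distrib_left)
  also have "\<dots> = (\<Sum>\<omega>\<in>Pow E. \<Sum>\<sigma>\<in>V \<rightarrow>\<^sub>E T. F \<sigma> * (s ^ card \<omega> * of_bool (\<forall>e\<in>\<omega>. mono_on_edge \<sigma> e)))"
    by (rule sum.swap)
  also have "\<dots> = (\<Sum>\<omega>\<in>Pow E. s ^ card \<omega> * (\<Sum>\<sigma>\<in>col T V \<omega>. F \<sigma>))"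
  proof (intro sum.cong refl)
    fix \<omega> assume "\<omega> \<in> Pow E"
    then have "(\<Sum>\<sigma>\<in>col T V \<omega>. F \<sigma>) = (\<Sum>\<sigma>\<in>V \<rightarrow>\<^sub>E T. if \<forall>e\<in>\<omega>. mono_on_edge \<sigma> e then F \<sigma> else 0)"
      using finP by (simp add: col_eq[OF assms(1)] sum.inter_filter)
    then show "(\<Sum>\<sigma>\<in>V \<rightarrow>\<^sub>E T. F \<sigma> * (s ^ card \<omega> * of_bool (\<forall>e\<in>\<omega>. mono_on_edge \<sigma> e))) = s ^ card \<omega> * (\<Sum>\<sigma>\<in>col T V \<omega>. F \<sigma>)"
      by (auto simp: sum_distrib_left intro!: sum.cong)
  qed
  finally show ?thesis .
qed

text \<open>The quadratic in t is minimal at - M / B; if B = 0 it is affine and nonnegative, so its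
  slope vanishes.\<close>

lemma discriminant_le:
  fixes A B M :: real
  assumes "\<And>t. 0 \<le> A + 2 * t * M + t\<^sup>2 * B" "0 \<le> B"
  shows "M\<^sup>2 \<le> A * B"
proof (cases "B = 0")
  case True
  have "M = 0"
  proof (rule ccontr)
    assume "M \<noteq> 0"
    then have "A + 2 * (- (A + 1) / (2 * M)) * M + (- (A + 1) / (2 * M))\<^sup>2 * B = - 1"
      using True by (simp add: field_simps)
    then show False using assms(1)[of "- (A + 1) / (2 * M)"] by simp
  qed
  then show ?thesis using True by simp
next
  case False
  then have B: "0 < B" using assms(2) by simp
  have "0 \<le> A + 2 * (- M / B) * M + (- M / B)\<^sup>2 * B" by (rule assms(1))
  also have "\<dots> = A - M\<^sup>2 / B" using B by (simp add: power2_eq_square field_simps)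
  finally show ?thesis using B by (simp add: field_simps)
qed

text \<open>\<open>K\<close> is a nonnegative combination of kernels of equivalence relations, hence
  positive semidefinite, and Cauchy-Schwarz holds for such a form even if it is degenerate.\<close>

lemma kernel_cauchy_schwarz:
  fixes a b :: "'i \<Rightarrow> real" and \<kappa> :: "'t \<Rightarrow> real" and f :: "'t \<Rightarrow> 'i \<Rightarrow> 'k"
  assumes "finite I" "\<And>t. t \<in> D \<Longrightarrow> 0 \<le> \<kappa> t"
  defines "K \<equiv> \<lambda>i j. \<Sum>t\<in>D. \<kappa> t * of_bool (f t i = f t j)"
  shows "(\<Sum>i\<in>I. \<Sum>j\<in>I. a i * b j * K i j)\<^sup>2
    \<le> (\<Sum>i\<in>I. \<Sum>j\<in>I. a i * a j * K i j) * (\<Sum>i\<in>I. \<Sum>j\<in>I. b i * b j * K i j)"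
proof -
  have psd: "0 \<le> (\<Sum>i\<in>I. \<Sum>j\<in>I. c i * c j * K i j)" for c
  proof -
    have "(\<Sum>i\<in>I. \<Sum>j\<in>I. c i * c j * K i j)
        = (\<Sum>i\<in>I. \<Sum>j\<in>I. \<Sum>t\<in>D. \<kappa> t * (c i * c j * of_bool (f t i = f t j)))"
      by (simp add: K_def sum_distrib_left ac_simps)
    also have "\<dots> = (\<Sum>i\<in>I. \<Sum>t\<in>D. \<Sum>j\<in>I. \<kappa> t * (c i * c j * of_bool (f t i = f t j)))"
      by (intro sum.cong refl sum.swap)
    also have "\<dots> = (\<Sum>t\<in>D. \<Sum>i\<in>I. \<Sum>j\<in>I. \<kappa> t * (c i * c j * of_bool (f t i = f t j)))"
      by (rule sum.swap)
    also have "\<dots> = (\<Sum>t\<in>D. \<kappa> t * (\<Sum>i\<in>I. \<Sum>j\<in>I. c i * c j * of_bool (f t i = f t j)))"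
      by (simp add: sum_distrib_left)
    also have "\<dots> \<ge> 0" by (intro sum_nonneg mult_nonneg_nonneg assms kernel_psd)
    finally show ?thesis .
  qed
  have K_sym: "K i j = K j i" for i j by (simp add: K_def eq_commute)
  have sw: "(\<Sum>i\<in>I. \<Sum>j\<in>I. b i * a j * K i j) = (\<Sum>i\<in>I. \<Sum>j\<in>I. a i * b j * K i j)"
    by (subst sum.swap, intro sum.cong refl) (metis K_sym mult.commute)
  have "0 \<le> (\<Sum>i\<in>I. \<Sum>j\<in>I. a i * a j * K i j) + 2 * t * (\<Sum>i\<in>I. \<Sum>j\<in>I. a i * b j * K i j)
      + t\<^sup>2 * (\<Sum>i\<in>I. \<Sum>j\<in>I. b i * b j * K i j)" for t
  proof -
    have "(\<Sum>i\<in>I. \<Sum>j\<in>I. (a i + t * b i) * (a j + t * b j) * K i j)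
        = (\<Sum>i\<in>I. \<Sum>j\<in>I. a i * a j * K i j + t * (a i * b j * K i j) + t * (b i * a j * K i j) + t\<^sup>2 * (b i * b j * K i j))"
      by (intro sum.cong refl) (simp add: algebra_simps power2_eq_square)
    also have "\<dots> = (\<Sum>i\<in>I. \<Sum>j\<in>I. a i * a j * K i j) + t * (\<Sum>i\<in>I. \<Sum>j\<in>I. a i * b j * K i j)
        + t * (\<Sum>i\<in>I. \<Sum>j\<in>I. b i * a j * K i j) + t\<^sup>2 * (\<Sum>i\<in>I. \<Sum>j\<in>I. b i * b j * K i j)"
      by (simp only: sum.distrib sum_distrib_left)
    finally show ?thesis using psd[of "\<lambda>i. a i + t * b i"] unfolding sw by simp
  qed
  then show ?thesis by (rule discriminant_le) (rule psd)
qed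

context fk begin

text \<open>\<open>of_bool (\<sigma> x = \<sigma> y) - 1 / q\<close> is, up to a factor, the scalar
  product of two Potts spins. Averaged over the colourings of one edge configuration it is 1 - 1 / q
  when x and y are connected, and 0 otherwise.\<close>

lemma spin_two_point:
  assumes "graph V E" "x \<in> V" "y \<in> V"
  shows "(\<Sum>\<sigma>\<in>V \<rightarrow>\<^sub>E {..<q}. (of_bool (\<sigma> x = \<sigma> y) - 1 / q) * (\<Prod>e\<in>E. 1 + sqrt q * of_bool (mono_on_edge \<sigma> e)))
    = (\<Sum>\<omega>\<in>Pow E. wt V \<omega>) * (1 - 1 / q) * ex V E (\<lambda>\<omega>. of_bool (conn \<omega> x y))"
proof -
  have "(\<Sum>\<sigma>\<in>col {..<q} V \<omega>. of_bool (\<sigma> x = \<sigma> y) - 1 / q)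
      = card (col {..<q} V \<omega>) * ((1 - 1 / q) * of_bool (conn \<omega> x y))" if "\<omega> \<subseteq> E" for \<omega>
  proof -
    let ?C = "col {..<q} V \<omega>"
    have fin: "finite ?C" using graph_finite[OF assms(1)] by (simp add: finite_col)
    have "(\<Sum>\<sigma>\<in>?C. of_bool (\<sigma> x = \<sigma> y) - 1 / real q) = real (card {\<sigma> \<in> ?C. \<sigma> x = \<sigma> y}) - card ?C / q"
      using fin by (simp add: sum_subtractf sum.inter_filter[symmetric] Int_def)
    also have "\<dots> = card ?C * ((1 - 1 / q) * of_bool (conn \<omega> x y))"
    proof (cases "conn \<omega> x y")
      case True
      then have "{\<sigma> \<in> ?C. \<sigma> x = \<sigma> y} = ?C" using col_conn[of _ "{..<q}" V \<omega> x y] by auto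
      then show ?thesis using True by (simp add: algebra_simps)
    next
      case False
      have "card {\<sigma> \<in> ?C. \<sigma> x = \<sigma> y} * card {..<q} = card ?C"
        using graph_finite[OF assms(1)] graph_subset_Pow[OF assms(1)] that assms(2,3) False
        by (intro card_col_agree) auto
      then have "real (card {\<sigma> \<in> ?C. \<sigma> x = \<sigma> y}) * q = card ?C"
        by (simp only: card_lessThan flip: of_nat_mult)
      then have "real (card {\<sigma> \<in> ?C. \<sigma> x = \<sigma> y}) = card ?C / q" using q_ge_2 by (simp add: field_simps)
      then show ?thesis using False by simp
    qed
    finally show ?thesis .
  qed
  then have "(\<Sum>\<sigma>\<in>V \<rightarrow>\<^sub>E {..<q}. (of_bool (\<sigma> x = \<sigma> y) - 1 / q) * (\<Prod>e\<in>E. 1 + sqrt q * of_bool (mono_on_edge \<sigma> e)))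
    = (\<Sum>\<omega>\<in>Pow E. wt V \<omega> * ((1 - 1 / q) * of_bool (conn \<omega> x y)))"
    unfolding edwards_sokal[OF assms(1) finite_lessThan] by (simp add: wt_def mult.assoc)
  also have "\<dots> = (\<Sum>\<omega>\<in>Pow E. wt V \<omega>) * ex V E (\<lambda>\<omega>. (1 - 1 / q) * of_bool (conn \<omega> x y))"
    using Z_pos[OF assms(1)] by (simp add: ex_def)
  finally show ?thesis by (simp add: ex_cmult)
qed

text \<open>Reflection in the line halfway between the columns -1 and 0. It preserves
  \<open>lbox 1 N\<close> and fixes no lattice point.\<close>

definition hrefl :: "pt \<Rightarrow> pt" where
  "hrefl x = (- 1 - fst x, snd x)"

lemma hrefl_hrefl [simp]: "hrefl (hrefl x) = x"
  by (simp add: hrefl_def)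

lemma inj_hrefl: "inj hrefl"
  by (metis injI hrefl_hrefl)

lemma ladj_hrefl: "ladj (hrefl x) (hrefl y) \<longleftrightarrow> ladj x y"
  by (auto simp: ladj_def hrefl_def)

text \<open>The spins on the two halves interact only through edges joining a point to its mirror
  image, and the weight of such an edge is a positive semidefinite kernel of its two spins. Folding
  the right half onto the left turns the Potts sum into a positive form, and the claim is
  Cauchy-Schwarz for observables on one half.\<close>

lemma reflection_positivity:
  assumes x: "x \<in> lbox 1 N" "fst x < 0" and y: "y \<in> lbox 1 N" "0 \<le> fst y"
  shows "(tp (lbox 1 N) x y)\<^sup>2 \<le> tp (lbox 1 N) x (hrefl x) * tp (lbox 1 N) y (hrefl y)"
proof -
  define S where "S = lbox 1 N"
  define L where "L = {v \<in> S. fst v < 0}"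
  define D where "D = {v \<in> L. fst v = - 1}"
  define \<Omega> where "\<Omega> = L \<rightarrow>\<^sub>E {..<q}"
  define w where "w \<sigma> = (\<Prod>e\<in>lat L. 1 + sqrt q * of_bool (mono_on_edge \<sigma> e))" for \<sigma> :: "pt \<Rightarrow> nat"
  \<comment> \<open>The right half is encoded by its mirror image, so that both halves range over
    the same set \<Omega>.\<close>
  define glue where "glue \<sigma> \<tau> = (\<lambda>v\<in>S. if v \<in> L then \<sigma> v else \<tau> (hrefl v))" for \<sigma> \<tau> :: "pt \<Rightarrow> nat"
  define K0 where "K0 \<sigma> \<tau> = (\<Prod>v\<in>D. 1 + sqrt q * of_bool (\<sigma> v = \<tau> v))" for \<sigma> \<tau> :: "pt \<Rightarrow> nat"
  have fin: "finite S" "finite L" "finite D" by (auto simp: S_def L_def D_def)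
  have gr: "graph S (lat S)" "graph L (lat L)" using fin by (auto intro: graph_lat)
  have fin\<Omega>: "finite \<Omega>" using fin by (simp add: \<Omega>_def finite_PiE)
  have reflS: "hrefl v \<in> S \<longleftrightarrow> v \<in> S" for v
    by (auto simp: S_def lbox_def hrefl_def mem_Times_iff)
  have reflL: "hrefl v \<in> L \<longleftrightarrow> v \<in> S \<and> v \<notin> L" for v
    using reflS[of v] by (auto simp: L_def hrefl_def)
  have SL: "S = L \<union> hrefl ` L"
  proof
    show "S \<subseteq> L \<union> hrefl ` L"
    proof
      fix v assume "v \<in> S"
      then show "v \<in> L \<union> hrefl ` L" using reflL[of v] by (cases "v \<in> L") (auto intro: image_eqI[of _ _ "hrefl v"])
    qed
    show "L \<union> hrefl ` L \<subseteq> S" using reflS by (auto simp: L_def)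
  qed
  define C where "C = (\<lambda>v. {v, hrefl v}) ` D"
  have lat_S: "lat S = lat L \<union> ((`) hrefl ` lat L) \<union> C"
  proof
    show "lat L \<union> ((`) hrefl ` lat L) \<union> C \<subseteq> lat S"
    proof -
      have "lat L \<subseteq> lat S" by (rule lat_mono) (auto simp: L_def)
      moreover have "(`) hrefl ` lat L \<subseteq> lat S"
        unfolding lat_image[OF ladj_hrefl] by (rule lat_mono) (use SL in auto)
      moreover have "{v, hrefl v} \<in> lat S" if "v \<in> D" for v
        using that reflS[of v] by (auto simp: lat_edge D_def L_def ladj_def hrefl_def)
      ultimately show ?thesis by (auto simp: C_def)
    qed
    show "lat S \<subseteq> lat L \<union> ((`) hrefl ` lat L) \<union> C"
    proof
      fix e assume "e \<in> lat S"
      then obtain u v where e: "e = {u, v}" "u \<in> S" "v \<in> S" "ladj u v" by (rule lat_cases)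
      have cross: "{u, v} \<in> C" if "u \<in> L" "v \<notin> L" "u \<in> S" "v \<in> S" "ladj u v" for u v
      proof -
        have "fst u = - 1" "v = hrefl u"
          using that by (auto simp: L_def ladj_def hrefl_def prod_eq_iff)
        then show ?thesis using that by (auto simp: C_def D_def)
      qed
      consider "u \<in> L" "v \<in> L" | "u \<in> L" "v \<notin> L" | "u \<notin> L" "v \<in> L" | "u \<notin> L" "v \<notin> L" by blast
      then show "e \<in> lat L \<union> ((`) hrefl ` lat L) \<union> C"
      proof cases
        case 1
        then show ?thesis using e by (simp add: lat_edge)
      next
        case 2
        then show ?thesis using cross[of u v] e by simp
      next
        case 3
        then show ?thesis using cross[of v u] e ladj_sym[of u v] by (simp add: insert_commute)
      next
        case 4
        then have "u \<in> hrefl ` L" "v \<in> hrefl ` L" using e SL by auto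
        then have "e \<in> lat (hrefl ` L)" using e by (simp add: lat_edge)
        then show ?thesis unfolding lat_image[OF ladj_hrefl] by simp
      qed
    qed
  qed
  have sign: "fst v < 0" if "v \<in> L" for v using that by (simp add: L_def)
  have disj: "lat L \<inter> ((`) hrefl ` lat L) = {}" "(lat L \<union> ((`) hrefl ` lat L)) \<inter> C = {}"
  proof -
    have a: "v \<in> L" if "e \<in> lat L" "v \<in> e" for e v using that by (auto elim!: lat_cases)
    have b: "v \<notin> L" if "e \<in> (`) hrefl ` lat L" "v \<in> e" for e v
      using that a reflL by auto
    have ne: "e \<noteq> {}" if "e \<in> lat L" for e using that by (auto elim!: lat_cases)
    show "lat L \<inter> ((`) hrefl ` lat L) = {}"
    proof (rule ccontr)
      assume "lat L \<inter> ((`) hrefl ` lat L) \<noteq> {}"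
      then obtain e where e: "e \<in> lat L" "e \<in> (`) hrefl ` lat L" by blast
      then obtain v where "v \<in> e" using ne by blast
      then show False using a[OF e(1)] b[OF e(2)] by blast
    qed
    have vD: "v \<in> L" "hrefl v \<notin> L" if "v \<in> D" for v using that reflL[of v] by (auto simp: D_def L_def)
    have "{v, hrefl v} \<notin> lat L" "{v, hrefl v} \<notin> (`) hrefl ` lat L" if "v \<in> D" for v
      using a[of "{v, hrefl v}" "hrefl v"] b[of "{v, hrefl v}" v] vD[OF that] by auto
    then show "(lat L \<union> ((`) hrefl ` lat L)) \<inter> C = {}" unfolding C_def by blast
  qed
  have pw: "(\<Prod>e\<in>lat S. 1 + sqrt q * of_bool (mono_on_edge (glue \<sigma> \<tau>) e)) = w \<sigma> * w \<tau> * K0 \<sigma> \<tau>" for \<sigma> \<tau>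
  proof -
    let ?h = "\<lambda>e. 1 + sqrt q * of_bool (mono_on_edge (glue \<sigma> \<tau>) e)"
    have finl: "finite (lat L)" "finite ((`) hrefl ` lat L)" "finite C"
      using graph_finite[OF gr(2)] fin by (auto simp: C_def)
    have "(\<Prod>e\<in>lat S. ?h e) = (\<Prod>e\<in>lat L. ?h e) * (\<Prod>e\<in>(`) hrefl ` lat L. ?h e) * (\<Prod>e\<in>C. ?h e)"
      unfolding lat_S using finl disj by (subst prod.union_disjoint; simp)+
    also have "(\<Prod>e\<in>lat L. ?h e) = w \<sigma>" unfolding w_def
    proof (intro prod.cong refl)
      fix e assume "e \<in> lat L"
      then have "v \<in> L \<and> v \<in> S" if "v \<in> e" for v using that by (auto elim!: lat_cases simp: L_def)
      then show "?h e = 1 + sqrt q * of_bool (mono_on_edge \<sigma> e)"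
        by (auto simp: mono_on_edge_def glue_def)
    qed
    also have "(\<Prod>e\<in>(`) hrefl ` lat L. ?h e) = (\<Prod>e\<in>lat L. ?h (hrefl ` e))"
      using inj_hrefl by (subst prod.reindex) (auto simp: inj_on_def inj_image_eq_iff)
    also have "\<dots> = w \<tau>" unfolding w_def
    proof (intro prod.cong refl)
      fix e assume "e \<in> lat L"
      then have "hrefl v \<notin> L \<and> hrefl v \<in> S" if "v \<in> e" for v
        using that reflL[of "hrefl v"] reflS[of v] by (auto elim!: lat_cases simp: L_def)
      then show "?h (hrefl ` e) = 1 + sqrt q * of_bool (mono_on_edge \<tau> e)"
        by (auto simp: mono_on_edge_def glue_def)
    qed
    also have "(\<Prod>e\<in>C. ?h e) = K0 \<sigma> \<tau>"
    proof -
      have "inj_on (\<lambda>v. {v, hrefl v}) D"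
        using reflL by (auto simp: inj_on_def doubleton_eq_iff D_def)
      moreover have "mono_on_edge (glue \<sigma> \<tau>) {v, hrefl v} \<longleftrightarrow> \<sigma> v = \<tau> v" if "v \<in> D" for v
      proof -
        have "v \<in> L" "v \<in> S" "hrefl v \<in> S" "hrefl v \<notin> L"
          using that reflL[of v] reflS[of v] by (auto simp: D_def L_def)
        then show ?thesis by (auto simp: mono_on_edge_def glue_def)
      qed
      ultimately show ?thesis unfolding C_def K0_def
        by (subst prod.reindex) (auto intro!: prod.cong)
    qed
    finally show ?thesis .
  qed
  have split: "(\<Sum>\<sigma>\<in>S \<rightarrow>\<^sub>E {..<q}. F \<sigma>) = (\<Sum>(\<sigma>, \<tau>)\<in>\<Omega> \<times> \<Omega>. F (glue \<sigma> \<tau>))" for F :: "(pt \<Rightarrow> nat) \<Rightarrow> real"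
  proof (rule sum.reindex_bij_witness[where i = "\<lambda>(\<sigma>, \<tau>). glue \<sigma> \<tau>" and j = "\<lambda>\<sigma>. (restrict \<sigma> L, \<lambda>v\<in>L. \<sigma> (hrefl v))"])
    fix \<sigma> assume \<sigma>: "\<sigma> \<in> S \<rightarrow>\<^sub>E {..<q}"
    show g: "(case (restrict \<sigma> L, \<lambda>v\<in>L. \<sigma> (hrefl v)) of (\<sigma>, \<tau>) \<Rightarrow> glue \<sigma> \<tau>) = \<sigma>"
    proof
      fix v
      show "(case (restrict \<sigma> L, \<lambda>v\<in>L. \<sigma> (hrefl v)) of (\<sigma>, \<tau>) \<Rightarrow> glue \<sigma> \<tau>) v = \<sigma> v"
        using PiE_arb[OF \<sigma>, of v] reflL[of v] by (cases "v \<in> S") (auto simp: glue_def)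
    qed
    show "(restrict \<sigma> L, \<lambda>v\<in>L. \<sigma> (hrefl v)) \<in> \<Omega> \<times> \<Omega>"
      using \<sigma> reflS by (auto simp: \<Omega>_def L_def)
    show "(case (restrict \<sigma> L, \<lambda>v\<in>L. \<sigma> (hrefl v)) of (\<sigma>, \<tau>) \<Rightarrow> F (glue \<sigma> \<tau>)) = F \<sigma>"
      using g by simp
  next
    fix st assume st: "st \<in> \<Omega> \<times> \<Omega>"
    obtain \<sigma> \<tau> where [simp]: "st = (\<sigma>, \<tau>)" by (cases st)
    have \<sigma>: "\<sigma> \<in> L \<rightarrow>\<^sub>E {..<q}" and \<tau>: "\<tau> \<in> L \<rightarrow>\<^sub>E {..<q}" using st by (auto simp: \<Omega>_def)
    have 1: "restrict (glue \<sigma> \<tau>) L = \<sigma>"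
    proof
      fix v show "restrict (glue \<sigma> \<tau>) L v = \<sigma> v"
        using PiE_arb[OF \<sigma>, of v] by (cases "v \<in> L") (auto simp: glue_def L_def)
    qed
    have 2: "(\<lambda>v\<in>L. glue \<sigma> \<tau> (hrefl v)) = \<tau>"
    proof
      fix v show "(\<lambda>v\<in>L. glue \<sigma> \<tau> (hrefl v)) v = \<tau> v"
        using PiE_arb[OF \<tau>, of v] reflL[of "hrefl v"] by (cases "v \<in> L") (auto simp: glue_def)
    qed
    show "(restrict (case st of (\<sigma>, \<tau>) \<Rightarrow> glue \<sigma> \<tau>) L, \<lambda>v\<in>L. (case st of (\<sigma>, \<tau>) \<Rightarrow> glue \<sigma> \<tau>) (hrefl v)) = st"
      using 1 2 by simp
    have "glue \<sigma> \<tau> v \<in> {..<q}" if "v \<in> S" for v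
      using that PiE_mem[OF \<sigma>, of v] PiE_mem[OF \<tau>, of "hrefl v"] reflL[of v] by (auto simp: glue_def)
    moreover have "glue \<sigma> \<tau> \<in> extensional S" by (simp add: glue_def)
    ultimately have "glue \<sigma> \<tau> \<in> S \<rightarrow>\<^sub>E {..<q}" unfolding PiE_def Pi_def by blast
    then show "(case st of (\<sigma>, \<tau>) \<Rightarrow> glue \<sigma> \<tau>) \<in> S \<rightarrow>\<^sub>E {..<q}" by simp
  qed
  \<comment> \<open>Expanding the product over the crossing edges writes \<open>K0\<close> as a
    nonnegative combination of kernels that test agreement on a subset t of \<open>D\<close>. The
    second component is an auxiliary colour in which \<open>K\<close> is diagonal.\<close>
  define K where "K i j = (\<Sum>t\<in>Pow D. sqrt q ^ card t * of_bool ((restrict (fst i) t, snd i) = (restrict (fst j) t, snd j)))"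
    for i j :: "(pt \<Rightarrow> nat) \<times> nat"
  have K_eq: "K (\<sigma>, c) (\<tau>, d) = (if c = d then K0 \<sigma> \<tau> else 0)" for \<sigma> \<tau> c d
  proof -
    have "K0 \<sigma> \<tau> = (\<Prod>v\<in>D. sqrt q * of_bool (\<sigma> v = \<tau> v) + 1)" by (simp add: K0_def add.commute)
    also have "\<dots> = (\<Sum>t\<in>Pow D. (\<Prod>v\<in>t. sqrt q * of_bool (\<sigma> v = \<tau> v)) * (\<Prod>v\<in>D - t. 1))"
      by (rule prod_add) (use fin in auto)
    also have "\<dots> = (\<Sum>t\<in>Pow D. sqrt q ^ card t * of_bool (restrict \<sigma> t = restrict \<tau> t))"
    proof (intro sum.cong refl)
      fix t assume "t \<in> Pow D"
      then have "finite t" using fin finite_subset by auto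
      then have "(\<Prod>v\<in>t. of_bool (\<sigma> v = \<tau> v) :: real) = of_bool (\<forall>v\<in>t. \<sigma> v = \<tau> v)"
        by (induction t rule: finite_induct) auto
      moreover have "(\<forall>v\<in>t. \<sigma> v = \<tau> v) \<longleftrightarrow> restrict \<sigma> t = restrict \<tau> t"
        by (auto simp: restrict_def fun_eq_iff)
      ultimately show "(\<Prod>v\<in>t. sqrt q * of_bool (\<sigma> v = \<tau> v)) * (\<Prod>v\<in>D - t. 1)
          = sqrt q ^ card t * of_bool (restrict \<sigma> t = restrict \<tau> t)"
        by (simp add: prod.distrib)
    qed
    finally show ?thesis by (simp add: K_def)
  qed
  define I where "I = \<Omega> \<times> {..<q}"
  define a where "a u i = (of_bool (fst i u = snd i) - 1 / q) * w (fst i)" for u and i :: "(pt \<Rightarrow> nat) \<times> nat"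
  define Z where "Z = (\<Sum>\<omega>\<in>Pow (lat S). wt S \<omega>) * (1 - 1 / q)"
  have Z: "0 < Z" using Z_pos[OF gr(1)] q_ge_2 by (simp add: Z_def)
  \<comment> \<open>The matrix with entries \<open>of_bool (m = k) - 1 / q\<close> is a projection,
    so it equals its square. This splits the two-spin observable into products of one-spin
    observables, one product for each colour.\<close>
  have colour_sum: "(\<Sum>c<q. (of_bool (m = c) - 1 / q) * (of_bool (k = c) - 1 / q)) = of_bool (m = k) - 1 / real q"
    if "m < q" "k < q" for m k :: nat
  proof -
    have "(\<Sum>c<q. (of_bool (m = c) - 1 / q) * (of_bool (k = c) - 1 / q))
        = (\<Sum>c<q. (if c = m then of_bool (k = m) else 0) - (if c = m then 1 / q else 0) - (if c = k then 1 / q else 0) + 1 / q * (1 / real q))"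
      by (intro sum.cong refl) (auto simp: algebra_simps)
    also have "\<dots> = of_bool (k = m) - 1 / q - 1 / q + q * (1 / q * (1 / real q))"
      using that by (simp add: sum.distrib sum_subtractf)
    also have "\<dots> = of_bool (m = k) - 1 / real q" using q_ge_2 by (auto simp: field_simps)
    finally show ?thesis .
  qed
  have form: "(\<Sum>i\<in>I. \<Sum>j\<in>I. a u i * a v j * K i j) = Z * tp S u (hrefl v)" if "u \<in> L" "v \<in> L" for u v
  proof -
    have uv: "u \<in> S" "hrefl v \<in> S" "hrefl v \<notin> L" using that reflS[of v] reflL[of v] by (auto simp: L_def)
    have "(\<Sum>i\<in>I. \<Sum>j\<in>I. a u i * a v j * K i j)
        = (\<Sum>\<sigma>\<in>\<Omega>. \<Sum>c<q. \<Sum>\<tau>\<in>\<Omega>. \<Sum>d<q. a u (\<sigma>, c) * a v (\<tau>, d) * K (\<sigma>, c) (\<tau>, d))"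
      by (simp add: I_def sum.cartesian_product')
    also have "\<dots> = (\<Sum>\<sigma>\<in>\<Omega>. \<Sum>c<q. \<Sum>\<tau>\<in>\<Omega>. a u (\<sigma>, c) * a v (\<tau>, c) * K0 \<sigma> \<tau>)"
      by (intro sum.cong refl) (simp add: K_eq if_distrib cong: if_cong)
    also have "\<dots> = (\<Sum>\<sigma>\<in>\<Omega>. \<Sum>\<tau>\<in>\<Omega>. \<Sum>c<q. a u (\<sigma>, c) * a v (\<tau>, c) * K0 \<sigma> \<tau>)"
      by (intro sum.cong refl sum.swap)
    also have "\<dots> = (\<Sum>\<sigma>\<in>\<Omega>. \<Sum>\<tau>\<in>\<Omega>. (of_bool (\<sigma> u = \<tau> v) - 1 / q) * (w \<sigma> * w \<tau> * K0 \<sigma> \<tau>))"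
    proof (intro sum.cong refl)
      fix \<sigma> \<tau> assume "\<sigma> \<in> \<Omega>" "\<tau> \<in> \<Omega>"
      then have "\<sigma> u < q" "\<tau> v < q" using that PiE_mem[of \<sigma> L "\<lambda>_. {..<q}" u] PiE_mem[of \<tau> L "\<lambda>_. {..<q}" v]
        by (simp_all add: \<Omega>_def)
      then have "(of_bool (\<sigma> u = \<tau> v) - 1 / q) * (w \<sigma> * w \<tau> * K0 \<sigma> \<tau>)
          = (\<Sum>c<q. (of_bool (\<sigma> u = c) - 1 / q) * (of_bool (\<tau> v = c) - 1 / q)) * (w \<sigma> * w \<tau> * K0 \<sigma> \<tau>)"
        by (simp only: colour_sum)
      also have "\<dots> = (\<Sum>c<q. a u (\<sigma>, c) * a v (\<tau>, c) * K0 \<sigma> \<tau>)"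
        unfolding sum_distrib_right by (intro sum.cong refl) (simp add: a_def)
      finally show "(\<Sum>c<q. a u (\<sigma>, c) * a v (\<tau>, c) * K0 \<sigma> \<tau>) = (of_bool (\<sigma> u = \<tau> v) - 1 / q) * (w \<sigma> * w \<tau> * K0 \<sigma> \<tau>)"
        by simp
    qed
    also have "\<dots> = (\<Sum>(\<sigma>, \<tau>)\<in>\<Omega> \<times> \<Omega>. (of_bool (glue \<sigma> \<tau> u = glue \<sigma> \<tau> (hrefl v)) - 1 / q)
        * (\<Prod>e\<in>lat S. 1 + sqrt q * of_bool (mono_on_edge (glue \<sigma> \<tau>) e)))"
    proof -
      have "glue \<sigma> \<tau> u = \<sigma> u" "glue \<sigma> \<tau> (hrefl v) = \<tau> v" for \<sigma> \<tau>
        using uv that by (simp_all add: glue_def)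
      then show ?thesis by (simp only: sum.cartesian_product pw)
    qed
    also have "\<dots> = (\<Sum>\<sigma>\<in>S \<rightarrow>\<^sub>E {..<q}. (of_bool (\<sigma> u = \<sigma> (hrefl v)) - 1 / q)
        * (\<Prod>e\<in>lat S. 1 + sqrt q * of_bool (mono_on_edge \<sigma> e)))"
      by (rule split[symmetric])
    also have "\<dots> = Z * tp S u (hrefl v)"
      unfolding spin_two_point[OF gr(1) uv(1,2)] by (simp add: Z_def tp_def)
    finally show ?thesis .
  qed
  \<comment> \<open>The second observable sits at \<open>hrefl y\<close>, the folded position of
    y.\<close>
  have xL: "x \<in> L" "hrefl y \<in> L" using x y reflL[of y] by (auto simp: L_def S_def)
  have "(\<Sum>i\<in>I. \<Sum>j\<in>I. a x i * a (hrefl y) j * K i j)\<^sup>2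
    \<le> (\<Sum>i\<in>I. \<Sum>j\<in>I. a x i * a x j * K i j) * (\<Sum>i\<in>I. \<Sum>j\<in>I. a (hrefl y) i * a (hrefl y) j * K i j)"
    unfolding K_def by (rule kernel_cauchy_schwarz) (auto simp: I_def fin\<Omega>)
  then have "(Z * tp S x y)\<^sup>2 \<le> (Z * tp S x (hrefl x)) * (Z * tp S (hrefl y) y)"
    using form xL by simp
  then have "Z\<^sup>2 * (tp S x y)\<^sup>2 \<le> Z\<^sup>2 * (tp S x (hrefl x) * tp S (hrefl y) y)"
    by (simp add: power2_eq_square ac_simps)
  then have "(tp S x y)\<^sup>2 \<le> tp S x (hrefl x) * tp S (hrefl y) y" using Z by simp
  then show ?thesis by (simp add: S_def tp_sym[of _ y])
qed

end

text \<open>Log-convexity makes the ratio of consecutive terms nondecreasing; a ratio above 1 would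
  persist and force geometric growth beyond the bound.\<close>

lemma log_convex_bounded_decreasing:
  fixes h :: "nat \<Rightarrow> real"
  assumes pos: "\<And>n. 0 < h n" and le: "\<And>n. h n \<le> 1"
    and conv: "\<And>n. (h (Suc n))\<^sup>2 \<le> h n * h (Suc (Suc n))"
  shows "h (Suc n) \<le> h n"
proof (rule ccontr)
  assume "\<not> h (Suc n) \<le> h n"
  define \<rho> where "\<rho> = h (Suc n) / h n"
  have \<rho>: "1 < \<rho>" using \<open>\<not> _\<close> pos[of n] by (simp add: \<rho>_def)
  have step: "\<rho> * h (n + k) \<le> h (Suc (n + k))" for k
  proof (induction k)
    case 0
    then show ?case using pos[of n] by (simp add: \<rho>_def)
  next
    case (Suc k)
    have "(\<rho> * h (n + k)) * h (Suc (n + k)) \<le> (h (Suc (n + k)))\<^sup>2"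
      unfolding power2_eq_square using Suc pos by (intro mult_right_mono) (auto simp: less_imp_le)
    also have "\<dots> \<le> h (n + k) * h (Suc (Suc (n + k)))" by (rule conv)
    finally have "h (n + k) * (\<rho> * h (Suc (n + k))) \<le> h (n + k) * h (Suc (Suc (n + k)))"
      by (simp add: ac_simps)
    then have "\<rho> * h (Suc (n + k)) \<le> h (Suc (Suc (n + k)))" using pos[of "n + k"] by simp
    then show ?case by simp
  qed
  have grow: "\<rho> ^ k * h n \<le> h (n + k)" for k
  proof (induction k)
    case (Suc k)
    have "\<rho> ^ Suc k * h n = \<rho> * (\<rho> ^ k * h n)" by simp
    also have "\<dots> \<le> \<rho> * h (n + k)" using Suc \<rho> by (intro mult_left_mono) auto
    also have "\<dots> \<le> h (n + Suc k)" using step[of k] by simp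
    finally show ?case .
  qed simp
  obtain k where "1 / h n < \<rho> ^ k" using real_arch_pow[OF \<rho>] by blast
  then have "1 < \<rho> ^ k * h n" using pos[of n] by (simp add: pos_divide_less_eq)
  then show False using grow[of k] le[of "n + k"] by simp
qed

section \<open>Behaviour of G along the axes and the uniform lower bound\<close>

context fk begin

lemma ex_pos:
  assumes "graph V E" "\<And>\<omega>. \<omega> \<subseteq> E \<Longrightarrow> 0 \<le> f \<omega>" "\<omega>\<^sub>0 \<subseteq> E" "0 < f \<omega>\<^sub>0"
  shows "0 < ex V E f"
proof -
  have "0 < wt V \<omega>\<^sub>0 * f \<omega>\<^sub>0" using wt_pos[OF assms(1,3)] assms(4) by simp
  also have "\<dots> \<le> (\<Sum>\<omega>\<in>Pow E. wt V \<omega> * f \<omega>)"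
    using graph_finite[OF assms(1)] assms wt_pos[OF assms(1)]
    by (intro member_le_sum) (auto simp: less_imp_le)
  finally show ?thesis using Z_pos[OF assms(1)] by (simp add: ex_def)
qed

lemma G_map_le:
  assumes "inj \<phi>" "\<And>x y. ladj (\<phi> x) (\<phi> y) \<longleftrightarrow> ladj x y"
  shows "G x y \<le> G (\<phi> x) (\<phi> y)"
  unfolding G_def[of x y]
proof (rule cSUP_least)
  fix S :: "pt set" assume "S \<in> {S. finite S}"
  then show "tp S x y \<le> G (\<phi> x) (\<phi> y)"
    using tp_le_G[of "\<phi> ` S" "\<phi> x" "\<phi> y"] tp_image[OF _ assms, of S x y] by simp
qed auto

lemma G_involution:
  assumes "\<And>x. \<phi> (\<phi> x) = x" "\<And>x y. ladj (\<phi> x) (\<phi> y) \<longleftrightarrow> ladj x y"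
  shows "G (\<phi> x) (\<phi> y) = G x y"
proof -
  have "inj \<phi>" by (metis assms(1) injI)
  then show ?thesis using G_map_le[of \<phi> x y] G_map_le[of \<phi> "\<phi> x" "\<phi> y"] assms by simp
qed

lemma G_swap: "G (prod.swap x) (prod.swap y) = G x y"
  by (rule G_involution) (auto simp: ladj_def)

lemma G_flip: "G (- fst x, snd x) (- fst y, snd y) = G x y"
  by (rule G_involution[of "\<lambda>x. (- fst x, snd x)" x y]) (auto simp: ladj_def)

lemma G_diff: "G x y = G (0, 0) (y - x)"
  using G_shift[of "- x" x y] by (simp add: zero_prod_def)

definition axis_G :: "nat \<Rightarrow> real" where
  "axis_G n = G (0, 0) (int n, 0)"

lemma axis_G: "G (0, 0) (a, 0) = axis_G (nat \<bar>a\<bar>)"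
  using G_flip[of "(0, 0)" "(a, 0)"] by (cases "0 \<le> a") (simp_all add: axis_G_def)

lemma axis_G_dist: "nat \<bar>b - a\<bar> = n \<Longrightarrow> G (a, 0) (b, 0) = axis_G n"
  using G_diff[of "(a, 0)" "(b, 0)"] axis_G[of "b - a"] by simp

lemma axis_G_add: "axis_G m * axis_G n \<le> axis_G (m + n)"
  using G_triangle[of "(0, 0)" "(int m, 0)" "(int m + int n, 0)"] G_diff[of "(int m, 0)" "(int m + int n, 0)"]
  by (simp add: axis_G_def)

text \<open>A single edge is open with positive probability, and supermultiplicativity does the
  rest.\<close>

lemma axis_G_pos: "0 < axis_G n"
proof (induction n)
  case 0
  then show ?case using G_refl[of "(0, 0)"] by (simp add: axis_G_def)
next
  case (Suc n)
  let ?S = "{(0, 0), (1, 0)} :: pt set"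
  have "{(0, 0), (1, 0)} \<in> lat ?S" by (simp add: lat_edge ladj_def)
  then have "conn (lat ?S) (0, 0) (1, 0)" by (rule conn_edge)
  then have "0 < tp ?S (0, 0) (1, 0)"
    unfolding tp_def by (intro ex_pos[where \<omega>\<^sub>0 = "lat ?S"] graph_lat) auto
  also have "\<dots> \<le> axis_G 1" using tp_le_G[of ?S] by (simp add: axis_G_def)
  finally have "0 < axis_G n * axis_G 1" using Suc by simp
  then show ?case using axis_G_add[of n 1] by simp
qed

lemma axis_G_le_G: "axis_G (nat \<bar>a\<bar>) * axis_G (nat \<bar>b\<bar>) \<le> G (0, 0) (a, b)"
proof -
  have "G (a, 0) (a, b) = axis_G (nat \<bar>b\<bar>)"
    using G_diff[of "(a, 0)" "(a, b)"] G_swap[of "(0, 0)" "(b, 0)"] axis_G[of b] by simp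
  then show ?thesis using G_triangle[of "(0, 0)" "(a, 0)" "(a, b)"] axis_G[of a] by simp
qed

text \<open>Limit along the boxes with p = 1, the ones that the reflection preserves.\<close>

lemma G_reflection:
  assumes "fst x < 0" "0 \<le> fst y"
  shows "(G x y)\<^sup>2 \<le> G x (hrefl x) * G y (hrefl y)"
proof (rule LIMSEQ_le)
  show "(\<lambda>N. (tp (lbox 1 N) x y)\<^sup>2) \<longlonglongrightarrow> (G x y)\<^sup>2"
    by (intro tendsto_power tp_tendsto_G)
  show "(\<lambda>N. tp (lbox 1 N) x (hrefl x) * tp (lbox 1 N) y (hrefl y)) \<longlonglongrightarrow> G x (hrefl x) * G y (hrefl y)"
    by (intro tendsto_mult tp_tendsto_G)
  obtain M where "\<forall>n\<ge>M. {x, y} \<subseteq> lbox 1 n"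
    using finite_subset_lbox[of "{x, y}" 1] unfolding eventually_sequentially by blast
  then show "\<exists>N. \<forall>n\<ge>N. (tp (lbox 1 n) x y)\<^sup>2 \<le> tp (lbox 1 n) x (hrefl x) * tp (lbox 1 n) y (hrefl y)"
    using reflection_positivity assms by blast
qed

text \<open>A point and its mirror image are at odd distance, because the mirror runs between
  lattice columns; hence log-convexity is obtained along odd distances.\<close>

lemma axis_G_odd_decreasing: "axis_G (2 * Suc n + 1) \<le> axis_G (2 * n + 1)"
proof (rule log_convex_bounded_decreasing[of "\<lambda>n. axis_G (2 * n + 1)"])
  show "axis_G (2 * n + 1) \<le> 1" for n by (simp add: axis_G_def G_le_1)
  fix n
  \<comment> \<open>The distances from x to its mirror image, from x to y, and from y to its mirror
    image are 2 n + 1, 2 n + 3 and 2 n + 5.\<close>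
  let ?x = "(- 1 - int n, 0)" and ?y = "(int (n + 2), 0)"
  have "G ?x ?y = axis_G (2 * Suc n + 1)" by (rule axis_G_dist) simp
  moreover have "G ?x (hrefl ?x) = axis_G (2 * n + 1)"
    unfolding hrefl_def fst_conv snd_conv by (rule axis_G_dist) simp
  moreover have "G ?y (hrefl ?y) = axis_G (2 * Suc (Suc n) + 1)"
    unfolding hrefl_def fst_conv snd_conv by (rule axis_G_dist) simp
  ultimately show "(axis_G (2 * Suc n + 1))\<^sup>2 \<le> axis_G (2 * n + 1) * axis_G (2 * Suc (Suc n) + 1)"
    using G_reflection[of ?x ?y] by simp
qed (rule axis_G_pos)

text \<open>A distant pair with large \<open>G\<close> is moved to the axis. At odd distances along
  the axis \<open>G\<close> decreases, so a bound that holds arbitrarily far out holds at all of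
  them. One more step covers the even distances, and an axis-parallel path covers the other
  pairs.\<close>

lemma G_bounded_below:
  assumes "0 < \<epsilon>" and far: "\<And>R. \<exists>x y. R \<le> \<bar>fst x - fst y\<bar> + \<bar>snd x - snd y\<bar> \<and> \<epsilon> \<le> G x y"
  shows "\<exists>c>0. \<forall>x y. c \<le> G x y"
proof -
  define g1 where "g1 = axis_G 1"
  have g1: "0 < g1" "g1 \<le> 1" using axis_G_pos[of 1] G_le_1 by (simp_all add: g1_def axis_G_def)
  have far_axis: "\<exists>A::nat. n \<le> A \<and> \<epsilon>\<^sup>2 \<le> axis_G (2 * A)" for n :: nat
  proof -
    \<comment> \<open>From the origin to (a, b) and on to (2 a, 0): the two displacements are mirror
      images of each other, and the second coordinate cancels.\<close>
    have double: "\<epsilon>\<^sup>2 \<le> axis_G (2 * nat \<bar>a\<bar>)" if "\<epsilon> \<le> G (0, 0) (a, b)" for a b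
    proof -
      have "G (a, b) (2 * a, 0) = G (0, 0) (a, - b)" by (subst G_diff) simp
      also have "\<dots> = G (0, 0) (- b, a)" using G_swap[of "(0, 0)" "(a, - b)"] by simp
      also have "\<dots> = G (0, 0) (b, a)" using G_flip[of "(0, 0)" "(b, a)"] by simp
      also have "\<dots> = G (0, 0) (a, b)" using G_swap[of "(0, 0)" "(a, b)"] by simp
      finally have "G (0, 0) (a, b) * G (0, 0) (a, b) \<le> axis_G (nat \<bar>2 * a\<bar>)"
        using G_triangle[of "(0, 0)" "(a, b)" "(2 * a, 0)"] axis_G[of "2 * a"] by simp
      moreover have "\<epsilon> * \<epsilon> \<le> G (0, 0) (a, b) * G (0, 0) (a, b)"
        using that assms(1) by (intro mult_mono) auto
      moreover have "nat \<bar>2 * a\<bar> = 2 * nat \<bar>a\<bar>" by (simp add: abs_mult nat_mult_distrib)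
      ultimately show ?thesis by (simp add: power2_eq_square)
    qed
    obtain x y where xy: "2 * int n \<le> \<bar>fst x - fst y\<bar> + \<bar>snd x - snd y\<bar>" "\<epsilon> \<le> G x y"
      using far[of "2 * int n"] by blast
    define a b where "a = fst y - fst x" and "b = snd y - snd x"
    have G: "\<epsilon> \<le> G (0, 0) (a, b)" using xy(2) G_diff[of x y] by (simp add: a_def b_def prod_eq_iff minus_prod_def)
    then have G': "\<epsilon> \<le> G (0, 0) (b, a)" using G_swap[of "(0, 0)" "(a, b)"] by simp
    \<comment> \<open>One coordinate carries at least half of the distance; the symmetry in the
      diagonal allows it to be either one.\<close>
    have "n \<le> nat \<bar>a\<bar> \<or> n \<le> nat \<bar>b\<bar>" using xy(1) by (auto simp: a_def b_def)
    then show ?thesis using double[OF G] double[OF G'] by blast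
  qed
  have dec: "axis_G (2 * n + 1) \<le> axis_G (2 * m + 1)" if "m \<le> n" for m n
    using that
  proof (induction n rule: dec_induct)
    case (step n)
    then show ?case using axis_G_odd_decreasing[of n] by simp
  qed simp
  have odd_ge: "\<epsilon>\<^sup>2 * g1 \<le> axis_G (2 * n + 1)" for n
  proof -
    obtain A where A: "Suc n \<le> A" "\<epsilon>\<^sup>2 \<le> axis_G (2 * A)" using far_axis by blast
    have "\<epsilon>\<^sup>2 * g1 \<le> axis_G (2 * A) * g1" using A g1 by (intro mult_right_mono) auto
    also have "\<dots> \<le> axis_G (2 * A + 1)" using axis_G_add[of "2 * A" 1] by (simp add: g1_def)
    also have "\<dots> \<le> axis_G (2 * n + 1)" using A by (intro dec) simp
    finally show ?thesis .
  qed
  \<comment> \<open>The 1 covers distance 0, and the second factor \<open>g1\<close> pays for the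
    step from odd to even distances.\<close>
  define c where "c = min 1 (\<epsilon>\<^sup>2 * g1 * g1)"
  have c: "0 < c" using g1 assms(1) by (simp add: c_def)
  have ge: "c \<le> axis_G n" for n
  proof (cases "even n")
    case False
    then obtain k where "n = 2 * k + 1" by (elim oddE)
    moreover have "\<epsilon>\<^sup>2 * g1 * g1 \<le> \<epsilon>\<^sup>2 * g1" using g1 assms(1) mult_left_le[of g1 "\<epsilon>\<^sup>2 * g1"] by simp
    ultimately show ?thesis using odd_ge[of k] by (simp add: c_def)
  next
    case True
    show ?thesis
    proof (cases n)
      case 0
      then show ?thesis using G_refl[of "(0, 0)"] by (simp add: c_def axis_G_def)
    next
      case (Suc m)
      with True have "odd m" by simp
      then obtain k where k: "m = 2 * k + 1" by (elim oddE)
      have "\<epsilon>\<^sup>2 * g1 * g1 \<le> axis_G m * g1" using odd_ge[of k] g1 k by (intro mult_right_mono) auto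
      also have "\<dots> \<le> axis_G n" using axis_G_add[of m 1] Suc by (simp add: g1_def)
      finally show ?thesis by (simp add: c_def)
    qed
  qed
  have "c * c \<le> G x y" for x y
  proof -
    have "c * c \<le> axis_G (nat \<bar>fst (y - x)\<bar>) * axis_G (nat \<bar>snd (y - x)\<bar>)"
      using ge c by (intro mult_mono) (auto intro: less_imp_le order_trans)
    also have "\<dots> \<le> G x y" using axis_G_le_G[of "fst (y - x)" "snd (y - x)"]
      by (simp only: prod.collapse G_diff[of x y])
    finally show ?thesis .
  qed
  then show ?thesis using c by (intro exI[of _ "c * c"]) simp
qed

lemma gam_pos:
  assumes "0 < c" "\<And>x y. c \<le> G x y"
  shows "0 < gam"
proof -
  have "c \<le> gam" unfolding gam_def
  proof (rule cInf_greatest[OF gam_set_nonempty])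
    fix t assume "t \<in> gam_set"
    then obtain V d where t: "t = (\<Sum>x\<in>V. \<Sum>y\<in>V. d x * d y * G x y)" "\<forall>x\<in>V. 0 \<le> d x" "sum d V = 1"
      unfolding gam_set_def by blast
    have "c = (\<Sum>x\<in>V. \<Sum>y\<in>V. d x * d y * c)"
      using t(3) by (simp add: sum_distrib_left[symmetric] sum_distrib_right[symmetric])
    also have "\<dots> \<le> t" unfolding t(1) using t(2) assms(2) by (intro sum_mono mult_left_mono) auto
    finally show "c \<le> t" .
  qed
  then show ?thesis using assms(1) by simp
qed

end

section \<open>Concentration of cluster densities\<close>

text \<open>Convexity of a positive form: the uniform distribution on the union is the average of
  those on the blocks.\<close>

lemma kav_blocks:
  fixes k :: "'v \<Rightarrow> 'v \<Rightarrow> real" and A :: "'i \<Rightarrow> 'v set"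
  assumes I: "finite I" "I \<noteq> {}" and A: "\<And>i. i \<in> I \<Longrightarrow> finite (A i)" "\<And>i. i \<in> I \<Longrightarrow> card (A i) = m" "0 < m"
    and disj: "\<And>i j. i \<in> I \<Longrightarrow> j \<in> I \<Longrightarrow> i \<noteq> j \<Longrightarrow> A i \<inter> A j = {}"
    and sym: "\<And>x y. k x y = k y x"
    and psd: "\<And>V c. finite V \<Longrightarrow> 0 \<le> (\<Sum>x\<in>V. \<Sum>y\<in>V. c x * c y * k x y)"
  shows "kav k (\<Union>i\<in>I. A i) (\<Union>i\<in>I. A i) \<le> (\<Sum>i\<in>I. kav k (A i) (A i)) / card I"
proof -
  define c where "c = real (card I)"
  have c: "0 < c" using I by (simp add: c_def card_gt_0_iff)
  have U: "(\<Sum>x\<in>(\<Union>i\<in>I. A i). g x) = (\<Sum>i\<in>I. \<Sum>x\<in>A i. g x)" for g :: "'v \<Rightarrow> real"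
    by (rule sum.UNION_disjoint) (use I A disj in auto)
  have cU: "card (\<Union>i\<in>I. A i) = card I * m"
    using I A disj by (subst card_UN_disjoint) auto
  have "(\<Sum>x\<in>(\<Union>i\<in>I. A i). \<Sum>y\<in>(\<Union>i\<in>I. A i). k x y) = (\<Sum>i\<in>I. \<Sum>j\<in>I. \<Sum>x\<in>A i. \<Sum>y\<in>A j. k x y)"
    unfolding U by (intro sum.cong refl sum.swap)
  also have "\<dots> = (\<Sum>i\<in>I. \<Sum>j\<in>I. (real m * real m) * kav k (A i) (A j))"
    using A by (intro sum.cong refl) (simp add: kav_def)
  also have "\<dots> \<le> (\<Sum>i\<in>I. \<Sum>j\<in>I. (real m * real m) * ((kav k (A i) (A i) + kav k (A j) (A j)) / 2))"
  proof (intro sum_mono mult_left_mono)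
    fix i j assume "i \<in> I" "j \<in> I"
    then have "2 * kav k (A i) (A j) \<le> kav k (A i) (A i) + kav k (A j) (A j)"
      by (intro kav_mixed sym psd A)
    then show "kav k (A i) (A j) \<le> (kav k (A i) (A i) + kav k (A j) (A j)) / 2" by simp
  qed auto
  also have "\<dots> = (real m * real m) * (c * (\<Sum>i\<in>I. kav k (A i) (A i)))"
    by (simp add: sum_distrib_left[symmetric] sum_divide_distrib[symmetric] sum.distrib c_def)
  finally have "(\<Sum>x\<in>(\<Union>i\<in>I. A i). \<Sum>y\<in>(\<Union>i\<in>I. A i). k x y) \<le> (real m * real m) * (c * (\<Sum>i\<in>I. kav k (A i) (A i)))" .
  then have "kav k (\<Union>i\<in>I. A i) (\<Union>i\<in>I. A i)
      \<le> ((real m * real m) * (c * (\<Sum>i\<in>I. kav k (A i) (A i)))) / ((c * real m) * (c * real m))"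
    unfolding kav_def[of k "\<Union>i\<in>I. A i"] cU c_def[symmetric] of_nat_mult by (rule divide_right_mono) simp
  also have "\<dots> = (\<Sum>i\<in>I. kav k (A i) (A i)) / c" using c A(3) by (simp add: field_simps)
  finally show ?thesis by (simp add: c_def)
qed

text \<open>For A = B this is the sum of the squared densities of the clusters in A.\<close>

definition cav :: "'v set set \<Rightarrow> 'v set \<Rightarrow> 'v set \<Rightarrow> real" where
  "cav \<omega> = kav (\<lambda>x y. of_bool (conn \<omega> x y))"

lemma cav_mono: "\<omega> \<subseteq> \<omega>' \<Longrightarrow> cav \<omega> A B \<le> cav \<omega>' A B"
  unfolding cav_def kav_def by (intro divide_right_mono sum_mono) (auto dest: conn_mono)

lemma cav_nonneg: "0 \<le> cav \<omega> A B"
  unfolding cav_def kav_def by (intro divide_nonneg_nonneg sum_nonneg) auto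

lemma cav_le_1: "cav \<omega> A B \<le> 1"
proof -
  have "(\<Sum>x\<in>A. \<Sum>y\<in>B. of_bool (conn \<omega> x y)) \<le> (\<Sum>x\<in>A. \<Sum>y\<in>B. 1 :: real)" by (intro sum_mono) auto
  then have "(\<Sum>x\<in>A. \<Sum>y\<in>B. of_bool (conn \<omega> x y)) / (real (card A) * real (card B))
      \<le> (real (card A) * real (card B)) / (real (card A) * real (card B))"
    by (intro divide_right_mono) auto
  also have "\<dots> \<le> 1" by simp
  finally show ?thesis by (simp add: cav_def kav_def)
qed

lemma cav_mixed:
  assumes "finite A" "finite B"
  shows "2 * cav \<omega> A B \<le> cav \<omega> A A + cav \<omega> B B"
  unfolding cav_def
proof (rule kav_mixed[OF assms])
  show "of_bool (conn \<omega> x y) = of_bool (conn \<omega> y x)" for x y by (subst conn_sym) (rule HOL.refl)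
  show "0 \<le> (\<Sum>x\<in>V. \<Sum>y\<in>V. c x * c y * of_bool (conn \<omega> x y))" if "finite V" for V and c :: "_ \<Rightarrow> real"
    by (rule conn_psd[OF that, where p = "\<lambda>x. x"])
qed

lemma lat_edgeD: "e \<in> lat S \<Longrightarrow> e \<subseteq> S \<and> e \<noteq> {}"
  by (erule lat_cases) simp

text \<open>Translates of a box by multiples of its side tile the lattice;
  \<open>(x + n) div L\<close> is the coordinate of the tile that contains x.\<close>

lemma block_index:
  fixes L n p x i :: int
  assumes "L = 2 * n + 1 - p" "0 < L"
  shows "x - L * i \<in> {- n..n - p} \<longleftrightarrow> i = (x + n) div L"
proof
  assume "x - L * i \<in> {- n..n - p}"
  then have "0 \<le> x + n - L * i" "x + n - L * i < L" using assms(1) by auto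
  moreover have "x + n = (x + n - L * i) + L * i" by simp
  ultimately show "i = (x + n) div L" using div_pos_pos_trivial[of "x + n - L * i" L]
    by (metis add.commute assms(2) div_mult_self2 less_irrefl add.right_neutral add_0)
next
  assume "i = (x + n) div L"
  then have "x + n - L * i = (x + n) mod L" by (simp add: minus_mult_div_eq_mod)
  then show "x - L * i \<in> {- n..n - p}"
    using pos_mod_bound[OF assms(2), of "x + n"] pos_mod_sign[OF assms(2), of "x + n"] assms(1) by auto
qed

text \<open>The tiles with indices up to h in absolute value fill a box of the same parity, since 2
  h + 1 is odd.\<close>

lemma block_range:
  fixes L n p x :: int and h :: nat
  assumes "L = 2 * n + 1 - p" "0 < L"
  shows "(x + n) div L \<in> {- int h..int h} \<longleftrightarrow> x \<in> {- (int h * L + n)..int h * L + n - p}"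
proof -
  have less: "m div L < k \<longleftrightarrow> m < k * L" for m k :: int
  proof
    assume "m div L < k"
    then have "(m div L + 1) * L \<le> k * L" using assms(2) by (intro mult_right_mono) auto
    then have "(m div L) * L + L \<le> k * L" by (simp add: distrib_right)
    moreover have "m = (m div L) * L + m mod L" by simp
    ultimately show "m < k * L" using pos_mod_bound[OF assms(2), of m] by linarith
  next
    assume "m < k * L"
    show "m div L < k"
    proof (rule ccontr)
      assume "\<not> m div L < k"
      then have "k * L \<le> (m div L) * L" using assms(2) by (intro mult_right_mono) auto
      moreover have "m = (m div L) * L + m mod L" by simp
      ultimately show False using \<open>m < k * L\<close> pos_mod_sign[OF assms(2), of m] by linarith
    qed
  qed
  have "- int h \<le> (x + n) div L \<longleftrightarrow> - int h * L \<le> x + n"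
    using less[of "x + n" "- int h"] by linarith
  moreover have "(x + n) div L \<le> int h \<longleftrightarrow> x + n < (int h + 1) * L"
    using less[of "x + n" "int h + 1"] by linarith
  ultimately have "(x + n) div L \<in> {- int h..int h} \<longleftrightarrow> - (int h * L) \<le> x + n \<and> x + n < int h * L + L"
    by (simp add: distrib_right)
  moreover define P where "P = int h * L"
  ultimately have "(x + n) div L \<in> {- int h..int h} \<longleftrightarrow> - P \<le> x + n \<and> x + n < P + L"
    by simp
  also have "\<dots> \<longleftrightarrow> x \<in> {- (P + n)..P + n - p}" using assms(1) by auto
  finally show ?thesis by (simp add: P_def)
qed

context fk begin

lemma lex_cav: "lex S (\<lambda>\<omega>. cav \<omega> A B) = kav (tp S) A B"
proof -
  have "lex S (\<lambda>\<omega>. cav \<omega> A B) = lex S (\<lambda>\<omega>. (1 / (real (card A) * real (card B))) * (\<Sum>x\<in>A. \<Sum>y\<in>B. of_bool (conn \<omega> x y)))"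
    by (simp add: cav_def kav_def)
  also have "\<dots> = kav (tp S) A B"
    unfolding ex_cmult ex_sum by (simp add: kav_def tp_def)
  finally show ?thesis .
qed

lemma kav_tp_le_Gav: "finite S \<Longrightarrow> kav (tp S) A B \<le> Gav A B"
  unfolding kav_def by (intro divide_right_mono sum_mono tp_le_G) auto

lemma kav_tp_tendsto: "(\<lambda>N. kav (tp (lbox p N)) A B) \<longlonglongrightarrow> Gav A B"
  unfolding kav_def divide_inverse by (intro tendsto_mult tendsto_sum tp_tendsto_G tendsto_const)

lemma kav_image:
  assumes "inj \<phi>"
  shows "kav k (\<phi> ` A) (\<phi> ` B) = kav (\<lambda>x y. k (\<phi> x) (\<phi> y)) A B"
  using assms by (simp add: kav_def sum.reindex card_image inj_on_subset[OF assms subset_UNIV])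

text \<open>The average over blocks of local approximations is concentrated because of FKG and the domain
  Markov property; by convexity it dominates the average over the large box, and their means nearly
  agree.\<close>

lemma concentration:
  assumes p: "p \<in> {0, 1}" and "0 < \<delta>"
  shows "\<exists>K\<ge>K\<^sub>0. \<forall>\<^sub>F N in sequentially.
    lex (lbox p N) (\<lambda>\<omega>. \<bar>cav \<omega> (lbox p K) (lbox p K) - gam\<bar>) \<le> \<delta>"
proof -
  \<comment> \<open>The errors below add up to at most 4 e + 2 t. As the variance is at most 4 e, a
    mean deviation of order t requires e to be the square of t.\<close>
  define t where "t = min 1 (\<delta> / 6)"
  define e where "e = t\<^sup>2"
  have t: "0 < t" "t \<le> 1" "6 * t \<le> \<delta>" using assms(2) by (auto simp: t_def)
  have e: "0 < e" "e \<le> t" using t by (auto simp: e_def power2_eq_square mult_left_le)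
  obtain n where n: "1 \<le> n" "Gav (lbox p n) (lbox p n) \<le> gam + e"
    using mean_ergodic[OF p e(1)] by (metis nat_le_linear)
  define A where "A = lbox p n"
  define g where "g = Gav A A"
  define L where "L = 2 * int n + 1 - p"
  have L: "1 \<le> L" using n p by (auto simp: L_def)
  have A: "finite A" "A \<noteq> {}" using p n by (auto simp: A_def lbox_def)
  have g: "gam \<le> g" "g \<le> gam + e" "g \<le> 1" "0 \<le> g"
  proof -
    show "gam \<le> g" unfolding g_def by (rule gam_le_Gav[OF A])
    show "g \<le> gam + e" using n by (simp add: g_def A_def)
    have "kav (tp (lbox p N)) A A \<le> 1" for N
      unfolding lex_cav[symmetric] using ex_mono[OF graph_lat, of "lbox p N" "\<lambda>\<omega>. cav \<omega> A A" "\<lambda>_. 1"]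
      by (simp add: cav_le_1 graph_lat)
    then show "g \<le> 1" unfolding g_def by (intro LIMSEQ_le_const2[OF kav_tp_tendsto[of p]]) auto
    show "0 \<le> g" unfolding g_def kav_def by (intro divide_nonneg_nonneg sum_nonneg G_nonneg) auto
  qed
  \<comment> \<open>M is a radius at which the free average over the block, computed in the finite
    neighbourhood only, nearly attains its infinite-volume value.\<close>
  have "\<forall>\<^sub>F M in sequentially. g - e < kav (tp (lbox p M)) A A"
    using order_tendstoD(1)[OF kav_tp_tendsto[of p A A], of "g - e"] e by (simp add: g_def)
  then obtain M where M: "n \<le> M" "g - e < kav (tp (lbox p M)) A A"
    unfolding eventually_sequentially by (metis nat_le_linear)
  \<comment> \<open>A block has at most (4 M + 1)^2 blocks whose neighbourhoods meet its own. As
    there are at least h blocks, such pairs make up at most a fraction e of all pairs.\<close>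
  obtain h where h: "K\<^sub>0 \<le> h" "real ((4 * M + 1)\<^sup>2) / e \<le> real h"
  proof
    let ?m = "nat \<lceil>real ((4 * M + 1)\<^sup>2) / e\<rceil>"
    show "K\<^sub>0 \<le> max K\<^sub>0 ?m" by simp
    have "real ((4 * M + 1)\<^sup>2) / e \<le> real ?m" by (rule real_nat_ceiling_ge)
    also have "\<dots> \<le> real (max K\<^sub>0 ?m)" by (simp only: of_nat_le_iff max.cobounded2)
    finally show "real ((4 * M + 1)\<^sup>2) / e \<le> real (max K\<^sub>0 ?m)" .
  qed
  define I :: "pt set" where "I = {- int h..int h} \<times> {- int h..int h}"
  define v where "v i = (L * fst i, L * snd i)" for i :: pt
  define Ai where "Ai i = (+) (v i) ` A" for i
  define R where "R i = (+) (v i) ` lbox p M" for i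
  \<comment> \<open>The radius of the box that is tiled by the blocks.\<close>
  define K where "K = nat (int h * L + int n)"
  define c where "c = real (card I)"
  have I: "finite I" "I \<noteq> {}" by (auto simp: I_def)
  have cI: "c = (2 * real h + 1)\<^sup>2" by (simp add: c_def I_def card_cartesian_product power2_eq_square)
  have c0: "0 < c" by (simp add: cI add_nonneg_pos)
  have KK: "K\<^sub>0 \<le> K"
  proof -
    have "int h \<le> int h * L" using L mult_left_mono[of 1 L "int h"] by simp
    then have "h \<le> K" by (simp add: K_def)
    then show ?thesis using h(1) by simp
  qed
  have mem_Ai: "x \<in> Ai i \<longleftrightarrow> fst i = (fst x + int n) div L \<and> snd i = (snd x + int n) div L" for x i
  proof -
    have "x \<in> Ai i \<longleftrightarrow> x - v i \<in> A"
      unfolding Ai_def by (metis (no_types, lifting) add.commute diff_add_cancel image_iff add_diff_cancel_left')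
    also have "\<dots> \<longleftrightarrow> fst x - L * fst i \<in> {- int n..int n - p} \<and> snd x - L * snd i \<in> {- int n..int n - p}"
      by (simp add: A_def lbox_def v_def mem_Times_iff)
    also have "\<dots> \<longleftrightarrow> fst i = (fst x + int n) div L \<and> snd i = (snd x + int n) div L"
      using block_index[of L "int n" p] L by (simp add: L_def)
    finally show ?thesis .
  qed
  have U: "(\<Union>i\<in>I. Ai i) = lbox p K"
  proof (intro set_eqI)
    fix x
    have "int K = int h * L + int n" using L by (simp add: K_def)
    then have "x \<in> lbox p K \<longleftrightarrow> (fst x + int n) div L \<in> {- int h..int h} \<and> (snd x + int n) div L \<in> {- int h..int h}"
      using block_range[of L "int n" p] L by (simp add: lbox_def mem_Times_iff L_def)
    also have "\<dots> \<longleftrightarrow> x \<in> (\<Union>i\<in>I. Ai i)"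
    proof -
      have "x \<in> (\<Union>i\<in>I. Ai i) \<longleftrightarrow> ((fst x + int n) div L, (snd x + int n) div L) \<in> I"
        using mem_Ai by (auto simp: prod_eq_iff) (metis prod.collapse)
      then show ?thesis by (simp add: I_def)
    qed
    finally show "x \<in> (\<Union>i\<in>I. Ai i) \<longleftrightarrow> x \<in> lbox p K" by simp
  qed
  have disjA: "Ai i \<inter> Ai j = {}" if "i \<noteq> j" for i j
  proof (rule ccontr)
    assume "Ai i \<inter> Ai j \<noteq> {}"
    then obtain x where "x \<in> Ai i" "x \<in> Ai j" by blast
    then show False using that mem_Ai[of x i] mem_Ai[of x j] by (simp add: prod_eq_iff)
  qed
  have inj_v: "inj ((+) (v i))" for i by simp
  have cardAi: "finite (Ai i)" "card (Ai i) = card A" for i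
    using A by (auto simp: Ai_def card_image)
  have finR: "finite (R i)" for i by (simp add: R_def)
  have tpR: "kav (tp (R i)) (Ai i) (Ai i) = kav (tp (lbox p M)) A A" for i
    unfolding R_def Ai_def kav_image[OF inj_v] by (simp add: tp_image ladj_shift)
  have GAi: "Gav (Ai i) (Ai i) = g" for i
    unfolding g_def Ai_def kav_image[OF inj_v] by (simp add: G_shift)
  define bad where "bad i j \<longleftrightarrow> R i \<inter> R j \<noteq> {}" for i j
  have bad_count: "(\<Sum>j\<in>I. of_bool (bad i j) :: real) \<le> real ((4 * M + 1)\<^sup>2)" for i
  proof -
    let ?J = "{fst i - 2 * int M..fst i + 2 * int M} \<times> {snd i - 2 * int M..snd i + 2 * int M}"
    have "{j \<in> I. bad i j} \<subseteq> ?J"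
    proof
      fix j assume "j \<in> {j \<in> I. bad i j}"
      then obtain z where z: "z \<in> R i" "z \<in> R j" unfolding bad_def by blast
      obtain a where a: "a \<in> lbox p M" "z = v i + a" using z(1) unfolding R_def by blast
      obtain b where b: "b \<in> lbox p M" "z = v j + b" using z(2) unfolding R_def by blast
      have ab: "a \<in> lbox p M" "b \<in> lbox p M" "v i + a = v j + b" using a b by simp_all
      have *: "\<bar>s\<bar> \<le> 2 * int M" if "L * s = d" "\<bar>d\<bar> \<le> 2 * int M" for s d
      proof -
        have "\<bar>s\<bar> * 1 \<le> \<bar>s\<bar> * L" using L by (intro mult_left_mono) auto
        also have "\<dots> = \<bar>d\<bar>" using that(1) L by (simp add: abs_mult mult.commute flip: that(1))
        finally show ?thesis using that(2) by simp
      qed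
      have "L * (fst i - fst j) = fst b - fst a" "L * (snd i - snd j) = snd b - snd a"
        using ab(3) by (auto simp: v_def prod_eq_iff algebra_simps)
      moreover have "\<bar>fst b - fst a\<bar> \<le> 2 * int M" "\<bar>snd b - snd a\<bar> \<le> 2 * int M"
        using ab(1,2) p by (auto simp: lbox_def mem_Times_iff)
      ultimately have "\<bar>fst i - fst j\<bar> \<le> 2 * int M" "\<bar>snd i - snd j\<bar> \<le> 2 * int M" using * by blast+
      then show "j \<in> ?J" by (auto simp: mem_Times_iff)
    qed
    then have "card {j \<in> I. bad i j} \<le> card ?J" by (intro card_mono) auto
    also have "\<dots> = (4 * M + 1)\<^sup>2"
    proof -
      have "card {a - 2 * int M..a + 2 * int M} = 4 * M + 1" for a
      proof -
        have "a + 2 * int M - (a - 2 * int M) + 1 = int (4 * M + 1)" by simp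
        then show ?thesis unfolding card_atLeastAtMost_int by (simp only: nat_int)
      qed
      then show ?thesis by (simp only: card_cartesian_product power2_eq_square)
    qed
    finally have "real (card {j \<in> I. bad i j}) \<le> real ((4 * M + 1)\<^sup>2)" by (simp only: of_nat_le_iff)
    moreover have "(\<Sum>j\<in>I. of_bool (bad i j) :: real) = real (card {j \<in> I. bad i j})"
      using I by (simp add: Int_def)
    ultimately show ?thesis by simp
  qed
  have frac: "real ((4 * M + 1)\<^sup>2) \<le> e * c"
  proof -
    have "real ((4 * M + 1)\<^sup>2) \<le> e * real h" using h(2) e(1) by (simp add: field_simps)
    also have "real h \<le> c" unfolding cI by (simp add: power2_eq_square algebra_simps)
    finally show ?thesis using e(1) by simp
  qed
  have ev: "\<forall>\<^sub>F N in sequentially. gam - e < kav (tp (lbox p N)) (lbox p K) (lbox p K) \<and> (\<Union>i\<in>I. R i) \<subseteq> lbox p N"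
  proof (intro eventually_conj)
    have "lbox p K \<noteq> {}" using U A I by (auto simp: Ai_def)
    then have "gam - e < Gav (lbox p K) (lbox p K)"
      using gam_le_Gav[of "lbox p K"] e(1) by simp
    then show "\<forall>\<^sub>F N in sequentially. gam - e < kav (tp (lbox p N)) (lbox p K) (lbox p K)"
      using order_tendstoD(1)[OF kav_tp_tendsto] by blast
    show "\<forall>\<^sub>F N in sequentially. (\<Union>i\<in>I. R i) \<subseteq> lbox p N"
      using I finR by (intro finite_subset_lbox) auto
  qed
  have main: "lex (lbox p N) (\<lambda>\<omega>. \<bar>cav \<omega> (lbox p K) (lbox p K) - gam\<bar>) \<le> \<delta>"
    if N: "gam - e < kav (tp (lbox p N)) (lbox p K) (lbox p K)" "(\<Union>i\<in>I. R i) \<subseteq> lbox p N" for N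
  proof -
    define S where "S = lbox p N"
    have finS: "finite S" by (simp add: S_def)
    have gS: "graph S (lat S)" by (simp add: S_def graph_lat)
    have RS: "lat (R i) \<subseteq> lat S" if "i \<in> I" for i using N(2) that by (intro lat_mono) (auto simp: S_def)
    \<comment> \<open>\<open>f i\<close> sees only the edges near block i, which makes distant
      blocks nearly uncorrelated; \<open>X i\<close> below uses all connections.\<close>
    define f where "f i = (\<lambda>\<omega>. cav (\<omega> \<inter> lat (R i)) (Ai i) (Ai i))" for i
    define X where "X i = (\<lambda>\<omega>. cav \<omega> (Ai i) (Ai i))" for i
    define F where "F = (\<lambda>\<omega>. (\<Sum>i\<in>I. f i \<omega>) / c)"
    define XX where "XX = (\<lambda>\<omega>. (\<Sum>i\<in>I. X i \<omega>) / c)"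
    define Y where "Y = (\<lambda>\<omega>. cav \<omega> (lbox p K) (lbox p K))"
    have f01: "0 \<le> f i \<omega>" "f i \<omega> \<le> 1" "f i \<omega> \<le> X i \<omega>" for i \<omega>
      by (simp_all add: f_def X_def cav_nonneg cav_le_1 cav_mono)
    have EX: "lex S (X i) \<le> g" for i
      using kav_tp_le_Gav[OF finS, of "Ai i" "Ai i"] by (simp add: X_def lex_cav GAi)
    have Ef_le: "lex S (f i) \<le> g" for i
      by (rule order_trans[OF ex_mono[OF gS f01(3)] EX])
    have r: "g - e \<le> kav (tp (R i)) (Ai i) (Ai i)" for i using M(2) by (simp add: tpR)
    have rf: "kav (tp (R i)) (Ai i) (Ai i) \<le> lex S (f i)" if "i \<in> I" for i
      unfolding f_def lex_cav[symmetric]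
      by (rule domain_mono[OF graph_lat[OF finR] gS RS[OF that]]) (rule cav_mono)
    have Ef_ge: "g - e \<le> lex S (f i)" if "i \<in> I" for i using r[of i] rf[OF that] by simp
    \<comment> \<open>An upper bound on the correlation is needed, whereas positive association
      gives lower bounds. The domain Markov inequality is therefore applied to \<open>f i\<close>
      and \<open>1 - f j\<close>, a nonnegative function of edges away from \<open>R i\<close>.
      Overlapping pairs get the trivial bound 1.\<close>
    have cov: "lex S (\<lambda>\<omega>. f i \<omega> * f j \<omega>) \<le> g\<^sup>2 + e + of_bool (bad i j)" if ij: "i \<in> I" "j \<in> I" for i j
    proof (cases "bad i j")
      case True
      have "lex S (\<lambda>\<omega>. f i \<omega> * f j \<omega>) \<le> 1"
        using ex_mono[OF gS, of "\<lambda>\<omega>. f i \<omega> * f j \<omega>" "\<lambda>_. 1"] f01 gS by (simp add: mult_le_one)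
      moreover have "0 \<le> g\<^sup>2" by simp
      moreover have "of_bool (bad i j) = (1 :: real)" using True by simp
      ultimately show ?thesis using e(1) by linarith
    next
      case False
      have dl: "lat (R i) \<inter> lat (R j) = {}"
      proof (rule ccontr)
        assume "lat (R i) \<inter> lat (R j) \<noteq> {}"
        then obtain e where "e \<in> lat (R i)" "e \<in> lat (R j)" by blast
        then show False using False lat_edgeD[of e] unfolding bad_def by blast
      qed
      let ?r = "kav (tp (R i)) (Ai i) (Ai i)"
      let ?h = "\<lambda>\<xi>. 1 - cav (\<xi> \<inter> lat (R j)) (Ai j) (Ai j)"
      have "ex (R i) (lat (R i)) (\<lambda>\<omega>. cav \<omega> (Ai i) (Ai i)) * lex S (\<lambda>\<omega>. ?h (\<omega> - lat (R i)))
          \<le> lex S (\<lambda>\<omega>. cav (\<omega> \<inter> lat (R i)) (Ai i) (Ai i) * ?h (\<omega> - lat (R i)))"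
        by (rule domain_markov[OF graph_lat[OF finR] gS RS[OF ij(1)]]) (auto intro: cav_mono simp: cav_le_1)
      moreover have "(\<omega> - lat (R i)) \<inter> lat (R j) = \<omega> \<inter> lat (R j)" for \<omega> using dl by auto
      ultimately have "?r * lex S (\<lambda>\<omega>. 1 - f j \<omega>) \<le> lex S (\<lambda>\<omega>. f i \<omega> - f i \<omega> * f j \<omega>)"
        by (simp add: lex_cav f_def right_diff_distrib)
      then have "?r * (1 - lex S (f j)) \<le> lex S (f i) - lex S (\<lambda>\<omega>. f i \<omega> * f j \<omega>)"
        by (simp add: ex_diff gS)
      moreover have "(g - e) * (1 - g) \<le> ?r * (1 - g)" using r[of i] g(3) by (intro mult_right_mono) auto
      moreover have "?r * (1 - g) \<le> ?r * (1 - lex S (f j))"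
      proof -
        have "0 \<le> ?r" unfolding lex_cav[symmetric] by (intro ex_nonneg graph_lat finR cav_nonneg)
        then show ?thesis using Ef_le[of j] by (intro mult_left_mono) auto
      qed
      ultimately have "lex S (\<lambda>\<omega>. f i \<omega> * f j \<omega>) \<le> g - (g - e) * (1 - g)" using Ef_le[of i] by linarith
      also have "\<dots> = g\<^sup>2 + e - e * g" by (simp add: power2_eq_square algebra_simps)
      also have "\<dots> \<le> g\<^sup>2 + e" using g(4) e(1) by simp
      finally show ?thesis using False by simp
    qed
    have EF: "g - e \<le> lex S F" "lex S F = (\<Sum>i\<in>I. lex S (f i)) / c"
    proof -
      have "lex S F = lex S (\<lambda>\<omega>. (1 / c) * (\<Sum>i\<in>I. f i \<omega>))" by (simp add: F_def)
      then show eq: "lex S F = (\<Sum>i\<in>I. lex S (f i)) / c" unfolding ex_cmult ex_sum by simp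
      have "c * (g - e) \<le> (\<Sum>i\<in>I. lex S (f i))"
        using sum_mono[of I "\<lambda>_. g - e" "\<lambda>i. lex S (f i)"] Ef_ge by (simp add: c_def)
      then show "g - e \<le> lex S F" unfolding eq using c0 by (simp add: field_simps)
    qed
    have EF2: "lex S (\<lambda>\<omega>. (F \<omega>)\<^sup>2) \<le> g\<^sup>2 + 2 * e"
    proof -
      have "(F \<omega>)\<^sup>2 = (1 / c\<^sup>2) * (\<Sum>i\<in>I. \<Sum>j\<in>I. f i \<omega> * f j \<omega>)" for \<omega>
        by (simp add: F_def power2_eq_square sum_product)
      then have "lex S (\<lambda>\<omega>. (F \<omega>)\<^sup>2) = (1 / c\<^sup>2) * (\<Sum>i\<in>I. \<Sum>j\<in>I. lex S (\<lambda>\<omega>. f i \<omega> * f j \<omega>))"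
        by (simp only: ex_cmult ex_sum)
      also have "\<dots> \<le> (1 / c\<^sup>2) * (\<Sum>i\<in>I. \<Sum>j\<in>I. g\<^sup>2 + e + of_bool (bad i j))"
        by (intro mult_left_mono sum_mono cov) auto
      also have "\<dots> = (1 / c\<^sup>2) * (c * c * (g\<^sup>2 + e) + (\<Sum>i\<in>I. \<Sum>j\<in>I. of_bool (bad i j)))"
        by (simp only: sum.distrib sum_constant c_def mult.assoc distrib_left)
      also have "\<dots> \<le> (1 / c\<^sup>2) * (c * c * (g\<^sup>2 + e) + (\<Sum>i\<in>I. e * c))"
      proof (intro mult_left_mono add_left_mono sum_mono)
        fix i show "(\<Sum>j\<in>I. of_bool (bad i j)) \<le> e * c" using bad_count[of i] frac by linarith
      qed auto
      also have "\<dots> = (1 / c\<^sup>2) * (c * c * (g\<^sup>2 + 2 * e))" by (simp add: c_def algebra_simps)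
      also have "\<dots> = g\<^sup>2 + 2 * e" using c0 by (simp add: power2_eq_square)
      finally show ?thesis .
    qed
    have var: "lex S (\<lambda>\<omega>. (F \<omega> - g)\<^sup>2) \<le> 4 * e"
    proof -
      have "lex S (\<lambda>\<omega>. (F \<omega> - g)\<^sup>2) = lex S (\<lambda>\<omega>. ((F \<omega>)\<^sup>2 - (2 * g) * F \<omega>) + g\<^sup>2)"
        by (intro arg_cong[of _ _ "lex S"] ext) (simp add: power2_eq_square algebra_simps)
      also have "\<dots> = lex S (\<lambda>\<omega>. (F \<omega>)\<^sup>2) - 2 * g * lex S F + g\<^sup>2"
        by (simp add: ex_add ex_diff ex_cmult gS)
      also have "\<dots> \<le> (g\<^sup>2 + 2 * e) - 2 * g * (g - e) + g\<^sup>2"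
        using EF2 mult_left_mono[OF EF(1), of "2 * g"] g(4) by simp
      also have "\<dots> = 2 * e + 2 * g * e" by (simp add: power2_eq_square algebra_simps)
      also have "\<dots> \<le> 4 * e" using g(3) e(1) by simp
      finally show ?thesis .
    qed
    have dev: "lex S (\<lambda>\<omega>. \<bar>F \<omega> - g\<bar>) \<le> 2 * t"
    proof -
      \<comment> \<open>Expands (|y| - 2 t)^2 \<ge> 0; this turns the variance bound into a bound on
        the mean deviation.\<close>
      have "\<bar>y\<bar> \<le> (1 / (4 * t)) * y\<^sup>2 + t" for y :: real
      proof -
        have "0 \<le> (\<bar>y\<bar> - 2 * t)\<^sup>2" by simp
        then have "4 * t * \<bar>y\<bar> \<le> y\<^sup>2 + 4 * t\<^sup>2" by (simp add: power2_diff algebra_simps)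
        then show ?thesis using t by (simp add: field_simps power2_eq_square)
      qed
      then have "lex S (\<lambda>\<omega>. \<bar>F \<omega> - g\<bar>) \<le> lex S (\<lambda>\<omega>. (1 / (4 * t)) * (F \<omega> - g)\<^sup>2 + t)"
        by (intro ex_mono[OF gS]) blast
      also have "\<dots> = (1 / (4 * t)) * lex S (\<lambda>\<omega>. (F \<omega> - g)\<^sup>2) + t" by (simp only: ex_add ex_cmult ex_const[OF gS])
      also have "\<dots> \<le> (1 / (4 * t)) * (4 * e) + t" using var t by (intro add_mono mult_left_mono) auto
      also have "\<dots> = 2 * t" using t by (simp add: e_def power2_eq_square)
      finally show ?thesis .
    qed
    have EXX: "lex S XX \<le> g"
    proof -
      have "lex S XX = lex S (\<lambda>\<omega>. (1 / c) * (\<Sum>i\<in>I. X i \<omega>))" by (simp add: XX_def)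
      also have "\<dots> = (1 / c) * (\<Sum>i\<in>I. lex S (X i))" unfolding ex_cmult ex_sum by simp
      also have "\<dots> \<le> (1 / c) * (\<Sum>i\<in>I. g)" using c0 by (intro mult_left_mono sum_mono EX) auto
      also have "\<dots> = g" using c0 by (simp add: c_def)
      finally show ?thesis .
    qed
    have EY: "gam - e \<le> lex S Y" using N(1) by (simp add: Y_def lex_cav S_def)
    have YX: "Y \<omega> \<le> XX \<omega>" for \<omega>
    proof -
      have "kav (\<lambda>x y. of_bool (conn \<omega> x y)) (\<Union>i\<in>I. Ai i) (\<Union>i\<in>I. Ai i)
          \<le> (\<Sum>i\<in>I. kav (\<lambda>x y. of_bool (conn \<omega> x y)) (Ai i) (Ai i)) / card I"
      proof (rule kav_blocks[OF I cardAi])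
        show "0 < card A" using A by (simp add: card_gt_0_iff)
        show "of_bool (conn \<omega> x y) = of_bool (conn \<omega> y x)" for x y by (subst conn_sym) (rule HOL.refl)
        show "0 \<le> (\<Sum>x\<in>V. \<Sum>y\<in>V. c x * c y * of_bool (conn \<omega> x y))" if "finite V" for V and c :: "_ \<Rightarrow> real"
          by (rule conn_psd[OF that, where p = "\<lambda>x. x"])
      qed (rule disjA)
      then show ?thesis by (simp add: Y_def XX_def X_def cav_def U c_def)
    qed
    have FX: "F \<omega> \<le> XX \<omega>" for \<omega>
      unfolding F_def XX_def using c0 by (intro divide_right_mono sum_mono f01) auto
    \<comment> \<open>\<open>XX\<close> lies above both \<open>Y\<close> and \<open>F\<close>, so
      its mean distance to each of them is a difference of means, and these differences are
      small.\<close>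
    have "lex S (\<lambda>\<omega>. \<bar>Y \<omega> - gam\<bar>) \<le> lex S (\<lambda>\<omega>. (XX \<omega> - Y \<omega>) + (XX \<omega> - F \<omega>) + \<bar>F \<omega> - g\<bar> + e)"
    proof (rule ex_mono[OF gS])
      fix \<omega> show "\<bar>Y \<omega> - gam\<bar> \<le> (XX \<omega> - Y \<omega>) + (XX \<omega> - F \<omega>) + \<bar>F \<omega> - g\<bar> + e"
        using YX[of \<omega>] FX[of \<omega>] g(1,2) by linarith
    qed
    also have "\<dots> = (lex S XX - lex S Y) + (lex S XX - lex S F) + lex S (\<lambda>\<omega>. \<bar>F \<omega> - g\<bar>) + e"
      by (simp only: ex_add ex_diff ex_const[OF gS])
    also have "\<dots> \<le> (g - (gam - e)) + (g - (g - e)) + 2 * t + e"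
      using EXX EY EF(1) dev by linarith
    also have "\<dots> \<le> 4 * e + 2 * t" using g(2) by simp
    also have "\<dots> \<le> \<delta>" using e(2) t(3) by simp
    finally show ?thesis by (simp add: Y_def S_def)
  qed
  have "\<forall>\<^sub>F N in sequentially. lex (lbox p N) (\<lambda>\<omega>. \<bar>cav \<omega> (lbox p K) (lbox p K) - gam\<bar>) \<le> \<delta>"
    by (rule eventually_mono[OF ev]) (use main in blast)
  then show ?thesis using KK by blast
qed

end

section \<open>Crossings outside a box\<close>

text \<open>Quarter turn about the centre of \<open>lbox p N\<close>.\<close>

definition rot :: "int \<Rightarrow> pt \<Rightarrow> pt" where
  "rot p x = (- p - snd x, fst x)"

lemma inj_rot: "inj (rot p)"
  by (auto simp: inj_def rot_def prod_eq_iff)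

lemma ladj_rot: "ladj (rot p x) (rot p y) \<longleftrightarrow> ladj x y"
  by (auto simp: ladj_def rot_def)

lemma rot_lbox: "rot p ` lbox p N = lbox p N"
proof (rule endo_inj_surj)
  show "rot p ` lbox p N \<subseteq> lbox p N" by (auto simp: rot_def lbox_def)
  show "inj_on (rot p) (lbox p N)" using inj_rot by (rule inj_on_subset) simp
qed simp

definition dens :: "'v set set \<Rightarrow> 'v \<Rightarrow> 'v set \<Rightarrow> real" where
  "dens \<omega> v U = card {y \<in> U. conn \<omega> v y} / card U"

lemma dens_mono:
  assumes "finite U" "\<omega> \<subseteq> \<omega>'"
  shows "dens \<omega> v U \<le> dens \<omega>' v U"
  unfolding dens_def using assms conn_mono[OF assms(2)]
  by (intro divide_right_mono of_nat_mono card_mono) auto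

lemma dens_image:
  assumes "inj \<phi>" "\<phi> ` U = U"
  shows "dens ((`) \<phi> ` \<omega>) (\<phi> v) U = dens \<omega> v U"
proof -
  have "{y \<in> U. conn ((`) \<phi> ` \<omega>) (\<phi> v) y} = \<phi> ` {y \<in> U. conn \<omega> v y}"
  proof
    show "\<phi> ` {y \<in> U. conn \<omega> v y} \<subseteq> {y \<in> U. conn ((`) \<phi> ` \<omega>) (\<phi> v) y}"
      using assms(2) conn_image[OF assms(1)] by blast
    show "{y \<in> U. conn ((`) \<phi> ` \<omega>) (\<phi> v) y} \<subseteq> \<phi> ` {y \<in> U. conn \<omega> v y}"
    proof
      fix y assume y: "y \<in> {y \<in> U. conn ((`) \<phi> ` \<omega>) (\<phi> v) y}"
      then obtain z where "z \<in> U" "y = \<phi> z" using assms(2) by blast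
      then show "y \<in> \<phi> ` {y \<in> U. conn \<omega> v y}" using y conn_image[OF assms(1)] by blast
    qed
  qed
  then show ?thesis using assms(1) by (simp add: dens_def card_image inj_on_subset[OF assms(1)])
qed

lemma exists_dense:
  assumes "finite A" "A \<noteq> {}" "finite U" "t \<le> cav \<omega> A U"
  shows "\<exists>x\<in>A. t \<le> dens \<omega> x U"
proof (rule ccontr)
  assume "\<not> ?thesis"
  then have less: "dens \<omega> x U < t" if "x \<in> A" for x using that by force
  have a: "0 < real (card A)" using assms by (simp add: card_gt_0_iff)
  have "cav \<omega> A U = (\<Sum>x\<in>A. dens \<omega> x U) / card A"
    using assms(3) by (simp add: cav_def kav_def dens_def sum_divide_distrib Int_def mult.commute)
  also have "\<dots> < (\<Sum>x\<in>A. t) / card A"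
    using assms less a by (intro divide_strict_right_mono sum_strict_mono) auto
  also have "\<dots> = t" using a by simp
  finally show False using assms(4) by simp
qed

text \<open>Follow an open path from x to its last visit of A; from there on it uses only edges
  outside \<open>lat A\<close>.\<close>

lemma conn_exit:
  assumes "\<omega> \<subseteq> lat S" "conn \<omega> x y" "x \<in> A"
  shows "y \<in> A \<or> (\<exists>v\<in>A. (\<exists>w. w \<notin> A \<and> ladj v w) \<and> conn (\<omega> - lat A) v y)"
  using assms(2)
proof (induction rule: conn_induct)
  case refl
  then show ?case using assms(3) by simp
next
  case (step y z)
  have "{y, z} \<in> lat S" using step.hyps(2) assms(1) by blast
  then have yz: "ladj y z" by (simp add: lat_edge)
  show ?case
  proof (cases "z \<in> A")
    case False
    then have e: "{y, z} \<in> \<omega> - lat A" using step.hyps(2) by (simp add: lat_edge)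
    show ?thesis
    proof (cases "y \<in> A")
      case True
      then show ?thesis using yz False conn_edge[OF e] by (intro disjI2 bexI[of _ y] conjI exI[of _ z])
    next
      case y: False
      then obtain v where v: "v \<in> A" "\<exists>w. w \<notin> A \<and> ladj v w" "conn (\<omega> - lat A) v y"
        using step.IH by blast
      then have "conn (\<omega> - lat A) v z" using conn_trans conn_edge[OF e] by metis
      then show ?thesis using v by (intro disjI2 bexI[of _ v] conjI)
    qed
  qed simp
qed

text \<open>The part of the dense cluster outside A is covered by the exterior clusters of boundary
  points of A. As U is large, A accounts for at most half of the density, and one of at most
  \<open>card A\<close> exterior clusters has its share of the rest.\<close>

lemma dense_exit:
  fixes g :: real
  assumes "\<omega> \<subseteq> lat S" "finite A" "finite U" "x \<in> A" "g \<le> dens \<omega> x U" "2 * real (card A) \<le> g * real (card U)" "0 < g"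
  shows "\<exists>v\<in>A. (\<exists>w. w \<notin> A \<and> ladj v w) \<and> g / (2 * real (card A)) \<le> dens (\<omega> - lat A) v U"
proof (rule ccontr)
  assume no: "\<not> ?thesis"
  define D where "D = {v \<in> A. \<exists>w. w \<notin> A \<and> ladj v w}"
  have a: "0 < real (card A)" using assms(2,4) by (simp add: card_gt_0_iff) blast
  have U0: "0 < real (card U)"
  proof (rule ccontr)
    assume "\<not> 0 < real (card U)"
    then show False using assms(5-7) by (simp add: dens_def)
  qed
  have D: "D \<subseteq> A" "finite D" using assms(2) by (auto simp: D_def)
  have small: "real (card {y \<in> U. conn (\<omega> - lat A) v y}) < g / (2 * real (card A)) * card U" if "v \<in> D" for v
  proof -
    have "dens (\<omega> - lat A) v U < g / (2 * real (card A))" using no that by (force simp: D_def)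
    then show ?thesis using U0 unfolding dens_def by (simp only: pos_divide_less_eq)
  qed
  have "{y \<in> U. conn \<omega> x y} \<subseteq> A \<union> (\<Union>v\<in>D. {y \<in> U. conn (\<omega> - lat A) v y})"
  proof
    fix y assume "y \<in> {y \<in> U. conn \<omega> x y}"
    then show "y \<in> A \<union> (\<Union>v\<in>D. {y \<in> U. conn (\<omega> - lat A) v y})"
      using conn_exit[OF assms(1) _ assms(4), of y] unfolding D_def by blast
  qed
  then have "card {y \<in> U. conn \<omega> x y} \<le> card (A \<union> (\<Union>v\<in>D. {y \<in> U. conn (\<omega> - lat A) v y}))"
    using assms(2,3) D by (intro card_mono) auto
  also have "\<dots> \<le> card A + card (\<Union>v\<in>D. {y \<in> U. conn (\<omega> - lat A) v y})" by (rule card_Un_le)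
  also have "\<dots> \<le> card A + (\<Sum>v\<in>D. card {y \<in> U. conn (\<omega> - lat A) v y})"
    using D by (intro add_left_mono card_UN_le)
  finally have le: "real (card {y \<in> U. conn \<omega> x y}) \<le> card A + (\<Sum>v\<in>D. real (card {y \<in> U. conn (\<omega> - lat A) v y}))"
    by (simp flip: of_nat_sum of_nat_add)
  have ge: "g * card U \<le> real (card {y \<in> U. conn \<omega> x y})"
    using assms(5) U0 unfolding dens_def by (simp only: pos_le_divide_eq)
  show False
  proof (cases "D = {}")
    case True
    then have "g * card U \<le> real (card A)" using le ge by simp
    then show False using assms(6) a by simp
  next
    case False
    have "(\<Sum>v\<in>D. real (card {y \<in> U. conn (\<omega> - lat A) v y})) < (\<Sum>v\<in>D. g / (2 * real (card A)) * card U)"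
      using D False small by (intro sum_strict_mono) auto
    also have "\<dots> = card D * (g / (2 * real (card A)) * card U)" by simp
    also have "\<dots> \<le> card A * (g / (2 * real (card A)) * card U)"
      using D assms(2,7) by (intro mult_right_mono of_nat_mono card_mono) auto
    also have "\<dots> = g * card U / 2" using a by simp
    finally show False using le ge assms(6) by linarith
  qed
qed

text \<open>Joining two clusters of density at least \<eta> connects all pairs between them.\<close>

lemma cav_merge:
  assumes U: "finite U" and sub: "\<omega> \<subseteq> \<omega>'" and uv: "conn \<omega>' u v" "\<not> conn \<omega> u v"
    and d: "\<eta> \<le> dens \<omega> u U" "\<eta> \<le> dens \<omega> v U" "0 \<le> \<eta>"
  shows "cav \<omega> U U + \<eta>\<^sup>2 \<le> cav \<omega>' U U"
proof -
  define Cu Cv where "Cu = {y \<in> U. conn \<omega> u y}" and "Cv = {y \<in> U. conn \<omega> v y}"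
  have fin: "finite Cu" "finite Cv" using U by (auto simp: Cu_def Cv_def)
  have pt: "of_bool (conn \<omega> x y) + of_bool (x \<in> Cu \<and> y \<in> Cv) \<le> (of_bool (conn \<omega>' x y) :: real)" for x y
  proof (cases "x \<in> Cu \<and> y \<in> Cv")
    case True
    then have c: "conn \<omega> u x" "conn \<omega> v y" by (auto simp: Cu_def Cv_def)
    then have "conn \<omega>' x y"
      using conn_mono[OF sub] uv(1) conn_trans conn_sym by metis
    moreover have "\<not> conn \<omega> x y" using c uv(2) conn_trans conn_sym by metis
    ultimately show ?thesis using True by simp
  next
    case False
    then show ?thesis using conn_mono[OF sub, of x y] by auto
  qed
  have "(\<Sum>x\<in>U. \<Sum>y\<in>U. of_bool (conn \<omega> x y)) + real (card Cu) * real (card Cv)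
      = (\<Sum>x\<in>U. \<Sum>y\<in>U. of_bool (conn \<omega> x y) + of_bool (x \<in> Cu \<and> y \<in> Cv))"
  proof -
    have "(\<Sum>x\<in>U. \<Sum>y\<in>U. of_bool (x \<in> Cu \<and> y \<in> Cv)) = (\<Sum>x\<in>U. of_bool (x \<in> Cu) * (\<Sum>y\<in>U. of_bool (y \<in> Cv) :: real))"
      by (simp add: sum_distrib_left of_bool_conj)
    also have "\<dots> = real (card Cu) * real (card Cv)"
    proof -
      have "U \<inter> {x. x \<in> Cu} = Cu" "U \<inter> {x. x \<in> Cv} = Cv" by (auto simp: Cu_def Cv_def)
      then show ?thesis using U by (simp add: sum_distrib_right[symmetric])
    qed
    finally show ?thesis by (simp add: sum.distrib)
  qed
  also have "\<dots> \<le> (\<Sum>x\<in>U. \<Sum>y\<in>U. of_bool (conn \<omega>' x y))" by (intro sum_mono pt)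
  finally have "((\<Sum>x\<in>U. \<Sum>y\<in>U. of_bool (conn \<omega> x y)) + real (card Cu) * real (card Cv)) / (real (card U) * real (card U))
      \<le> (\<Sum>x\<in>U. \<Sum>y\<in>U. of_bool (conn \<omega>' x y)) / (real (card U) * real (card U))"
    by (rule divide_right_mono) simp
  then have "cav \<omega> U U + dens \<omega> u U * dens \<omega> v U \<le> cav \<omega>' U U"
    by (simp add: cav_def kav_def dens_def add_divide_distrib Cu_def Cv_def)
  moreover have "\<eta>\<^sup>2 \<le> dens \<omega> u U * dens \<omega> v U"
    unfolding power2_eq_square using d by (intro mult_mono) auto
  ultimately show ?thesis by simp
qed

context fk begin

text \<open>Square-root trick for four events: by FKG for decreasing functions, the product of the
  four equal means is at most the mean of the product.\<close>

lemma fourth_root_trick: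
  fixes n :: "nat \<Rightarrow> 'v set set \<Rightarrow> real"
  assumes "graph V E"
    and anti: "\<And>k \<eta> \<eta>'. \<lbrakk>\<eta>' \<subseteq> \<eta>; \<eta> \<subseteq> E\<rbrakk> \<Longrightarrow> n k \<eta> \<le> n k \<eta>'"
    and nonneg: "\<And>k \<omega>. 0 \<le> n k \<omega>"
    and eq: "\<And>k. ex V E (n k) = ex V E (n 0)"
    and small: "ex V E (\<lambda>\<omega>. (n 0 \<omega> * n 1 \<omega>) * (n 2 \<omega> * n 3 \<omega>)) \<le> (1 / 8) ^ 4"
  shows "ex V E (n 0) \<le> 1 / 8"
proof (rule ccontr)
  assume "\<not> ?thesis"
  then have "(1 / 8) ^ 4 < ex V E (n 0) ^ 4" by (intro power_strict_mono) auto
  also have "\<dots> = (ex V E (n 0) * ex V E (n 1)) * (ex V E (n 2) * ex V E (n 3))"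
    unfolding power4_eq_xxxx eq[of 1] eq[of 2] eq[of 3] by simp
  also have "\<dots> \<le> ex V E (\<lambda>\<omega>. n 0 \<omega> * n 1 \<omega>) * ex V E (\<lambda>\<omega>. n 2 \<omega> * n 3 \<omega>)"
    by (intro mult_mono fkg_antimono[OF assms(1)] anti mult_nonneg_nonneg ex_nonneg[OF assms(1)] nonneg)
  also have "\<dots> \<le> ex V E (\<lambda>\<omega>. (n 0 \<omega> * n 1 \<omega>) * (n 2 \<omega> * n 3 \<omega>))"
    by (intro fkg_antimono[OF assms(1)] mult_mono anti nonneg)
  finally show False using small by simp
qed

text \<open>\<open>A\<close> meets a dense cluster with probability close to 1, hence by the square-root trick so do its two
  opposite sides outside \<open>A\<close>. If these met different dense clusters, opening \<open>A\<close> would increase the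
  average connectivity of a large box, against concentration. Here \<open>(rot p ^^ 2) ` T\<close> is the side of
  \<open>A\<close> opposite to \<open>T\<close>.\<close>

lemma exterior_crossing:
  assumes p: "p \<in> {0, 1}" and "0 < gam"
  shows "\<exists>a\<^sub>0. \<forall>A T. finite A \<and> lbox p a\<^sub>0 \<subseteq> A \<and> rot p ` A = A \<and> T \<subseteq> A \<and>
      (\<forall>x\<in>A. \<forall>y\<in>A. conn (lat A) x y) \<and>
      (\<forall>v\<in>A. \<forall>w. w \<notin> A \<and> ladj v w \<longrightarrow> (\<exists>k<4. v \<in> (rot p ^^ k) ` T)) \<longrightarrow>
    (\<forall>\<^sub>F N in sequentially. 5 / 8 \<le> lex (lbox p N)
      (\<lambda>\<omega>. of_bool (\<exists>u\<in>T. \<exists>v\<in>(rot p ^^ 2) ` T. conn (\<omega> - lat A) u v)))"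
proof -
  \<comment> \<open>Makes \<open>5 * \<eta> / (gam / 4)\<close> equal to 1/10000; with the same
    contribution from \<delta> the total stays below (1/8)^4.\<close>
  define \<eta> where "\<eta> = gam / 200000"
  have \<eta>: "0 < \<eta>" using assms(2) by (simp add: \<eta>_def)
  obtain k0 where k0: "\<And>k. k0 \<le> k \<Longrightarrow> Gav (lbox p k) (lbox p k) \<le> gam + \<eta>"
    using mean_ergodic[OF p \<eta>] by blast
  \<comment> \<open>The successor keeps the box nonempty for p = 1, since \<open>lbox 1 0\<close> is
    empty.\<close>
  define a0 where "a0 = Suc k0"
  define A0 where "A0 = lbox p a0"
  have A0: "finite A0" "A0 \<noteq> {}" using p by (auto simp: A0_def lbox_def a0_def)
  have "\<forall>\<^sub>F N in sequentially. 5 / 8 \<le> lex (lbox p N)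
      (\<lambda>\<omega>. of_bool (\<exists>u\<in>T. \<exists>v\<in>(rot p ^^ 2) ` T. conn (\<omega> - lat A) u v))"
    if A: "finite A" "lbox p a0 \<subseteq> A" "rot p ` A = A" "T \<subseteq> A"
      and conA: "\<forall>x\<in>A. \<forall>y\<in>A. conn (lat A) x y"
      and sides: "\<forall>v\<in>A. \<forall>w. w \<notin> A \<and> ladj v w \<longrightarrow> (\<exists>k<4. v \<in> (rot p ^^ k) ` T)" for A T
  proof -
    have A_ne: "A \<noteq> {}" using A(2) A0 by (auto simp: A0_def)
    \<comment> \<open>The exterior density that \<open>dense_exit\<close> yields for a cluster of
      density gam / 4.\<close>
    define \<theta> where "\<theta> = (gam / 4) / (2 * real (card A))"
    have cA: "0 < real (card A)" using A(1) A_ne by (simp add: card_gt_0_iff)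
    have \<theta>: "0 < \<theta>" using assms(2) cA by (simp add: \<theta>_def)
    \<comment> \<open>The cost in \<open>finite_energy\<close> of resetting all edges of A.\<close>
    define C where "C = (2 * real q) ^ card (lat A)"
    have C: "0 < C" using q_ge_2 by (simp add: C_def)
    \<comment> \<open>Merging two exterior clusters of density \<theta> raises the average by
      \<theta>^2, so the values before and after cannot both be closer than \<kappa> to
      \<open>gam\<close>.\<close>
    define \<kappa> where "\<kappa> = \<theta>\<^sup>2 / 4"
    have \<kappa>: "0 < \<kappa>" using \<theta> by (simp add: \<kappa>_def)
    define \<delta> where "\<delta> = min (gam / 40000) (\<kappa> / (16 * C))"
    have \<delta>: "0 < \<delta>" "\<delta> \<le> gam / 40000" "C * \<delta> / \<kappa> \<le> 1 / 16"
    proof -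
      show "0 < \<delta>" "\<delta> \<le> gam / 40000" using assms(2) C \<kappa> by (simp_all add: \<delta>_def)
      have "C * \<delta> \<le> C * (\<kappa> / (16 * C))" using C by (intro mult_left_mono) (simp_all add: \<delta>_def)
      also have "\<dots> = \<kappa> / 16" using C by simp
      finally show "C * \<delta> / \<kappa> \<le> 1 / 16" using \<kappa> by (simp add: field_simps)
    qed
    obtain K where K: "max (Suc k0) (nat \<lceil>8 * card A / gam\<rceil>) \<le> K"
      and conc: "\<forall>\<^sub>F N in sequentially. lex (lbox p N) (\<lambda>\<omega>. \<bar>cav \<omega> (lbox p K) (lbox p K) - gam\<bar>) \<le> \<delta>"
      using concentration[OF p \<delta>(1)] by blast
    define U where "U = lbox p K"
    have U: "finite U" "U \<noteq> {}" "rot p ` U = U"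
      using p K by (auto simp: U_def rot_lbox) (auto simp: lbox_def)
    \<comment> \<open>K was taken so large that A is negligible in U, as \<open>dense_exit\<close>
      requires.\<close>
    have UA: "2 * real (card A) \<le> gam / 4 * card U"
    proof -
      have "8 * card A / gam \<le> real K" using K by linarith
      then have "8 * real (card A) \<le> gam * K" using assms(2) by (simp add: field_simps)
      moreover have "K \<le> card U"
      proof -
        have "(2 * int K + 1 - p) \<ge> int K" using p by auto
        then have "K \<le> nat (2 * int K + 1 - p)" by simp
        also have "\<dots> \<le> nat (2 * int K + 1 - p) ^ 2"           by (cases "nat (2 * int K + 1 - p)") (simp_all add: power2_eq_square)
        also have "\<dots> = card U" unfolding U_def using p by (intro card_lbox[symmetric]) auto
        finally show ?thesis .
      qed
      moreover then have "gam * real K \<le> gam * real (card U)" using assms(2) by (intro mult_left_mono) auto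
      ultimately show ?thesis by linarith
    qed
    \<comment> \<open>The squared distance between the averages over A0 and over U. Both are nearly
      minimal and their midpoint cannot go below \<open>gam\<close>, so by the parallelogram
      identity they are close.\<close>
    have EZ: "\<forall>\<^sub>F N in sequentially. kav (tp (lbox p N)) A0 A0 + kav (tp (lbox p N)) U U - 2 * kav (tp (lbox p N)) A0 U < 5 * \<eta>"
    proof (rule order_tendstoD(2))
      show "(\<lambda>N. kav (tp (lbox p N)) A0 A0 + kav (tp (lbox p N)) U U - 2 * kav (tp (lbox p N)) A0 U)
          \<longlonglongrightarrow> Gav A0 A0 + Gav U U - 2 * Gav A0 U"
        by (intro tendsto_intros kav_tp_tendsto)
      have "Gav A0 A0 \<le> gam + \<eta>" "Gav U U \<le> gam + \<eta>"
        using k0 K by (auto simp: A0_def U_def a0_def)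
      then show "Gav A0 A0 + Gav U U - 2 * Gav A0 U < 5 * \<eta>"
        using Gav_mixed[OF A0 U(1,2)] \<eta> by linarith
    qed
    have "\<forall>\<^sub>F N in sequentially. A \<subseteq> lbox p N" by (rule finite_subset_lbox[OF A(1)])
    with conc EZ show ?thesis
    proof eventually_elim
      case (elim N)
      define S where "S = lbox p N"
      have gS: "graph S (lat S)" by (simp add: S_def graph_lat)
      have AS: "lat A \<subseteq> lat S" using elim(3) by (intro lat_mono) (simp add: S_def)
      define X where "X \<omega> = \<bar>cav \<omega> U U - gam\<bar>" for \<omega>
      have EX: "lex S X \<le> \<delta>" using elim(1) unfolding X_def[abs_def] S_def U_def by simp
      define Z where "Z \<omega> = cav \<omega> A0 A0 + cav \<omega> U U - 2 * cav \<omega> A0 U" for \<omega>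
      have Z0: "0 \<le> Z \<omega>" for \<omega> using cav_mixed[OF A0(1) U(1), of \<omega>] by (simp add: Z_def)
      have EZ: "lex S Z \<le> 5 * \<eta>"
        unfolding Z_def[abs_def] ex_add ex_diff ex_cmult lex_cav using elim(2) by (simp add: S_def)
      define n :: "nat \<Rightarrow> pt set set \<Rightarrow> real" where "n k \<omega> = of_bool (\<not> (\<exists>v\<in>(rot p ^^ k) ` T. \<theta> \<le> dens (\<omega> - lat A) v U))" for k \<omega>
      define c :: "pt set set \<Rightarrow> real" where "c \<omega> = of_bool (\<exists>u\<in>T. \<exists>v\<in>(rot p ^^ 2) ` T. conn (\<omega> - lat A) u v)" for \<omega>
      \<comment> \<open>The box, A and U are invariant under the quarter turn, so the four sides are
        equally likely to fail.\<close>
      have n_rot: "lex S (n (Suc k)) = lex S (n k)" for k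
      proof -
        have latS: "(`) (rot p) ` lat S = lat S" "(`) (rot p) ` lat A = lat A"
          unfolding lat_image[OF ladj_rot] by (simp_all add: S_def rot_lbox A(3))
        have "lex S (n (Suc k)) = ex (rot p ` S) ((`) (rot p) ` lat S) (n (Suc k))"
          unfolding latS by (simp add: S_def rot_lbox)
        also have "\<dots> = lex S (\<lambda>\<omega>. n (Suc k) ((`) (rot p) ` \<omega>))" by (rule ex_image[OF inj_rot gS])
        also have "\<dots> = lex S (n k)"
        proof -
          have "n (Suc k) ((`) (rot p) ` \<omega>) = n k \<omega>" for \<omega>
          proof -
            have injI: "inj ((`) (rot p))" using inj_rot[of p] by (simp add: inj_def inj_image_eq_iff)
            have "(`) (rot p) ` \<omega> - lat A = (`) (rot p) ` (\<omega> - lat A)"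
              by (subst latS(2)[symmetric]) (simp add: image_set_diff[OF injI])
            then have "(\<exists>v\<in>(rot p ^^ Suc k) ` T. \<theta> \<le> dens ((`) (rot p) ` \<omega> - lat A) v U)
              \<longleftrightarrow> (\<exists>v\<in>(rot p ^^ k) ` T. \<theta> \<le> dens (\<omega> - lat A) v U)"
              by (simp add: dens_image[OF inj_rot U(3)])
            then show ?thesis by (simp add: n_def)
          qed
          then show ?thesis by simp
        qed
        finally show ?thesis .
      qed
      have n_eq: "lex S (n k) = lex S (n 0)" for k by (induction k) (simp_all add: n_rot)
      have n_anti: "n k \<eta>1 \<le> n k \<eta>2" if "\<eta>2 \<subseteq> \<eta>1" for k \<eta>1 \<eta>2
      proof -
        have "dens (\<eta>2 - lat A) v U \<le> dens (\<eta>1 - lat A) v U" for v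
          using that by (intro dens_mono U) auto
        then have "(\<exists>v\<in>(rot p ^^ k) ` T. \<theta> \<le> dens (\<eta>2 - lat A) v U) \<longrightarrow> (\<exists>v\<in>(rot p ^^ k) ` T. \<theta> \<le> dens (\<eta>1 - lat A) v U)"
          by (meson order_trans)
        then show ?thesis unfolding n_def of_bool_less_eq_iff by (meson)
      qed
      \<comment> \<open>If neither the average over U nor the distance between A0 and U deviates,
        some point of A0 lies in a dense cluster, and this cluster leaves A through one of the four
        sides.\<close>
      have pointwise: "n 0 \<omega> * n 1 \<omega> * (n 2 \<omega> * n 3 \<omega>) \<le> of_bool (gam / 4 \<le> X \<omega>) + of_bool (gam / 4 \<le> Z \<omega>)"
        if \<omega>: "\<omega> \<subseteq> lat S" for \<omega>
      proof (cases "gam / 4 \<le> X \<omega> \<or> gam / 4 \<le> Z \<omega>")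
        case True
        have "n k \<omega> \<le> 1" "0 \<le> n k \<omega>" for k by (simp_all add: n_def)
        then have "n 0 \<omega> * n 1 \<omega> * (n 2 \<omega> * n 3 \<omega>) \<le> 1" by (intro mult_le_one mult_nonneg_nonneg)
        then show ?thesis using True by auto
      next
        case False
        then have "X \<omega> < gam / 4" "Z \<omega> < gam / 4" by auto
        \<comment> \<open>The average over U exceeds 3 gam / 4, and twice the mixed average falls
          short of it by less than gam / 4.\<close>
        then have "gam / 4 \<le> cav \<omega> A0 U"
          using cav_nonneg[of \<omega> A0 A0] unfolding X_def Z_def by linarith
        then obtain x where x: "x \<in> A0" "gam / 4 \<le> dens \<omega> x U"
          using exists_dense[OF A0 U(1)] by blast
        have "x \<in> A" using x A(2) by (auto simp: A0_def)
        then obtain v where v: "v \<in> A" "\<exists>w. w \<notin> A \<and> ladj v w" "\<theta> \<le> dens (\<omega> - lat A) v U"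
          using dense_exit[OF \<omega> A(1) U(1) _ x(2) UA] assms(2) unfolding \<theta>_def by auto
        then obtain k where "k < 4" "v \<in> (rot p ^^ k) ` T" using sides by blast
        then have "n k \<omega> = 0" "k = 0 \<or> k = 1 \<or> k = 2 \<or> k = 3" using v(3) by (auto simp: n_def)
        then have "n 0 \<omega> * n 1 \<omega> * (n 2 \<omega> * n 3 \<omega>) = 0" by auto
        then show ?thesis by (simp only:) simp
      qed
      have "lex S (\<lambda>\<omega>. n 0 \<omega> * n 1 \<omega> * (n 2 \<omega> * n 3 \<omega>))
          \<le> lex S (\<lambda>\<omega>. of_bool (gam / 4 \<le> X \<omega>) + of_bool (gam / 4 \<le> Z \<omega>))"
        by (rule ex_mono[OF gS pointwise])
      also have "\<dots> \<le> \<delta> / (gam / 4) + 5 * \<eta> / (gam / 4)"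
      proof -
        have "lex S (\<lambda>\<omega>. of_bool (gam / 4 \<le> X \<omega>)) \<le> lex S X / (gam / 4)"
          using assms(2) by (intro markov[OF gS]) (auto simp: X_def)
        also have "\<dots> \<le> \<delta> / (gam / 4)" using assms(2) EX by (intro divide_right_mono) auto
        finally have 1: "lex S (\<lambda>\<omega>. of_bool (gam / 4 \<le> X \<omega>)) \<le> \<delta> / (gam / 4)" .
        have "lex S (\<lambda>\<omega>. of_bool (gam / 4 \<le> Z \<omega>)) \<le> lex S Z / (gam / 4)"
          using assms(2) Z0 by (intro markov[OF gS]) auto
        also have "\<dots> \<le> 5 * \<eta> / (gam / 4)" using assms(2) EZ by (intro divide_right_mono) auto
        finally show ?thesis using 1 unfolding ex_add by linarith
      qed
      also have "\<dots> \<le> (1 / 8) ^ 4"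
      proof -
        have "\<delta> / (gam / 4) \<le> (gam / 40000) / (gam / 4)" using \<delta>(2) assms(2) by (intro divide_right_mono) auto
        also have "\<dots> = 1 / 10000" using assms(2) by simp
        finally have "\<delta> / (gam / 4) \<le> 1 / 10000" .
        moreover have "5 * \<eta> / (gam / 4) = 1 / 10000" using assms(2) by (simp add: \<eta>_def)
        ultimately show ?thesis by (simp add: power4_eq_xxxx)
      qed
      finally have n0: "lex S (n 0) \<le> 1 / 8"
        using n_anti n_eq by (intro fourth_root_trick[OF gS, of n]) (auto simp: n_def)
      have finS: "finite S" by (simp add: S_def)
      \<comment> \<open>By finite energy the concentration survives a resetting of the edges of A;
        it is used below with all of them closed and with all of them opened.\<close>
      have bad: "lex S (\<lambda>\<omega>. of_bool (\<kappa> \<le> X (m \<omega>))) \<le> 1 / 16"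
        if m: "\<And>\<omega>. \<omega> \<subseteq> lat S \<Longrightarrow> m \<omega> \<subseteq> lat S \<and> m \<omega> - lat A = \<omega> - lat A" for m
      proof -
        have "lex S (\<lambda>\<omega>. of_bool (\<kappa> \<le> X (m \<omega>))) \<le> lex S (\<lambda>\<omega>. X (m \<omega>)) / \<kappa>"
          using \<kappa> by (intro markov[OF gS]) (auto simp: X_def)
        also have "\<dots> \<le> C * lex S X / \<kappa>"
          unfolding C_def using \<kappa> by (intro divide_right_mono finite_energy[OF gS AS m]) (auto simp: X_def)
        also have "\<dots> \<le> C * \<delta> / \<kappa>" using \<kappa> C EX by (intro divide_right_mono mult_left_mono) auto
        also have "\<dots> \<le> 1 / 16" by (rule \<delta>(3))
        finally show ?thesis .
      qed
      \<comment> \<open>One of these occurs: the crossing, a failing side, or a deviation of the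
        average after A is closed or opened. The bounds 1/8, 1/8, 1/16 and 1/16 on the others leave
        5/8 for the crossing.\<close>
      have "1 \<le> c \<omega> + n 0 \<omega> + n 2 \<omega> + of_bool (\<kappa> \<le> X (\<omega> - lat A)) + of_bool (\<kappa> \<le> X (\<omega> \<union> lat A))" for \<omega>
      proof (cases "n 0 \<omega> = 1 \<or> n 2 \<omega> = 1 \<or> c \<omega> = 1")
        case True
        moreover have "0 \<le> n 0 \<omega>" "0 \<le> n 2 \<omega>" "0 \<le> c \<omega>" by (simp_all add: n_def c_def)
        ultimately show ?thesis by auto
      next
        case False
        then have *: "\<exists>u\<in>(rot p ^^ 0) ` T. \<theta> \<le> dens (\<omega> - lat A) u U"
          "\<exists>v\<in>(rot p ^^ 2) ` T. \<theta> \<le> dens (\<omega> - lat A) v U"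
          "\<not> (\<exists>u\<in>T. \<exists>v\<in>(rot p ^^ 2) ` T. conn (\<omega> - lat A) u v)"
          unfolding n_def c_def of_bool_eq_1_iff by blast+
        have "(rot p ^^ 0) ` T = T" by simp
        with * obtain u v where uv: "u \<in> T" "v \<in> (rot p ^^ 2) ` T"
          "\<theta> \<le> dens (\<omega> - lat A) u U" "\<theta> \<le> dens (\<omega> - lat A) v U" "\<not> conn (\<omega> - lat A) u v"
          by metis
        have "(rot p ^^ 2) ` T \<subseteq> A"
        proof -
          have "(rot p ^^ 2) ` T = rot p ` rot p ` T" by (simp add: numeral_2_eq_2 image_comp)
          also have "\<dots> \<subseteq> rot p ` rot p ` A" using A(4) by (intro image_mono)
          finally show ?thesis by (simp add: A(3))
        qed
        then have "conn (\<omega> \<union> lat A) u v"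
          using uv(1,2) A(4) conA conn_mono[of "lat A" "\<omega> \<union> lat A" u v] by blast
        then have "cav (\<omega> - lat A) U U + \<theta>\<^sup>2 \<le> cav (\<omega> \<union> lat A) U U"
          using uv \<theta> by (intro cav_merge[OF U(1), where u = u and v = v]) auto
        then have "\<kappa> \<le> X (\<omega> - lat A) \<or> \<kappa> \<le> X (\<omega> \<union> lat A)"
          using \<kappa> unfolding X_def \<kappa>_def by linarith
        moreover have "0 \<le> n 0 \<omega>" "0 \<le> n 2 \<omega>" "0 \<le> c \<omega>" by (simp_all add: n_def c_def)
        ultimately show ?thesis by (auto simp: add_increasing)
      qed
      then have "1 \<le> lex S (\<lambda>\<omega>. c \<omega> + n 0 \<omega> + n 2 \<omega> + of_bool (\<kappa> \<le> X (\<omega> - lat A)) + of_bool (\<kappa> \<le> X (\<omega> \<union> lat A)))"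
        using ex_mono[OF gS, of "\<lambda>_. 1"] gS by simp
      also have "\<dots> = lex S c + lex S (n 0) + lex S (n 2) + lex S (\<lambda>\<omega>. of_bool (\<kappa> \<le> X (\<omega> - lat A)))
          + lex S (\<lambda>\<omega>. of_bool (\<kappa> \<le> X (\<omega> \<union> lat A)))"
        by (simp only: ex_add)
      also have "\<dots> \<le> lex S c + 1 / 8 + 1 / 8 + 1 / 16 + 1 / 16"
        using n0 n_eq[of 2] bad[of "\<lambda>\<omega>. \<omega> - lat A"] bad[of "\<lambda>\<omega>. \<omega> \<union> lat A"] AS by (intro add_mono) auto
      finally show ?case by (simp add: c_def[abs_def] S_def)
    qed
  qed
  then show ?thesis by blast
qed

end

section \<open>Planar duality\<close>

definition crosses :: "'v set \<Rightarrow> 'v set \<Rightarrow> bool" where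
  "crosses e X \<longleftrightarrow> e \<inter> X \<noteq> {} \<and> e - X \<noteq> {}"

lemma crosses_pair: "crosses {x, y} X \<longleftrightarrow> (x \<in> X) \<noteq> (y \<in> X)"
  by (auto simp: crosses_def)

lemma odd_card_sym_diff:
  assumes "finite A" "finite B"
  shows "odd (card ((A - B) \<union> (B - A))) \<longleftrightarrow> odd (card A) \<noteq> odd (card B)"
proof -
  have "card ((A - B) \<union> (B - A)) = card (A - B) + card (B - A)"
    using assms by (intro card_Un_disjoint) auto
  moreover have "card A = card (A - B) + card (A \<inter> B)"
    using assms by (subst card_Un_disjoint[symmetric]) (auto simp: Un_Diff_Int)
  moreover have "card B = card (B - A) + card (A \<inter> B)"
    using assms by (subst card_Un_disjoint[symmetric]) (auto intro: arg_cong[of _ _ card])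
  ultimately show ?thesis by simp blast
qed

text \<open>A path as a chain modulo 2 with boundary {x, y}; edges are added by symmetric
  difference. Stating the parity for all cuts X covers the degrees at vertices as well as the
  crossings of a line.\<close>

lemma conn_flow:
  assumes "conn \<omega> x y"
  shows "\<exists>P. finite P \<and> P \<subseteq> \<omega> \<and> (\<forall>X. odd (card {e \<in> P. crosses e X}) \<longleftrightarrow> (x \<in> X) \<noteq> (y \<in> X))"
  using assms
proof (induction rule: conn_induct)
  case refl
  show ?case by (intro exI[of _ "{}"]) simp
next
  case (step y z)
  obtain P where P0: "finite P \<and> P \<subseteq> \<omega> \<and> (\<forall>X. odd (card {e \<in> P. crosses e X}) \<longleftrightarrow> (x \<in> X) \<noteq> (y \<in> X))"
    using step.IH by (rule exE)
  note P = P0[THEN conjunct1] P0[THEN conjunct2, THEN conjunct1] P0[THEN conjunct2, THEN conjunct2, rule_format]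
  define P' where "P' = (P - {{y, z}}) \<union> ({{y, z}} - P)"
  have "odd (card {e \<in> P'. crosses e X}) \<longleftrightarrow> (x \<in> X) \<noteq> (z \<in> X)" for X
  proof -
    let ?A = "{e \<in> P. crosses e X}" and ?B = "{e \<in> {{y, z}}. crosses e X}"
    have "{e \<in> P'. crosses e X} = (?A - ?B) \<union> (?B - ?A)" by (auto simp: P'_def)
    then have "odd (card {e \<in> P'. crosses e X}) \<longleftrightarrow> odd (card ?A) \<noteq> odd (card ?B)"
      by (simp only:, intro odd_card_sym_diff) (use P(1) in simp_all)
    moreover have "odd (card ?B) \<longleftrightarrow> (y \<in> X) \<noteq> (z \<in> X)"
    proof (cases "crosses {y, z} X")
      case True
      then have "?B = {{y, z}}" by auto
      then show ?thesis using True by (simp add: crosses_pair)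
    next
      case False
      then have "?B = {}" by auto
      then have "even (card ?B)" by (simp only: card.empty even_zero)
      then show ?thesis using False by (simp add: crosses_pair)
    qed
    ultimately show ?thesis using P(3)[of X] by argo
  qed
  moreover have "finite P'" "P' \<subseteq> \<omega>" using P step.hyps(2) by (auto simp: P'_def)
  ultimately show ?case by blast
qed

lemma conn_obtain_flow:
  assumes "conn \<omega> x y"
  obtains P where "finite P" "P \<subseteq> \<omega>" "\<forall>X. odd (card {e \<in> P. crosses e X}) \<longleftrightarrow> (x \<in> X) \<noteq> (y \<in> X)"
proof -
  obtain P where P: "finite P \<and> P \<subseteq> \<omega> \<and> (\<forall>X. odd (card {e \<in> P. crosses e X}) \<longleftrightarrow> (x \<in> X) \<noteq> (y \<in> X))"
    using conn_flow[OF assms] by (rule exE)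
  show thesis
    by (rule that[OF P[THEN conjunct1] P[THEN conjunct2, THEN conjunct1]
      P[THEN conjunct2, THEN conjunct2]])
qed

section \<open>Lattice edges by direction, and height functions on faces\<close>

definition hE :: "int \<Rightarrow> int \<Rightarrow> pt set" where
  "hE i j = {(i - 1, j), (i, j)}"

definition vE :: "int \<Rightarrow> int \<Rightarrow> pt set" where
  "vE i j = {(i, j - 1), (i, j)}"

lemma ladj_cases:
  "ladj (i, j) y \<longleftrightarrow> y = (i - 1, j) \<or> y = (i + 1, j) \<or> y = (i, j - 1) \<or> y = (i, j + 1)"
  by (cases y) (auto simp: ladj_def)

lemma lat_UNIV_cases:
  assumes "e \<in> lat S"
  obtains i j where "e = hE i j" | i j where "e = vE i j"
proof -
  obtain x y where e: "e = {x, y}" "ladj x y" using assms by (rule lat_cases)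
  obtain i j where x: "x = (i, j)" by (cases x)
  from e(2) consider "y = (i - 1, j)" | "y = (i + 1, j)" | "y = (i, j - 1)" | "y = (i, j + 1)"
    unfolding x ladj_cases by blast
  then show thesis
  proof cases
    case 1 then show ?thesis using that(1)[of i j] e x by (simp add: hE_def insert_commute)
  next
    case 2 then show ?thesis using that(1)[of "i + 1" j] e x by (simp add: hE_def)
  next
    case 3 then show ?thesis using that(2)[of i j] e x by (simp add: vE_def insert_commute)
  next
    case 4 then show ?thesis using that(2)[of i "j + 1"] e x by (simp add: vE_def)
  qed
qed

lemma hE_lat: "hE i j \<in> lat S \<longleftrightarrow> (i - 1, j) \<in> S \<and> (i, j) \<in> S"
  by (auto simp: hE_def lat_edge ladj_def)

lemma vE_lat: "vE i j \<in> lat S \<longleftrightarrow> (i, j - 1) \<in> S \<and> (i, j) \<in> S"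
  by (auto simp: vE_def lat_edge ladj_def)

lemma edge_eq_simps [simp]:
  "hE i j = hE i' j' \<longleftrightarrow> i = i' \<and> j = j'" "vE i j = vE i' j' \<longleftrightarrow> i = i' \<and> j = j'"
  "hE i j \<noteq> vE i' j'" "vE i' j' \<noteq> hE i j"
  by (auto simp: hE_def vE_def doubleton_eq_iff)

lemma star_edges:
  assumes "Q \<subseteq> lat UNIV"
  shows "{e \<in> Q. crosses e {(i, j)}} = Q \<inter> {hE i j, hE (i + 1) j, vE i j, vE i (j + 1)}"
proof (intro set_eqI iffI)
  fix e assume e: "e \<in> {e \<in> Q. crosses e {(i, j)}}"
  then have "e \<in> lat UNIV" "crosses e {(i, j)}" using assms by auto
  then show "e \<in> Q \<inter> {hE i j, hE (i + 1) j, vE i j, vE i (j + 1)}"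
    using e by (elim lat_UNIV_cases) (auto simp: hE_def vE_def crosses_def)
next
  fix e assume "e \<in> Q \<inter> {hE i j, hE (i + 1) j, vE i j, vE i (j + 1)}"
  then show "e \<in> {e \<in> Q. crosses e {(i, j)}}"
    by (auto simp: hE_def vE_def crosses_pair)
qed

lemma odd_card_star:
  assumes "Q \<subseteq> lat UNIV"
  shows "odd (card {e \<in> Q. crosses e {(i, j)}}) \<longleftrightarrow>
    ((hE i j \<in> Q) \<noteq> (hE (i + 1) j \<in> Q)) \<noteq> ((vE i j \<in> Q) \<noteq> (vE i (j + 1) \<in> Q))"
  unfolding star_edges[OF assms]
  by (cases "hE i j \<in> Q"; cases "hE (i + 1) j \<in> Q"; cases "vE i j \<in> Q"; cases "vE i (j + 1) \<in> Q") simp_all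

text \<open>A closed flow modulo 2 is the gradient of a function on faces. This is the only topological input.\<close>

lemma height_function:
  assumes Q: "finite Q" "Q \<subseteq> lat UNIV" "\<And>v. even (card {e \<in> Q. crosses e {v}})"
  obtains h :: "pt \<Rightarrow> bool" where
    "\<forall>i j. h (i, j + 1) \<noteq> h (i, j) \<longleftrightarrow> hE i j \<in> Q"
    "\<forall>i j. h (i + 1, j) \<noteq> h (i, j) \<longleftrightarrow> vE i j \<in> Q"
proof -
  \<comment> \<open>Parity of the edges of Q met by the ray going down from the face with upper
    right corner x.\<close>
  define h where "h x = odd (card {k. k < snd x \<and> hE (fst x) k \<in> Q})" for x :: pt
  have fin: "finite {k. hE i k \<in> Q}" "finite {k. vE i k \<in> Q}" for i
  proof -
    have "finite (hE i -` Q)" "finite (vE i -` Q)"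
      using Q(1) by (intro finite_vimageI injI; simp)+
    then show "finite {k. hE i k \<in> Q}" "finite {k. vE i k \<in> Q}" by (simp_all add: vimage_def)
  qed
  have up: "h (i, j + 1) \<noteq> h (i, j) \<longleftrightarrow> hE i j \<in> Q" for i j
  proof (cases "hE i j \<in> Q")
    case True
    then have "{k. k < j + 1 \<and> hE i k \<in> Q} = insert j {k. k < j \<and> hE i k \<in> Q}" by auto
    moreover have "finite {k. k < j \<and> hE i k \<in> Q}" using fin(1)[of i] by (rule finite_subset[rotated]) auto
    ultimately show ?thesis using True by (simp add: h_def)
  next
    case False
    then have "{k. k < j + 1 \<and> hE i k \<in> Q} = {k. k < j \<and> hE i k \<in> Q}"
      by (metis (no_types, lifting) Collect_cong zless_add1_eq)
    then show ?thesis using False by (simp add: h_def)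
  qed
  \<comment> \<open>Below all edges of Q both sides are trivially false; going up, the even degree
    at (i, j) carries the equivalence from j to j + 1.\<close>
  have right: "h (i + 1, j) \<noteq> h (i, j) \<longleftrightarrow> vE i j \<in> Q" for i j
  proof -
    have "finite ({k. hE i k \<in> Q} \<union> {k. hE (i + 1) k \<in> Q} \<union> {k. vE i k \<in> Q})" using fin by simp
    then have "bdd_below ({k. hE i k \<in> Q} \<union> {k. hE (i + 1) k \<in> Q} \<union> {k. vE i k \<in> Q})" by (rule bdd_below_finite)
    then obtain m where m: "\<And>k. k < m \<Longrightarrow> hE i k \<notin> Q \<and> hE (i + 1) k \<notin> Q \<and> vE i k \<notin> Q"
      unfolding bdd_below_def by (metis (mono_tags, lifting) UnCI mem_Collect_eq not_less)
    have low: "h (i + 1, j) \<noteq> h (i, j) \<longleftrightarrow> vE i j \<in> Q" if "j < m" for j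
    proof -
      have none: "{k. k < j \<and> hE i k \<in> Q} = {}" "{k. k < j \<and> hE (i + 1) k \<in> Q} = {}"
        using m that by force+
      have "\<not> h (i, j)" unfolding h_def fst_conv snd_conv none by simp
      moreover have "\<not> h (i + 1, j)" unfolding h_def fst_conv snd_conv none by simp
      ultimately show ?thesis using m[OF that] by blast
    qed
    show ?thesis
    proof (cases "j < m")
      case False
      then have "m - 1 \<le> j" by simp
      then show ?thesis
      proof (induction j rule: int_ge_induct)
        case base
        show ?case by (rule low) simp
      next
        case (step j)
        have "((hE i j \<in> Q) \<noteq> (hE (i + 1) j \<in> Q)) = ((vE i j \<in> Q) \<noteq> (vE i (j + 1) \<in> Q))"
          using odd_card_star[OF Q(2), of i j] Q(3) by blast
        then show ?case using up[of i j] up[of "i + 1" j] step.IH by blast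
      qed
    qed (rule low)
  qed
  show thesis by (rule that[of h]) (intro allI up right)+
qed

text \<open>Faces are indexed by their upper right corner; \<open>dual_edge {f, g}\<close> is the edge that separates
  the adjacent faces \<open>f\<close> and \<open>g\<close>.\<close>

definition corners :: "pt \<Rightarrow> pt set" where
  "corners f = {fst f - 1, fst f} \<times> {snd f - 1, snd f}"

definition dual_edge :: "pt set \<Rightarrow> pt set" where
  "dual_edge d = (\<Inter>f\<in>d. corners f)"

lemma dual_edge_hE: "dual_edge (hE i j) = vE (i - 1) j"
  by (auto simp: dual_edge_def hE_def vE_def corners_def)

lemma dual_edge_vE: "dual_edge (vE i j) = hE i (j - 1)"
  by (auto simp: dual_edge_def hE_def vE_def corners_def)

lemma inj_dual_edge: "inj_on dual_edge (lat S)"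
proof (rule inj_onI)
  fix d d' assume "d \<in> lat S" "d' \<in> lat S" "dual_edge d = dual_edge d'"
  then show "d = d'"
    by (elim lat_UNIV_cases) (auto simp: dual_edge_hE dual_edge_vE)
qed

text \<open>Heights change only across edges of Q, and the dual path crosses none of them.\<close>

lemma height_constant:
  fixes h :: "pt \<Rightarrow> bool"
  assumes h: "\<And>i j. h (i, j + 1) \<noteq> h (i, j) \<longleftrightarrow> hE i j \<in> Q"
    "\<And>i j. h (i + 1, j) \<noteq> h (i, j) \<longleftrightarrow> vE i j \<in> Q"
    and \<eta>: "\<eta> \<subseteq> lat S" "\<And>d. d \<in> \<eta> \<Longrightarrow> dual_edge d \<notin> Q"
    and "conn \<eta> f g"
  shows "h f = h g"
  using assms(5)
proof (induction rule: conn_induct)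
  case (step y z)
  have "\<not> h u \<noteq> h v" if "{u, v} = hE i j \<or> {u, v} = vE i j" "{u, v} \<in> \<eta>" for u v i j
  proof -
    have "dual_edge {u, v} \<notin> Q" using \<eta>(2) that(2) by blast
    then show ?thesis
      using that(1) h(2)[of "i - 1" j] h(1)[of i "j - 1"]
      by (auto simp: dual_edge_hE dual_edge_vE) (auto simp: hE_def vE_def doubleton_eq_iff)
  qed
  then have "h y = h z" using step.hyps(2) \<eta>(1) lat_UNIV_cases[of "{y, z}" S] by (metis subsetD)
  then show ?case using step.IH by simp
qed simp

text \<open>A primal path from x to y together with \<open>e\<close> would be a closed flow, whose
  height changes across \<open>e\<close>. The dual path from f to g crosses neither \<open>e\<close>
  nor \<omega>, so f and g would also have equal heights.\<close>

lemma planar_duality: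
  assumes \<omega>: "\<omega> \<subseteq> lat S" and \<eta>: "\<eta> \<subseteq> lat S'" "\<And>d. d \<in> \<eta> \<Longrightarrow> dual_edge d \<notin> insert e \<omega>"
    and fg: "{f, g} \<in> lat S''" and e: "e = dual_edge {f, g}" "e = {x, y}" "e \<notin> \<omega>"
    and "conn \<eta> f g"
  shows "\<not> conn \<omega> x y"
proof
  assume "conn \<omega> x y"
  then obtain P where P: "finite P" "P \<subseteq> \<omega>"
    and P3: "\<forall>X. odd (card {e \<in> P. crosses e X}) \<longleftrightarrow> (x \<in> X) \<noteq> (y \<in> X)"
    by (rule conn_obtain_flow)
  define Q where "Q = insert e P"
  have eP: "e \<notin> P" using P(2) e(3) by blast
  have e_lat: "e \<in> lat UNIV"
    using fg unfolding e(1) by (elim lat_UNIV_cases) (auto simp: dual_edge_hE dual_edge_vE hE_lat vE_lat)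
  have Q_lat: "Q \<subseteq> lat UNIV" using e_lat P(2) \<omega> lat_mono[of S UNIV] by (auto simp: Q_def)
  have "even (card {d \<in> Q. crosses d {v}})" for v
  proof (cases "crosses e {v}")
    case True
    then have "{d \<in> Q. crosses d {v}} = insert e {d \<in> P. crosses d {v}}" by (auto simp: Q_def)
    then have "card {d \<in> Q. crosses d {v}} = Suc (card {d \<in> P. crosses d {v}})" using P(1) eP by simp
    then show ?thesis using P3[rule_format, of "{v}"] True by (simp add: e(2) crosses_pair)
  next
    case False
    then have "{d \<in> Q. crosses d {v}} = {d \<in> P. crosses d {v}}" by (auto simp: Q_def)
    then show ?thesis using P3[rule_format, of "{v}"] False by (simp add: e(2) crosses_pair)
  qed
  note even_deg = this
  have finQ: "finite Q" using P(1) by (simp add: Q_def)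
  obtain h :: "pt \<Rightarrow> bool" where h': "\<forall>i j. h (i, j + 1) \<noteq> h (i, j) \<longleftrightarrow> hE i j \<in> Q"
    "\<forall>i j. h (i + 1, j) \<noteq> h (i, j) \<longleftrightarrow> vE i j \<in> Q"
    by (rule height_function[OF finQ Q_lat even_deg])
  note h = h'[rule_format]
  have "h f = h g"
    by (rule height_constant[OF h \<eta>(1) _ assms(8)]) (use \<eta>(2) P(2) in \<open>auto simp: Q_def\<close>)
  moreover have "h f \<noteq> h g"
  proof -
    have eQ: "dual_edge {f, g} \<in> Q" using e by (simp add: Q_def)
    show ?thesis
      using fg
    proof (rule lat_UNIV_cases)
      fix i j assume "{f, g} = hE i j"
      then show ?thesis using eQ h(2)[of "i - 1" j] by (auto simp: dual_edge_hE) (auto simp: hE_def doubleton_eq_iff)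
    next
      fix i j assume "{f, g} = vE i j"
      then show ?thesis using eQ h(1)[of i "j - 1"] by (auto simp: dual_edge_vE) (auto simp: vE_def doubleton_eq_iff)
    qed
  qed
  ultimately show False by simp
qed

context fk begin

text \<open>The dual of the free measure is wired at its boundary, so it dominates free measures.\<close>

lemma dual_domination:
  fixes f :: "pt set set \<Rightarrow> real"
  assumes "finite S" "finite D" and sub: "dual_edge ` lat D \<subseteq> lat S"
    and f: "\<And>\<eta> \<eta>'. \<lbrakk>\<eta>' \<subseteq> \<eta>; \<eta> \<subseteq> lat D\<rbrakk> \<Longrightarrow> f \<eta>' \<le> f \<eta>"
  shows "lex D f \<le> lex S (\<lambda>\<omega>. f {d \<in> lat D. dual_edge d \<notin> \<omega>})"
proof -
  have g: "graph S (lat S)" "graph D (lat D)" using assms by (auto intro: graph_lat)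
  have fin: "finite (lat S)" "finite (lat D)" using g graph_finite by blast+
  define F where "F = dual_edge ` lat D"
  have le: "lex D f * (\<Sum>\<zeta>\<in>Pow F. wt S (\<xi> \<union> \<zeta>)) \<le> (\<Sum>\<zeta>\<in>Pow F. wt S (\<xi> \<union> \<zeta>) * f {d \<in> lat D. dual_edge d \<notin> \<xi> \<union> \<zeta>})"
    if \<xi>: "\<xi> \<subseteq> lat S - F" for \<xi>
  proof -
    \<comment> \<open>The weight as a function of the dual configuration, in which a dual edge is
      open when the primal edge it crosses is closed; the remaining primal edges are frozen at
      \<xi>.\<close>
    define W where "W \<eta> = wt S (\<xi> \<union> dual_edge ` (lat D - \<eta>))" for \<eta>
    have sub': "\<xi> \<union> dual_edge ` (lat D - \<eta>) \<subseteq> lat S" for \<eta> using \<xi> sub by auto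
    have mem: "dual_edge d \<in> \<xi> \<union> dual_edge ` (lat D - \<eta>) \<longleftrightarrow> d \<notin> \<eta>" if "d \<in> lat D" for d \<eta>
    proof -
      have "dual_edge d \<in> F" using that by (simp add: F_def)
      then have "dual_edge d \<notin> \<xi>" using \<xi> by blast
      moreover have "dual_edge d \<in> dual_edge ` (lat D - \<eta>) \<longleftrightarrow> d \<notin> \<eta>"
        using inj_on_image_mem_iff[OF inj_dual_edge[of D] that, of "lat D - \<eta>"] that by simp
      ultimately show ?thesis by simp
    qed
    have W: "0 < W \<eta>" for \<eta> unfolding W_def by (rule wt_pos[OF g(1) sub'])
    have "lex D f \<le> (\<Sum>\<eta>\<in>Pow (lat D). W \<eta> * f \<eta>) / (\<Sum>\<eta>\<in>Pow (lat D). W \<eta>)"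
    proof (rule ex_le_of_ratio[OF g(2) W _ f])
      fix \<eta> \<eta>' x y assume *: "\<eta>' \<subseteq> \<eta>" "\<eta> \<subseteq> lat D" "{x, y} \<in> lat D - \<eta>"
      define \<omega> where "\<omega> = \<xi> \<union> dual_edge ` (lat D - insert {x, y} \<eta>)"
      have W1: "W (insert {x, y} \<eta>) = wt S \<omega>" by (simp add: W_def \<omega>_def)
      have xyD: "{x, y} \<in> lat D" using * by simp
      then have dS: "dual_edge {x, y} \<in> lat S" using sub by blast
      then obtain u v where uv: "dual_edge {x, y} = {u, v}" using graph_edge[OF g(1)] by metis
      have not_in: "dual_edge {x, y} \<notin> \<omega>"
        unfolding \<omega>_def mem[OF xyD] by simp
      have "lat D - \<eta> = insert {x, y} (lat D - insert {x, y} \<eta>)" using * by auto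
      then have "\<xi> \<union> dual_edge ` (lat D - \<eta>) = insert {u, v} \<omega>" by (simp add: \<omega>_def uv)
      then have W0: "W \<eta> = wt S \<omega> * (if conn \<omega> u v then sqrt q else 1 / sqrt q)"
        unfolding W_def using wt_insert[OF g(1), of \<omega> u v] sub'[of "insert {x, y} \<eta>"] not_in dS
        by (simp add: uv \<omega>_def[symmetric])
      have pos: "0 < wt S \<omega>" using W[of "insert {x, y} \<eta>"] W1 by simp
      \<comment> \<open>If the new dual edge closes a dual cycle, its primal edge joins two
        clusters, and removing that edge multiplies the weight by sqrt q. This is where the
        self-dual value of the edge weight enters.\<close>
      show "W \<eta> * (if conn \<eta>' x y then sqrt q else 1 / sqrt q) \<le> W (insert {x, y} \<eta>)"
      proof (cases "conn \<eta>' x y")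
        case True
        have "\<not> conn \<omega> u v"
        proof (rule planar_duality[OF _ _ _ _ HOL.refl uv not_in True])
          show "\<omega> \<subseteq> lat S" unfolding \<omega>_def by (rule sub')
          show "\<eta>' \<subseteq> lat D" using * by blast
          show "{x, y} \<in> lat D" by (rule xyD)
          fix d assume d: "d \<in> \<eta>'"
          then have dD: "d \<in> lat D" "d \<noteq> {x, y}" "d \<in> \<eta>" using * by blast+
          then have "dual_edge d \<notin> \<omega>" unfolding \<omega>_def mem[OF dD(1)] by simp
          moreover have "dual_edge d \<noteq> dual_edge {x, y}"
            using inj_onD[OF inj_dual_edge[of D], of d "{x, y}"] dD xyD by blast
          ultimately show "dual_edge d \<notin> insert (dual_edge {x, y}) \<omega>" by simp
        qed
        then show ?thesis using True sqrt_q(2) by (simp add: W0 W1)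
      next
        case False
        have "wt S \<omega> * (if conn \<omega> u v then sqrt q else 1 / sqrt q) \<le> wt S \<omega> * sqrt q"
          using pos sqrt_q(3) by (intro mult_left_mono) auto
        then show ?thesis using False sqrt_q(2) by (simp add: W0 W1 divide_le_eq)
      qed
    qed
    moreover have "0 < (\<Sum>\<eta>\<in>Pow (lat D). W \<eta>)" using W fin by (intro sum_pos) auto
    ultimately have "lex D f * (\<Sum>\<eta>\<in>Pow (lat D). W \<eta>) \<le> (\<Sum>\<eta>\<in>Pow (lat D). W \<eta> * f \<eta>)"
      by (simp add: pos_le_divide_eq)
    moreover have re: "(\<Sum>\<zeta>\<in>Pow F. k \<zeta>) = (\<Sum>\<eta>\<in>Pow (lat D). k (dual_edge ` (lat D - \<eta>)))" for k :: "pt set set \<Rightarrow> real"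
    proof (rule sum.reindex_bij_witness[where j = "\<lambda>\<zeta>. {d \<in> lat D. dual_edge d \<notin> \<zeta>}" and i = "\<lambda>\<eta>. dual_edge ` (lat D - \<eta>)"])
      fix \<zeta> assume \<zeta>: "\<zeta> \<in> Pow F"
      have "lat D - {d \<in> lat D. dual_edge d \<notin> \<zeta>} = {d \<in> lat D. dual_edge d \<in> \<zeta>}" by auto
      then show eq: "dual_edge ` (lat D - {d \<in> lat D. dual_edge d \<notin> \<zeta>}) = \<zeta>"
        using \<zeta> by (auto simp: F_def)
      then show "k (dual_edge ` (lat D - {d \<in> lat D. dual_edge d \<notin> \<zeta>})) = k \<zeta>" by simp
    next
      fix \<eta> assume \<eta>: "\<eta> \<in> Pow (lat D)"
      then show "{d \<in> lat D. dual_edge d \<notin> dual_edge ` (lat D - \<eta>)} = \<eta>"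
        using inj_on_image_mem_iff[OF inj_dual_edge[of D], of _ "lat D - \<eta>"] by auto
    qed (auto simp: F_def)
    moreover have "{d \<in> lat D. dual_edge d \<notin> \<xi> \<union> dual_edge ` (lat D - \<eta>)} = \<eta>" if "\<eta> \<in> Pow (lat D)" for \<eta>
      using that mem[of _ \<eta>] by blast
    ultimately show ?thesis by (simp add: re W_def)
  qed
  have sF: "F \<subseteq> lat S" using sub by (simp add: F_def)
  have "lex D f * (\<Sum>\<omega>\<in>Pow (lat S). wt S \<omega>) \<le> (\<Sum>\<omega>\<in>Pow (lat S). wt S \<omega> * f {d \<in> lat D. dual_edge d \<notin> \<omega>})"
    unfolding sum_Pow_split[OF fin(1) sF] sum_distrib_left[of "lex D f" _ "Pow (lat S - F)"]
    by (intro sum_mono le) auto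
  then show ?thesis using Z_pos[OF g(1)] unfolding ex_def[of S] by (simp add: pos_le_divide_eq)
qed

end

section \<open>Primal and dual crossings around a square\<close>

lemma const_on_int_interval:
  fixes f :: "int \<Rightarrow> 'a"
  assumes "\<And>i. l \<le> i \<Longrightarrow> i < r \<Longrightarrow> f (i + 1) = f i" "l \<le> i" "i \<le> r"
  shows "f i = f l"
  using assms(2,3)
proof (induction i rule: int_ge_induct)
  case (step i)
  then show ?case using assms(1)[of i] by simp
qed simp

lemma line_conn:
  fixes a b :: int
  assumes "a \<le> b" "\<And>k. a \<le> k \<Longrightarrow> k < b \<Longrightarrow> {f k, f (k + 1)} \<in> \<omega>"
  shows "conn \<omega> (f a) (f b)"
  using assms
proof (induction b rule: int_ge_induct)
  case (step b)
  then have "conn \<omega> (f a) (f b)" by simp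
  moreover have "{f b, f (b + 1)} \<in> \<omega>" using step by simp
  ultimately show ?case using conn_edge conn_trans by metis
qed simp

lemma rect_conn:
  assumes "x \<in> {l..r} \<times> {b..t}" "y \<in> {l..r} \<times> {b..t}"
  shows "conn (lat ({l..r} \<times> {b..t})) x y"
proof -
  let ?R = "{l..r} \<times> {b..t}"
  have row: "conn (lat ?R) (i, j) (i', j)" if "i \<le> i'" "l \<le> i" "i' \<le> r" "b \<le> j" "j \<le> t" for i i' j
    by (rule line_conn[of i i' "\<lambda>i. (i, j)"]) (use that in \<open>auto simp: lat_edge ladj_def\<close>)
  have row': "conn (lat ?R) (i, j) (i', j)" if "l \<le> i" "i \<le> r" "l \<le> i'" "i' \<le> r" "b \<le> j" "j \<le> t" for i i' j
    using row[of i i' j] row[of i' i j] that conn_sym[of "lat ?R" "(i, j)"] by (cases "i \<le> i'") auto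
  have col: "conn (lat ?R) (i, j) (i, j')" if "j \<le> j'" "l \<le> i" "i \<le> r" "b \<le> j" "j' \<le> t" for i j j'
    by (rule line_conn[of j j' "\<lambda>j. (i, j)"]) (use that in \<open>auto simp: lat_edge ladj_def\<close>)
  have col': "conn (lat ?R) (i, j) (i, j')" if "l \<le> i" "i \<le> r" "b \<le> j" "j \<le> t" "b \<le> j'" "j' \<le> t" for i j j'
    using col[of j j' i] col[of j' j i] that conn_sym[of "lat ?R" "(i, j)"] by (cases "j \<le> j'") auto
  obtain i j i' j' where xy: "x = (i, j)" "y = (i', j')" by (cases x; cases y)
  have "conn (lat ?R) (i, j) (i', j)" by (rule row') (use assms xy in auto)
  moreover have "conn (lat ?R) (i', j) (i', j')" by (rule col') (use assms xy in auto)
  ultimately show ?thesis unfolding xy by (rule conn_trans)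
qed

text \<open>A square without its corners: were the corners present, a primal arm leaving a corner and a dual
  arm next to it could bypass each other.\<close>

definition trimmed :: "int \<Rightarrow> pt set" where
  "trimmed a = {- a + 1..a - 2} \<times> {- a..a - 1} \<union> {- a..a - 1} \<times> {- a + 1..a - 2}"

definition right_side :: "int \<Rightarrow> pt set" where
  "right_side a = {a - 1} \<times> {- a + 1..a - 2}"

definition top_side :: "int \<Rightarrow> pt set" where
  "top_side a = {- (a - 1)..a - 1} \<times> {a - 1}"

text \<open>The exterior primal path is closed up inside the square. The resulting closed flow has a
  height function; the exterior dual path forces equal heights at top and bottom, while the closing
  path makes them differ along the middle column of faces.\<close>

lemma exterior_crossings_incompatible:
  assumes a: "3 \<le> a" and \<omega>: "\<omega> \<subseteq> lat S" and \<eta>: "\<eta> \<subseteq> lat D" "\<And>d. d \<in> \<eta> \<Longrightarrow> dual_edge d \<notin> \<omega>"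
    and u: "u \<in> right_side a" and v: "v \<in> {- a} \<times> {- a + 1..a - 2}"
    and uv: "conn (\<omega> - lat (trimmed a)) u v"
    and t: "t \<in> top_side a" and b: "b \<in> {- (a - 1)..a - 1} \<times> {- (a - 1)}"
    and tb: "conn (\<eta> - lat ({- (a - 1)..a - 1} \<times> {- (a - 1)..a - 1})) t b"
  shows False
proof -
  define R where "R = {- a + 1..a - 2} \<times> {- a + 1..a - 2}"
  define F where "F = {- (a - 1)..a - 1} \<times> {- (a - 1)..a - 1}"
  obtain j where j: "u = (a - 1, j)" "- a + 1 \<le> j" "j \<le> a - 2" using u by (auto simp: right_side_def)
  obtain j' where j': "v = (- a, j')" "- a + 1 \<le> j'" "j' \<le> a - 2" using v by auto
  \<comment> \<open>The closing path may use the inner square and one horizontal edge at each of u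
    and v. None of these edges separates two neighbouring faces of the top row or of the bottom
    row.\<close>
  define Ein where "Ein = insert (hE (a - 1) j) (insert (hE (- a + 1) j') (lat R))"
  have Ein_A: "Ein \<subseteq> lat (trimmed a)"
  proof -
    have "lat R \<subseteq> lat (trimmed a)" by (rule lat_mono) (auto simp: R_def trimmed_def)
    moreover have "hE (a - 1) j \<in> lat (trimmed a)" "hE (- a + 1) j' \<in> lat (trimmed a)"
      using a j j' by (simp_all add: hE_lat trimmed_def)
    ultimately show ?thesis by (simp add: Ein_def)
  qed
  have "conn Ein u v"
  proof -
    have e1: "{u, (a - 2, j)} \<in> Ein" by (simp add: Ein_def hE_def j insert_commute)
    have e2: "{(- a + 1, j'), v} \<in> Ein" by (simp add: Ein_def hE_def j' insert_commute)
    have "conn (lat R) (a - 2, j) (- a + 1, j')"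
      unfolding R_def by (rule rect_conn) (use a j j' in auto)
    then have "conn Ein (a - 2, j) (- a + 1, j')" by (rule conn_mono[rotated]) (auto simp: Ein_def)
    then show ?thesis using conn_edge[OF e1] conn_edge[OF e2] conn_trans by metis
  qed
  then obtain I where I: "finite I" "I \<subseteq> Ein"
    and I3: "\<forall>X. odd (card {e \<in> I. crosses e X}) \<longleftrightarrow> (u \<in> X) \<noteq> (v \<in> X)"
    by (rule conn_obtain_flow)
  obtain P where P: "finite P" "P \<subseteq> \<omega> - lat (trimmed a)"
    and P3: "\<forall>X. odd (card {e \<in> P. crosses e X}) \<longleftrightarrow> (u \<in> X) \<noteq> (v \<in> X)"
    using uv by (rule conn_obtain_flow)
  define Q where "Q = P \<union> I"
  have Q: "finite Q" "Q \<subseteq> lat UNIV"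
  proof -
    show "finite Q" using P(1) I(1) by (simp add: Q_def)
    have "P \<subseteq> lat UNIV" using P(2) \<omega> lat_mono[of S UNIV] by blast
    moreover have "I \<subseteq> lat UNIV" using I(2) Ein_A lat_mono[of "trimmed a" UNIV] by blast
    ultimately show "Q \<subseteq> lat UNIV" by (simp add: Q_def)
  qed
  \<comment> \<open>P and I have the same boundary {u, v} and are disjoint, since P avoids
    \<open>lat (trimmed a)\<close> and I lies in it.\<close>
  have Qev: "even (card {e \<in> Q. crosses e {w}})" for w
  proof -
    have "{e \<in> Q. crosses e {w}} = {e \<in> P. crosses e {w}} \<union> {e \<in> I. crosses e {w}}" by (auto simp: Q_def)
    moreover have "{e \<in> P. crosses e {w}} \<inter> {e \<in> I. crosses e {w}} = {}" using P(2) I(2) Ein_A by blast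
    ultimately have "card {e \<in> Q. crosses e {w}} = card {e \<in> P. crosses e {w}} + card {e \<in> I. crosses e {w}}"
      using P(1) I(1) by (simp add: card_Un_disjoint)
    moreover have "odd (card {e \<in> P. crosses e {w}}) \<longleftrightarrow> odd (card {e \<in> I. crosses e {w}})"
      using I3[rule_format, of "{w}"] P3[rule_format, of "{w}"] by argo
    ultimately show ?thesis by simp
  qed
  obtain h :: "pt \<Rightarrow> bool" where h': "\<forall>i j. h (i, j + 1) \<noteq> h (i, j) \<longleftrightarrow> hE i j \<in> Q"
    "\<forall>i j. h (i + 1, j) \<noteq> h (i, j) \<longleftrightarrow> vE i j \<in> Q"
    by (rule height_function[OF Q Qev])
  note h = h'[rule_format]
  \<comment> \<open>Dual edges that cross the closing path lie inside F, hence are absent from the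
    exterior dual path.\<close>
  have inside: "d \<in> lat F" if "d \<in> lat D" "dual_edge d \<in> Ein" for d
    using that(1)
  proof (rule lat_UNIV_cases)
    fix i k assume d: "d = hE i k"
    then have "vE (i - 1) k \<in> lat R" using that(2) by (simp add: dual_edge_hE Ein_def)
    then show ?thesis using d by (auto simp: hE_lat vE_lat R_def F_def)
  next
    fix i k assume d: "d = vE i k"
    then have "i = a - 1 \<and> k - 1 = j \<or> i = - a + 1 \<and> k - 1 = j' \<or> hE i (k - 1) \<in> lat R"
      using that(2) by (simp add: dual_edge_vE Ein_def)
    then show ?thesis using d a j j' by (auto simp: hE_lat vE_lat R_def F_def)
  qed
  have "h t = h b"
  proof (rule height_constant[OF h _ _ tb[folded F_def]])
    show "\<eta> - lat F \<subseteq> lat D" using \<eta>(1) by blast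
    fix d assume d: "d \<in> \<eta> - lat F"
    then have "dual_edge d \<notin> P" using \<eta>(2) P(2) by blast
    moreover have "dual_edge d \<notin> I" using d inside[of d] \<eta>(1) I(2) by blast
    ultimately show "dual_edge d \<notin> Q" by (simp add: Q_def)
  qed
  have notQ: "e \<notin> Q" if "e \<in> lat (trimmed a)" "e \<notin> Ein" for e using that P(2) I(2) by (auto simp: Q_def)
  \<comment> \<open>The edges between neighbouring faces of the top row belong to the trimmed
    square, so P avoids them, and so does the closing path.\<close>
  have top: "h (i, a - 1) = h (- (a - 1), a - 1)" if "- (a - 1) \<le> i" "i \<le> a - 1" for i
  proof (rule const_on_int_interval[of _ "a - 1" "\<lambda>i. h (i, a - 1)", OF _ that])
    fix k assume "- (a - 1) \<le> k" "k < a - 1"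
    then have "vE k (a - 1) \<notin> Q" using a
      by (intro notQ) (auto simp: vE_lat trimmed_def Ein_def R_def)
    then show "h (k + 1, a - 1) = h (k, a - 1)" using h(2)[of k "a - 1"] by simp
  qed
  have bottom: "h (i, - (a - 1)) = h (- (a - 1), - (a - 1))" if "- (a - 1) \<le> i" "i \<le> a - 1" for i
  proof (rule const_on_int_interval[of _ "a - 1" "\<lambda>i. h (i, - (a - 1))", OF _ that])
    fix k assume "- (a - 1) \<le> k" "k < a - 1"
    then have "vE k (- (a - 1)) \<notin> Q" using a
      by (intro notQ) (auto simp: vE_lat trimmed_def Ein_def R_def)
    then show "h (k + 1, - (a - 1)) = h (k, - (a - 1))" using h(2)[of k "- (a - 1)"] by simp
  qed
  \<comment> \<open>The edges of Q crossed when climbing n faces in column 0 from the bottom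
    row.\<close>
  define J where "J n = {k. - (a - 1) \<le> k \<and> k < - (a - 1) + int n \<and> hE 0 k \<in> Q}" for n
  have column: "h (0, - (a - 1) + int n) \<noteq> h (0, - (a - 1)) \<longleftrightarrow> odd (card (J n))" for n
  proof (induction n)
    case 0
    have "J 0 = {}" by (auto simp: J_def)
    then show ?case by (simp only: card.empty even_zero) simp
  next
    case (Suc n)
    let ?k = "- (a - 1) + int n"
    have finJ: "finite (J n)" by (rule finite_subset[of _ "{- (a - 1)..?k}"]) (auto simp: J_def)
    have eq: "- (a - 1) + int (Suc n) = ?k + 1" by simp
    have step: "h (0, ?k + 1) \<noteq> h (0, ?k) \<longleftrightarrow> hE 0 ?k \<in> Q" by (rule h(1))
    show ?case
    proof (cases "hE 0 ?k \<in> Q")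
      case True
      then have "J (Suc n) = insert ?k (J n)" by (auto simp: J_def)
      moreover have "?k \<notin> J n" by (simp add: J_def)
      ultimately have "card (J (Suc n)) = Suc (card (J n))" using finJ by simp
      then show ?thesis using Suc step True unfolding eq by auto
    next
      case False
      have "J (Suc n) = J n"
      proof (intro set_eqI)
        fix k show "k \<in> J (Suc n) \<longleftrightarrow> k \<in> J n"
          using False by (cases "k = ?k") (auto simp: J_def)
      qed
      then show ?thesis using Suc step False unfolding eq by auto
    qed
  qed
  define n where "n = nat (2 * (a - 1))"
  have n: "- (a - 1) + int n = a - 1" using a by (simp add: n_def)
  \<comment> \<open>This half-plane contains v but not u, so I crosses its boundary an odd number of
    times; the edges concerned are those met on the climb.\<close>
  define X where "X = {w :: pt. fst w < 0}"
  have "{e \<in> I. crosses e X} = hE 0 ` J n"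
  proof (intro set_eqI iffI)
    fix e assume e: "e \<in> {e \<in> I. crosses e X}"
    then have eI: "e \<in> Ein" "e \<in> I" "crosses e X" using I(2) by auto
    then have "e \<in> lat (trimmed a)" using Ein_A by blast
    then obtain i k where "e = hE i k \<or> e = vE i k" by (metis lat_UNIV_cases)
    then have ek: "e = hE 0 k"
      using eI(3) by (auto simp: hE_def vE_def crosses_pair X_def)
    then have "hE 0 k \<in> lat R" using eI(1) a by (auto simp: Ein_def)
    then have "k \<in> J n" using eI(2) ek n by (auto simp: J_def Q_def hE_lat R_def)
    then show "e \<in> hE 0 ` J n" using ek by blast
  next
    fix e assume "e \<in> hE 0 ` J n"
    then obtain k where k: "e = hE 0 k" "- (a - 1) \<le> k" "k < a - 1" "hE 0 k \<in> Q"
      using n by (auto simp: J_def)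
    have "hE 0 k \<in> lat (trimmed a)" using k a by (auto simp: hE_lat trimmed_def)
    then have "e \<in> I" using k P(2) by (auto simp: Q_def)
    moreover have "crosses e X" by (simp add: k(1) hE_def crosses_pair X_def)
    ultimately show "e \<in> {e \<in> I. crosses e X}" by simp
  qed
  moreover have "odd (card {e \<in> I. crosses e X})"
    using I3[rule_format, of X] a j j' by (simp add: X_def)
  moreover have "card (hE 0 ` J n) = card (J n)" by (intro card_image inj_onI) simp
  ultimately have "h (0, a - 1) \<noteq> h (0, - (a - 1))" using column[of n] unfolding n by simp
  moreover have "h (0, a - 1) = h t" using top[of 0] top[of "fst t"] t a by (auto simp: top_side_def)
  moreover have "h (0, - (a - 1)) = h b" using bottom[of 0] bottom[of "fst b"] b a by auto
  ultimately show False using \<open>h t = h b\<close> by simp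
qed

lemma rot_pow:
  "(rot p ^^ 1) x = (- p - snd x, fst x)"
  "(rot p ^^ 2) x = (- p - fst x, - p - snd x)"
  "(rot p ^^ 3) x = (snd x, - p - fst x)"
  by (simp_all add: rot_def numeral_2_eq_2 numeral_3_eq_3)

section \<open>Vanishing of the asymptotic mean, and decay\<close>

context fk begin

text \<open>Zhang's argument at a finite scale, with a primal box of even side (p = 1) and a dual
  box of odd side (p = 0) about the same centre.\<close>

lemma gam_eq_0: "\<not> 0 < gam"
proof
  assume gam: "0 < gam"
  have "1 \<in> {0, 1 :: int}" by simp
  then obtain a1 where a1: "\<forall>A T. finite A \<and> lbox 1 a1 \<subseteq> A \<and> rot 1 ` A = A \<and> T \<subseteq> A \<and>
      (\<forall>x\<in>A. \<forall>y\<in>A. conn (lat A) x y) \<and>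
      (\<forall>v\<in>A. \<forall>w. w \<notin> A \<and> ladj v w \<longrightarrow> (\<exists>k<4. v \<in> (rot 1 ^^ k) ` T)) \<longrightarrow>
    (\<forall>\<^sub>F N in sequentially. 5 / 8 \<le> lex (lbox 1 N)
      (\<lambda>\<omega>. of_bool (\<exists>u\<in>T. \<exists>v\<in>(rot 1 ^^ 2) ` T. conn (\<omega> - lat A) u v)))"
    by (rule exE[OF exterior_crossing[OF _ gam]])
  have "0 \<in> {0, 1 :: int}" by simp
  then obtain a2 where a2: "\<forall>A T. finite A \<and> lbox 0 a2 \<subseteq> A \<and> rot 0 ` A = A \<and> T \<subseteq> A \<and>
      (\<forall>x\<in>A. \<forall>y\<in>A. conn (lat A) x y) \<and>
      (\<forall>v\<in>A. \<forall>w. w \<notin> A \<and> ladj v w \<longrightarrow> (\<exists>k<4. v \<in> (rot 0 ^^ k) ` T)) \<longrightarrow>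
    (\<forall>\<^sub>F N in sequentially. 5 / 8 \<le> lex (lbox 0 N)
      (\<lambda>\<omega>. of_bool (\<exists>u\<in>T. \<exists>v\<in>(rot 0 ^^ 2) ` T. conn (\<omega> - lat A) u v)))"
    by (rule exE[OF exterior_crossing[OF _ gam]])
  \<comment> \<open>The 3 makes the trimmed square contain \<open>lbox 1 a1\<close> in spite of its
    missing corners, and leaves room for the inner square.\<close>
  define a where "a = int (max a1 a2) + 3"
  have a: "3 \<le> a" "int a1 + 3 \<le> a" "int a2 + 3 \<le> a" by (simp_all add: a_def)
  define A where "A = trimmed a"
  define F where "F = {- (a - 1)..a - 1} \<times> {- (a - 1)..a - 1}"
  define T1 where "T1 = right_side a"
  define T2 where "T2 = top_side a"
  have ev1: "\<forall>\<^sub>F N in sequentially. 5 / 8 \<le> lex (lbox 1 N)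
      (\<lambda>\<omega>. of_bool (\<exists>u\<in>T1. \<exists>v\<in>(rot 1 ^^ 2) ` T1. conn (\<omega> - lat A) u v))"
  proof (rule a1[THEN spec, THEN spec, THEN mp], intro conjI)
    show fin: "finite A" by (simp add: A_def trimmed_def)
    show "lbox 1 a1 \<subseteq> A" using a by (auto simp: A_def trimmed_def lbox_def)
    show "rot 1 ` A = A"
    proof (rule endo_inj_surj[OF fin])
      show "rot 1 ` A \<subseteq> A" by (auto simp: A_def trimmed_def rot_def)
      show "inj_on (rot 1) A" using inj_rot by (rule inj_on_subset) simp
    qed
    show "T1 \<subseteq> A" using a by (auto simp: T1_def right_side_def A_def trimmed_def)
    show "\<forall>x\<in>A. \<forall>y\<in>A. conn (lat A) x y"
    proof -
      \<comment> \<open>The trimmed square is the union of two rectangles that share the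
        origin.\<close>
      define V H where "V = {- a + 1..a - 2} \<times> {- a..a - 1}" and "H = {- a..a - 1} \<times> {- a + 1..a - 2}"
      have VH: "A = V \<union> H" by (simp add: A_def trimmed_def V_def H_def)
      have cV: "conn (lat A) x y" if "x \<in> V" "y \<in> V" for x y
        by (rule conn_mono[OF lat_mono rect_conn[of x "- a + 1" "a - 2" "- a" "a - 1" y]])
          (use that in \<open>auto simp: VH V_def\<close>)
      have cH: "conn (lat A) x y" if "x \<in> H" "y \<in> H" for x y
        by (rule conn_mono[OF lat_mono rect_conn[of x "- a" "a - 1" "- a + 1" "a - 2" y]])
          (use that in \<open>auto simp: VH H_def\<close>)
      have O: "(0, 0) \<in> V" "(0, 0) \<in> H" using a by (auto simp: V_def H_def)
      have "conn (lat A) x (0, 0)" "conn (lat A) (0, 0) x" if "x \<in> A" for x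
        using that cV cH O unfolding VH by blast+
      then show ?thesis using conn_trans by metis
    qed
    show "\<forall>v\<in>A. \<forall>w. w \<notin> A \<and> ladj v w \<longrightarrow> (\<exists>k<4. v \<in> (rot 1 ^^ k) ` T1)"
    proof (intro ballI allI impI)
      fix v w assume v: "v \<in> A" and w: "w \<notin> A \<and> ladj v w"
      obtain i j where ij: "v = (i, j)" by (cases v)
      have wc: "w = (i - 1, j) \<or> w = (i + 1, j) \<or> w = (i, j - 1) \<or> w = (i, j + 1)"
        using w unfolding ij ladj_cases by simp
      have inA: "(- a + 1 \<le> i \<and> i \<le> a - 2 \<and> - a \<le> j \<and> j \<le> a - 1) \<or> (- a \<le> i \<and> i \<le> a - 1 \<and> - a + 1 \<le> j \<and> j \<le> a - 2)"
        using v by (auto simp: ij A_def trimmed_def)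
      have "\<not> (- a + 1 \<le> i \<and> i \<le> a - 2 \<and> - a + 1 \<le> j \<and> j \<le> a - 2)"
        using w wc by (auto simp: A_def trimmed_def)
      then consider "i = a - 1" "- a + 1 \<le> j" "j \<le> a - 2" | "j = a - 1" "- a + 1 \<le> i" "i \<le> a - 2"
        | "i = - a" "- a + 1 \<le> j" "j \<le> a - 2" | "j = - a" "- a + 1 \<le> i" "i \<le> a - 2"
        using inA by linarith
      then show "\<exists>k<4. v \<in> (rot 1 ^^ k) ` T1"
      proof cases
        case 1
        then have "v \<in> (rot 1 ^^ 0) ` T1" by (simp add: ij T1_def right_side_def)
        then show ?thesis by (intro exI[of _ 0]) simp
      next
        case 2
        then have "v = (rot 1 ^^ 1) (a - 1, - 1 - i)" "(a - 1, - 1 - i) \<in> T1"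
          by (simp_all only: rot_pow) (simp_all add: ij T1_def right_side_def)
        then have "v \<in> (rot 1 ^^ 1) ` T1" by (rule image_eqI)
        then show ?thesis by (intro exI[of _ 1] conjI; (assumption | simp))
      next
        case 3
        then have "v = (rot 1 ^^ 2) (a - 1, - 1 - j)" "(a - 1, - 1 - j) \<in> T1"
          by (simp_all only: rot_pow) (simp_all add: ij T1_def right_side_def)
        then have "v \<in> (rot 1 ^^ 2) ` T1" by (rule image_eqI)
        then show ?thesis by (intro exI[of _ 2] conjI; (assumption | simp))
      next
        case 4
        then have "v = (rot 1 ^^ 3) (a - 1, i)" "(a - 1, i) \<in> T1"
          by (simp_all only: rot_pow) (simp_all add: ij T1_def right_side_def)
        then have "v \<in> (rot 1 ^^ 3) ` T1" by (rule image_eqI)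
        then show ?thesis by (intro exI[of _ 3] conjI; (assumption | simp))
      qed
    qed
  qed
  have ev2: "\<forall>\<^sub>F N in sequentially. 5 / 8 \<le> lex (lbox 0 N)
      (\<lambda>\<omega>. of_bool (\<exists>u\<in>T2. \<exists>v\<in>(rot 0 ^^ 2) ` T2. conn (\<omega> - lat F) u v))"
  proof (rule a2[THEN spec, THEN spec, THEN mp], intro conjI)
    show fin: "finite F" by (simp add: F_def)
    show "lbox 0 a2 \<subseteq> F" using a by (auto simp: F_def lbox_def)
    show "rot 0 ` F = F"
    proof (rule endo_inj_surj[OF fin])
      show "rot 0 ` F \<subseteq> F" by (auto simp: F_def rot_def)
      show "inj_on (rot 0) F" using inj_rot by (rule inj_on_subset) simp
    qed
    show "T2 \<subseteq> F" using a by (auto simp: T2_def top_side_def F_def)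
    show "\<forall>x\<in>F. \<forall>y\<in>F. conn (lat F) x y" unfolding F_def using rect_conn by blast
    show "\<forall>v\<in>F. \<forall>w. w \<notin> F \<and> ladj v w \<longrightarrow> (\<exists>k<4. v \<in> (rot 0 ^^ k) ` T2)"
    proof (intro ballI allI impI)
      fix v w assume v: "v \<in> F" and w: "w \<notin> F \<and> ladj v w"
      obtain i j where ij: "v = (i, j)" by (cases v)
      have wc: "w = (i - 1, j) \<or> w = (i + 1, j) \<or> w = (i, j - 1) \<or> w = (i, j + 1)"
        using w unfolding ij ladj_cases by simp
      have inF: "- (a - 1) \<le> i" "i \<le> a - 1" "- (a - 1) \<le> j" "j \<le> a - 1"
        using v by (auto simp: ij F_def)
      have "i = a - 1 \<or> i = - (a - 1) \<or> j = a - 1 \<or> j = - (a - 1)"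
        using w wc inF by (auto simp: F_def)
      then consider "j = a - 1" | "i = - (a - 1)" | "j = - (a - 1)" | "i = a - 1" by blast
      then show "\<exists>k<4. v \<in> (rot 0 ^^ k) ` T2"
      proof cases
        case 1
        then have "v \<in> (rot 0 ^^ 0) ` T2" using inF by (simp add: ij T2_def top_side_def)
        then show ?thesis by (intro exI[of _ 0]) simp
      next
        case 2
        then have "v = (rot 0 ^^ 1) (j, a - 1)" "(j, a - 1) \<in> T2"
          using inF by (simp_all only: rot_pow) (simp_all add: ij T2_def top_side_def)
        then have "v \<in> (rot 0 ^^ 1) ` T2" by (rule image_eqI)
        then show ?thesis by (intro exI[of _ 1] conjI; (assumption | simp))
      next
        case 3
        then have "v = (rot 0 ^^ 2) (- i, a - 1)" "(- i, a - 1) \<in> T2"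
          using inF by (simp_all only: rot_pow) (simp_all add: ij T2_def top_side_def)
        then have "v \<in> (rot 0 ^^ 2) ` T2" by (rule image_eqI)
        then show ?thesis by (intro exI[of _ 2] conjI; (assumption | simp))
      next
        case 4
        then have "v = (rot 0 ^^ 3) (- j, a - 1)" "(- j, a - 1) \<in> T2"
          using inF by (simp_all only: rot_pow) (simp_all add: ij T2_def top_side_def)
        then have "v \<in> (rot 0 ^^ 3) ` T2" by (rule image_eqI)
        then show ?thesis by (intro exI[of _ 3] conjI; (assumption | simp))
      qed
    qed
  qed
  \<comment> \<open>The faces inside \<open>lbox 1 (Suc N)\<close> are indexed by
    \<open>lbox 0 N\<close>, so the primal box is taken one size larger.\<close>
  have "\<forall>\<^sub>F N in sequentially. 5 / 8 \<le> lex (lbox 1 (Suc N))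
      (\<lambda>\<omega>. of_bool (\<exists>u\<in>T1. \<exists>v\<in>(rot 1 ^^ 2) ` T1. conn (\<omega> - lat A) u v))"
    by (rule eventually_sequentially_Suc[THEN iffD2, OF ev1])
  with ev2 have "\<forall>\<^sub>F N in sequentially. 5 / 8 \<le> lex (lbox 1 (Suc N))
      (\<lambda>\<omega>. of_bool (\<exists>u\<in>T1. \<exists>v\<in>(rot 1 ^^ 2) ` T1. conn (\<omega> - lat A) u v)) \<and>
    5 / 8 \<le> lex (lbox 0 N)
      (\<lambda>\<omega>. of_bool (\<exists>u\<in>T2. \<exists>v\<in>(rot 0 ^^ 2) ` T2. conn (\<omega> - lat F) u v))"
    by (rule eventually_conj[rotated])
  then obtain N where N: "5 / 8 \<le> lex (lbox 1 (Suc N))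
      (\<lambda>\<omega>. of_bool (\<exists>u\<in>T1. \<exists>v\<in>(rot 1 ^^ 2) ` T1. conn (\<omega> - lat A) u v))"
    "5 / 8 \<le> lex (lbox 0 N)
      (\<lambda>\<omega>. of_bool (\<exists>u\<in>T2. \<exists>v\<in>(rot 0 ^^ 2) ` T2. conn (\<omega> - lat F) u v))"
    by (auto simp: eventually_sequentially)
  define S D where "S = lbox 1 (Suc N)" and "D = lbox 0 N"
  define c1 :: "pt set set \<Rightarrow> real"
    where "c1 = (\<lambda>\<omega>. of_bool (\<exists>u\<in>T1. \<exists>v\<in>(rot 1 ^^ 2) ` T1. conn (\<omega> - lat A) u v))"
  define c2 :: "pt set set \<Rightarrow> real"
    where "c2 = (\<lambda>\<omega>. of_bool (\<exists>u\<in>T2. \<exists>v\<in>(rot 0 ^^ 2) ` T2. conn (\<omega> - lat F) u v))"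
  have gS: "graph S (lat S)" by (simp add: S_def graph_lat)
  have "5 / 8 \<le> lex D c2" using N(2) by (simp only: D_def c2_def)
  also have "\<dots> \<le> lex S (\<lambda>\<omega>. c2 {d \<in> lat D. dual_edge d \<notin> \<omega>})"
  proof (rule dual_domination)
    show "dual_edge ` lat D \<subseteq> lat S"
    proof
      fix e assume "e \<in> dual_edge ` lat D"
      then obtain d where d: "d \<in> lat D" "e = dual_edge d" by blast
      from d(1) show "e \<in> lat S"
      proof (rule lat_UNIV_cases)
        fix i j assume "d = hE i j"
        then show ?thesis using d by (auto simp: dual_edge_hE vE_lat hE_lat S_def D_def lbox_def)
      next
        fix i j assume "d = vE i j"
        then show ?thesis using d by (auto simp: dual_edge_vE vE_lat hE_lat S_def D_def lbox_def)
      qed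
    qed
    fix \<eta> \<eta>' :: "pt set set" assume "\<eta>' \<subseteq> \<eta>"
    then have sub: "\<eta>' - lat F \<subseteq> \<eta> - lat F" by blast
    show "c2 \<eta>' \<le> c2 \<eta>"
      unfolding c2_def of_bool_less_eq_iff
      by (intro impI, elim bexE, intro bexI, rule conn_mono[OF sub], assumption+)
  qed (simp_all add: S_def D_def)
  finally have "5 / 8 + 5 / 8 \<le> lex S c1 + lex S (\<lambda>\<omega>. c2 {d \<in> lat D. dual_edge d \<notin> \<omega>})"
    using N(1) unfolding S_def[symmetric] c1_def[symmetric] by linarith
  also have "\<dots> = lex S (\<lambda>\<omega>. c1 \<omega> + c2 {d \<in> lat D. dual_edge d \<notin> \<omega>})" by (simp only: ex_add)
  also have "\<dots> \<le> lex S (\<lambda>\<omega>. 1)"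
  proof (rule ex_mono[OF gS])
    fix \<omega> assume \<omega>: "\<omega> \<subseteq> lat S"
    have r1: "(rot 1 ^^ 2) ` T1 \<subseteq> {- a} \<times> {- a + 1..a - 2}"
      by (auto simp: T1_def right_side_def rot_pow)
    have r2: "(rot 0 ^^ 2) ` T2 \<subseteq> {- (a - 1)..a - 1} \<times> {- (a - 1)}"
      by (auto simp: T2_def top_side_def rot_pow)
    have "\<not> (c1 \<omega> = 1 \<and> c2 {d \<in> lat D. dual_edge d \<notin> \<omega>} = 1)"
    proof
      assume "c1 \<omega> = 1 \<and> c2 {d \<in> lat D. dual_edge d \<notin> \<omega>} = 1"
      then obtain u v t b where "u \<in> T1" "v \<in> (rot 1 ^^ 2) ` T1" "conn (\<omega> - lat A) u v"
        "t \<in> T2" "b \<in> (rot 0 ^^ 2) ` T2" "conn ({d \<in> lat D. dual_edge d \<notin> \<omega>} - lat F) t b"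
        unfolding c1_def c2_def of_bool_eq_1_iff by blast
      then show False
        using exterior_crossings_incompatible[OF a(1) \<omega>, of "{d \<in> lat D. dual_edge d \<notin> \<omega>}" D u v t b] r1 r2
        unfolding A_def F_def T1_def T2_def by blast
    qed
    then show "c1 \<omega> + c2 {d \<in> lat D. dual_edge d \<notin> \<omega>} \<le> 1"
      unfolding c1_def c2_def by (auto simp: of_bool_def split: if_splits)
  qed
  finally show False using gS by simp
qed

lemma G_decay:
  assumes "0 < \<epsilon>"
  obtains R where "\<And>x y. R \<le> \<bar>fst x - fst y\<bar> + \<bar>snd x - snd y\<bar> \<Longrightarrow> G x y < \<epsilon>"
proof (rule ccontr)
  assume no: "\<not> thesis"
  have "\<exists>x y. R \<le> \<bar>fst x - fst y\<bar> + \<bar>snd x - snd y\<bar> \<and> \<epsilon> \<le> G x y" for R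
    using no that[of R] by (meson not_less)
  then have "\<exists>c>0. \<forall>x y. c \<le> G x y" by (rule G_bounded_below[OF assms])
  then obtain c where "0 < c" "\<forall>x y. c \<le> G x y" by (elim exE conjE)
  then have "0 < gam" by (intro gam_pos[of c]) blast+
  then show False using gam_eq_0 by simp
qed

end

section \<open>From the random-cluster model to the Potts model\<close>

text \<open>Only the number of colours matters; this passes from the simplex to the colours below
  q.\<close>

lemma card_col_cong:
  assumes "card T = card T'" "finite T" "finite T'" "\<omega> \<subseteq> Pow V"
  shows "card (col T V \<omega>) = card (col T' V \<omega>)"
proof -
  obtain g where g: "bij_betw g T T'" using finite_same_card_bij[OF assms(2,3,1)] by blast
  have in_col: "(\<lambda>v\<in>V. g (\<sigma> v)) \<in> col T' V \<omega>"
    if "bij_betw g T T'" "\<sigma> \<in> col T V \<omega>" for g T T' \<sigma>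
  proof -
    have "(\<lambda>v\<in>V. g (\<sigma> v)) x = (\<lambda>v\<in>V. g (\<sigma> v)) y" if "{x, y} \<in> \<omega>" for x y
    proof -
      have "x \<in> V" "y \<in> V" using that assms(4) by auto
      moreover have "\<sigma> x = \<sigma> y" using that \<open>\<sigma> \<in> col T V \<omega>\<close> by (auto simp: col_def)
      ultimately show ?thesis by simp
    qed
    moreover have "g (\<sigma> v) \<in> T'" if "v \<in> V" for v
    proof -
      have "\<sigma> v \<in> T" using \<open>\<sigma> \<in> col T V \<omega>\<close> that by (auto simp: col_def)
      then show ?thesis using bij_betwE[OF \<open>bij_betw g T T'\<close>] by blast
    qed
    ultimately show ?thesis by (simp add: col_def)
  qed
  have inv: "(\<lambda>v\<in>V. g' ((\<lambda>v\<in>V. g (\<sigma> v)) v)) = \<sigma>"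
    if "\<And>t. t \<in> T \<Longrightarrow> g' (g t) = t" "\<sigma> \<in> col T V \<omega>" for g g' T \<sigma>
  proof
    fix v
    have "\<sigma> \<in> V \<rightarrow>\<^sub>E T" using that(2) by (simp add: col_def)
    then show "(\<lambda>v\<in>V. g' ((\<lambda>v\<in>V. g (\<sigma> v)) v)) v = \<sigma> v"
      using that(1)[of "\<sigma> v"] PiE_arb[of \<sigma> V "\<lambda>_. T" v] PiE_mem[of \<sigma> V "\<lambda>_. T" v] by (cases "v \<in> V") simp_all
  qed
  define g' where "g' = inv_into T g"
  have g': "bij_betw g' T' T" unfolding g'_def by (rule bij_betw_inv_into[OF g])
  have gg': "g' (g t) = t" if "t \<in> T" for t
    unfolding g'_def using bij_betw_inv_into_left[OF g that] .
  have g'g: "g (g' t) = t" if "t \<in> T'" for t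
    unfolding g'_def using bij_betw_inv_into_right[OF g that] .
  have inv1: "(\<lambda>v\<in>V. g' ((\<lambda>v\<in>V. g (\<sigma> v)) v)) = \<sigma>" if "\<sigma> \<in> col T V \<omega>" for \<sigma>
    by (rule inv[OF _ that]) (rule gg')
  have inv2: "(\<lambda>v\<in>V. g ((\<lambda>v\<in>V. g' (\<sigma> v)) v)) = \<sigma>" if "\<sigma> \<in> col T' V \<omega>" for \<sigma>
    by (rule inv[OF _ that]) (rule g'g)
  show ?thesis
    by (rule bij_betw_same_card[of "\<lambda>\<sigma>. \<lambda>v\<in>V. g (\<sigma> v)"],
        rule bij_betw_byWitness[where f' = "\<lambda>\<sigma>. \<lambda>v\<in>V. g' (\<sigma> v)"])
       (use in_col[OF g] in_col[OF g'] inv1 inv2 in auto)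
qed

context fk begin

text \<open>If the marked points lie in distinct clusters, their colours are exactly independent and
  uniform. Otherwise some pair is connected, and the number of connected ordered pairs bounds the
  error.\<close>

lemma spin_pinned_approx:
  fixes T :: "'c set" and \<tau> :: "'i \<Rightarrow> 'c" and x :: "'i \<Rightarrow> 'v"
  assumes "graph V E" "finite T" "card T = q" "finite I" "inj_on x I" "x ` I \<subseteq> V" "\<tau> ` I \<subseteq> T"
  defines "w \<equiv> \<lambda>\<sigma>. \<Prod>e\<in>E. 1 + sqrt q * of_bool (mono_on_edge \<sigma> e)"
  shows "\<bar>(\<Sum>\<sigma>\<in>V \<rightarrow>\<^sub>E T. of_bool (\<forall>i\<in>I. \<sigma> (x i) = \<tau> i) * w \<sigma>) / (\<Sum>\<sigma>\<in>V \<rightarrow>\<^sub>E T. w \<sigma>) - 1 / q ^ card I\<bar>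
    \<le> (\<Sum>i\<in>I. \<Sum>j\<in>I - {i}. ex V E (\<lambda>\<omega>. of_bool (conn \<omega> (x i) (x j))))"
proof -
  have fin: "finite V" "finite E" using graph_finite[OF assms(1)] by auto
  define Z where "Z = (\<Sum>\<omega>\<in>Pow E. wt V \<omega>)"
  have Z: "0 < Z" unfolding Z_def by (rule Z_pos[OF assms(1)])
  define N where "N \<omega> = real (card {\<sigma> \<in> col T V \<omega>. \<forall>i\<in>I. \<sigma> (x i) = \<tau> i})" for \<omega>
  have colT: "card (col T V \<omega>) = card (col {..<q} V \<omega>)" if "\<omega> \<subseteq> E" for \<omega>
    using that graph_subset_Pow[OF assms(1)] assms(2,3) by (intro card_col_cong) auto
  have den: "(\<Sum>\<sigma>\<in>V \<rightarrow>\<^sub>E T. w \<sigma>) = Z"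
  proof -
    have "(\<Sum>\<sigma>\<in>V \<rightarrow>\<^sub>E T. w \<sigma>) = (\<Sum>\<sigma>\<in>V \<rightarrow>\<^sub>E T. 1 * w \<sigma>)" by simp
    also have "\<dots> = (\<Sum>\<omega>\<in>Pow E. sqrt q ^ card \<omega> * (\<Sum>\<sigma>\<in>col T V \<omega>. 1))"
      unfolding w_def by (rule edwards_sokal[OF assms(1,2)])
    also have "\<dots> = Z" unfolding Z_def wt_def using colT by (intro sum.cong) auto
    finally show ?thesis .
  qed
  have num: "(\<Sum>\<sigma>\<in>V \<rightarrow>\<^sub>E T. of_bool (\<forall>i\<in>I. \<sigma> (x i) = \<tau> i) * w \<sigma>) = (\<Sum>\<omega>\<in>Pow E. sqrt q ^ card \<omega> * N \<omega>)"
  proof -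
    have "(\<Sum>\<sigma>\<in>col T V \<omega>. of_bool (\<forall>i\<in>I. \<sigma> (x i) = \<tau> i)) = N \<omega>" for \<omega>
      using finite_col[OF fin(1) assms(2)] by (simp add: N_def Int_def)
    then show ?thesis unfolding w_def edwards_sokal[OF assms(1,2)] by simp
  qed
  have pt: "\<bar>sqrt q ^ card \<omega> * N \<omega> - wt V \<omega> / q ^ card I\<bar> \<le> wt V \<omega> * (\<Sum>i\<in>I. \<Sum>j\<in>I - {i}. of_bool (conn \<omega> (x i) (x j)))"
    if \<omega>: "\<omega> \<subseteq> E" for \<omega>
  proof -
    have sub: "\<omega> \<subseteq> Pow V" using \<omega> graph_subset_Pow[OF assms(1)] by blast
    have wt: "wt V \<omega> = sqrt q ^ card \<omega> * card (col T V \<omega>)" by (simp add: wt_def colT[OF \<omega>])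
    have pos: "0 < wt V \<omega>" by (rule wt_pos[OF assms(1) \<omega>])
    show ?thesis
    proof (cases "\<exists>i\<in>I. \<exists>j\<in>I. i \<noteq> j \<and> conn \<omega> (x i) (x j)")
      case True
      then obtain i j where ij: "i \<in> I" "j \<in> I - {i}" "conn \<omega> (x i) (x j)" by blast
      have "1 \<le> (\<Sum>j\<in>I - {i}. of_bool (conn \<omega> (x i) (x j)) :: real)"
        using member_le_sum[of j "I - {i}" "\<lambda>j. of_bool (conn \<omega> (x i) (x j)) :: real"] ij assms(4) by simp
      also have "\<dots> \<le> (\<Sum>i\<in>I. \<Sum>j\<in>I - {i}. of_bool (conn \<omega> (x i) (x j)))"
        using ij(1) assms(4) by (intro member_le_sum[of i I "\<lambda>i. \<Sum>j\<in>I - {i}. of_bool (conn \<omega> (x i) (x j))"] sum_nonneg) auto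
      finally have "wt V \<omega> * 1 \<le> wt V \<omega> * (\<Sum>i\<in>I. \<Sum>j\<in>I - {i}. of_bool (conn \<omega> (x i) (x j)))"
        using pos by (intro mult_left_mono) auto
      moreover have "0 \<le> sqrt q ^ card \<omega> * N \<omega>" by (simp add: N_def)
      moreover have "sqrt q ^ card \<omega> * N \<omega> \<le> wt V \<omega>"
        unfolding wt N_def using finite_col[OF fin(1) assms(2)] by (intro mult_left_mono of_nat_mono card_mono) auto
      moreover have "0 \<le> wt V \<omega> / q ^ card I" using pos by simp
      moreover have "wt V \<omega> / q ^ card I \<le> wt V \<omega>"
        using pos q_ge_2 by (simp add: divide_le_eq mult_le_cancel_left1)
      ultimately show ?thesis by linarith
    next
      case False
      \<comment> \<open>\<open>card_col_pinned\<close> prescribes colours by position, whereas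
        \<tau> is indexed by I; the inverse of x translates.\<close>
      have "card {\<sigma> \<in> col T V \<omega>. \<forall>z\<in>x ` I. \<sigma> z = \<tau> (inv_into I x z)} * card T ^ card (x ` I) = card (col T V \<omega>)"
      proof (rule card_col_pinned[OF fin(1) assms(2) sub _ assms(6)])
        fix y z assume yz: "y \<in> x ` I" "z \<in> x ` I" "y \<noteq> z"
        obtain i where i: "i \<in> I" "y = x i" using yz(1) by (elim imageE)
        obtain j where j: "j \<in> I" "z = x j" using yz(2) by (elim imageE)
        have "i \<noteq> j" using yz(3) i(2) j(2) by auto
        then show "\<not> conn \<omega> y z" using False i j by metis
      next
        fix z assume "z \<in> x ` I"
        then have "inv_into I x z \<in> I" by (rule inv_into_into)
        then show "\<tau> (inv_into I x z) \<in> T" using assms(7) by (simp add: image_subset_iff)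
      next
        show "finite (x ` I)" using assms(4) by simp
      qed
      moreover have "(\<forall>z\<in>x ` I. \<sigma> z = \<tau> (inv_into I x z)) \<longleftrightarrow> (\<forall>i\<in>I. \<sigma> (x i) = \<tau> i)" for \<sigma>
        using assms(5) by simp
      ultimately have "real (card {\<sigma> \<in> col T V \<omega>. \<forall>i\<in>I. \<sigma> (x i) = \<tau> i} * card T ^ card (x ` I)) = real (card (col T V \<omega>))"
        by simp
      then have "N \<omega> * real q ^ card I = real (card (col T V \<omega>))"
        by (simp add: N_def assms(3) card_image[OF assms(5)])
      then have "N \<omega> = card (col T V \<omega>) / q ^ card I" using q_ge_2 by (simp add: field_simps)
      then have "sqrt q ^ card \<omega> * N \<omega> - wt V \<omega> / q ^ card I = 0" by (simp add: wt)
      moreover have "0 \<le> wt V \<omega> * (\<Sum>i\<in>I. \<Sum>j\<in>I - {i}. of_bool (conn \<omega> (x i) (x j)))"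
        using pos by (intro mult_nonneg_nonneg sum_nonneg) auto
      ultimately show ?thesis by simp
    qed
  qed
  have "\<bar>(\<Sum>\<omega>\<in>Pow E. sqrt q ^ card \<omega> * N \<omega>) / Z - 1 / q ^ card I\<bar>
      = \<bar>\<Sum>\<omega>\<in>Pow E. sqrt q ^ card \<omega> * N \<omega> - wt V \<omega> / q ^ card I\<bar> / Z"
  proof -
    have "(\<Sum>\<omega>\<in>Pow E. sqrt q ^ card \<omega> * N \<omega> - wt V \<omega> / q ^ card I) = (\<Sum>\<omega>\<in>Pow E. sqrt q ^ card \<omega> * N \<omega>) - Z / q ^ card I"
      by (simp add: sum_subtractf Z_def sum_divide_distrib)
    moreover have "(\<Sum>\<omega>\<in>Pow E. sqrt q ^ card \<omega> * N \<omega>) / Z - 1 / q ^ card I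
      = ((\<Sum>\<omega>\<in>Pow E. sqrt q ^ card \<omega> * N \<omega>) - Z / q ^ card I) / Z"
      using Z by (simp add: diff_divide_distrib)
    ultimately show ?thesis using Z by (simp add: abs_divide)
  qed
  also have "\<dots> \<le> (\<Sum>\<omega>\<in>Pow E. \<bar>sqrt q ^ card \<omega> * N \<omega> - wt V \<omega> / q ^ card I\<bar>) / Z"
    using Z by (intro divide_right_mono sum_abs) auto
  also have "\<dots> \<le> (\<Sum>\<omega>\<in>Pow E. wt V \<omega> * (\<Sum>i\<in>I. \<Sum>j\<in>I - {i}. of_bool (conn \<omega> (x i) (x j)))) / Z"
    using Z by (intro divide_right_mono sum_mono pt) auto
  also have "\<dots> = ex V E (\<lambda>\<omega>. \<Sum>i\<in>I. \<Sum>j\<in>I - {i}. of_bool (conn \<omega> (x i) (x j)))"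
    by (simp add: ex_def Z_def)
  finally show ?thesis unfolding num den by (simp only: ex_sum)
qed

section \<open>The rescaled lattice and the critical Potts measure\<close>

definition emb :: "real \<Rightarrow> pt \<Rightarrow> complex" where
  "emb \<delta> z = of_real \<delta> * Complex (of_int (fst z)) (of_int (snd z))"

lemma inj_emb: "0 < \<delta> \<Longrightarrow> inj (emb \<delta>)"
  by (auto simp: inj_def emb_def prod_eq_iff)

lemma dist_emb: "0 < \<delta> \<Longrightarrow> dist (emb \<delta> x) (emb \<delta> y) = \<delta> * sqrt (of_int ((fst x - fst y)\<^sup>2 + (snd x - snd y)\<^sup>2))"
proof -
  assume "0 < \<delta>"
  have "emb \<delta> x - emb \<delta> y = of_real \<delta> * Complex (of_int (fst x - fst y)) (of_int (snd x - snd y))"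
    by (simp add: emb_def complex_eq_iff algebra_simps)
  then have "dist (emb \<delta> x) (emb \<delta> y) = \<bar>\<delta>\<bar> * cmod (Complex (of_int (fst x - fst y)) (of_int (snd x - snd y)))"
    unfolding dist_norm by (simp only: norm_mult norm_of_real)
  then show ?thesis using \<open>0 < \<delta>\<close> by (simp add: complex_norm)
qed

lemma dist_emb_eq:
  assumes "0 < \<delta>"
  shows "dist (emb \<delta> x) (emb \<delta> y) = \<delta> \<longleftrightarrow> ladj x y"
proof -
  define m n where "m = fst x - fst y" and "n = snd x - snd y"
  have "dist (emb \<delta> x) (emb \<delta> y) = \<delta> \<longleftrightarrow> sqrt (of_int (m\<^sup>2 + n\<^sup>2)) = 1"
    unfolding dist_emb[OF assms] m_def n_def using assms by simp
  also have "\<dots> \<longleftrightarrow> m\<^sup>2 + n\<^sup>2 = 1"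
    by (simp only: real_sqrt_eq_1_iff of_int_eq_1_iff)
  also have "\<dots> \<longleftrightarrow> \<bar>m\<bar> + \<bar>n\<bar> = 1"
  proof
    assume *: "m\<^sup>2 + n\<^sup>2 = 1"
    have sq: "\<bar>k\<bar> \<le> k\<^sup>2" for k :: int
    proof (cases "k = 0")
      case False
      then have "\<bar>k\<bar> * 1 \<le> \<bar>k\<bar> * \<bar>k\<bar>" by (intro mult_left_mono) auto
      then show ?thesis by (simp add: power2_eq_square)
    qed simp
    have "\<bar>m\<bar> \<le> m\<^sup>2" "\<bar>n\<bar> \<le> n\<^sup>2" by (rule sq)+
    moreover have "\<bar>m\<bar> + \<bar>n\<bar> \<noteq> 0"
    proof
      assume "\<bar>m\<bar> + \<bar>n\<bar> = 0"
      then have "m = 0" "n = 0" by linarith+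
      then show False using * by simp
    qed
    ultimately show "\<bar>m\<bar> + \<bar>n\<bar> = 1" using * by linarith
  next
    assume "\<bar>m\<bar> + \<bar>n\<bar> = 1"
    then have "(\<bar>m\<bar> = 1 \<and> n = 0) \<or> (m = 0 \<and> \<bar>n\<bar> = 1)" by linarith
    then show "m\<^sup>2 + n\<^sup>2 = 1" by (auto simp: abs_if split: if_splits)
  qed
  finally show ?thesis by (simp add: ladj_def m_def n_def)
qed

lemma dist_emb_le:
  assumes "0 < \<delta>"
  shows "dist (emb \<delta> x) (emb \<delta> y) \<le> \<delta> * of_int (\<bar>fst x - fst y\<bar> + \<bar>snd x - snd y\<bar>)"
proof -
  have "sqrt (of_int ((fst x - fst y)\<^sup>2 + (snd x - snd y)\<^sup>2)) \<le> real_of_int (\<bar>fst x - fst y\<bar> + \<bar>snd x - snd y\<bar>)"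
    using sqrt_sum_squares_le_sum_abs[of "of_int (fst x - fst y)" "of_int (snd x - snd y)"] by simp
  then show ?thesis unfolding dist_emb[OF assms] using assms by (intro mult_left_mono) auto
qed

text \<open>An edge has weight exp \<beta> or exp (- \<beta> / (q - 1)). At the critical \<beta>
  their ratio is 1 + sqrt q, and the common factor cancels in the quotient.\<close>

lemma critical_potts_prob_eq:
  fixes T :: "(real ^ 'd) set"
  assumes T: "potts_simplex q T" and "finite (domain_verts \<Omega> \<delta>)" "0 < \<delta>"
  defines "V \<equiv> domain_verts \<Omega> \<delta>" and "E \<equiv> (\<lambda>(x, y). {x, y}) ` domain_edges \<Omega> \<delta>"
  shows "critical_potts_prob q T \<Omega> \<delta> A
    = (\<Sum>\<sigma>\<in>V \<rightarrow>\<^sub>E T. of_bool (A \<sigma>) * (\<Prod>e\<in>E. 1 + sqrt q * of_bool (mono_on_edge \<sigma> e)))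
      / (\<Sum>\<sigma>\<in>V \<rightarrow>\<^sub>E T. \<Prod>e\<in>E. 1 + sqrt q * of_bool (mono_on_edge \<sigma> e))"
proof -
  define \<beta> where "\<beta> = potts_beta_c q"
  define D where "D = domain_edges \<Omega> \<delta>"
  define \<kappa> where "\<kappa> = exp (- \<beta> / (real q - 1)) ^ card E"
  have finD: "finite D"
    unfolding D_def domain_edges_def by (rule finite_subset[of _ "V \<times> V"]) (use assms(2) in \<open>auto simp: V_def\<close>)
  then have finE: "finite E" by (simp add: E_def D_def)
  have weight: "exp (- \<beta> * potts_hamiltonian D \<sigma>) = \<kappa> * (\<Prod>e\<in>E. 1 + sqrt q * of_bool (mono_on_edge \<sigma> e))"
    if \<sigma>: "\<sigma> \<in> V \<rightarrow>\<^sub>E T" for \<sigma>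
  proof -
    define k where "k e = (if mono_on_edge \<sigma> e then 1 else - 1 / (real q - 1))" for e
    have inner: "\<sigma> u \<bullet> \<sigma> v = k {u, v}" if "(u, v) \<in> D" for u v
    proof -
      have "\<sigma> u \<in> T" "\<sigma> v \<in> T" using that \<sigma> by (auto simp: D_def domain_edges_def V_def)
      then have "\<sigma> u \<bullet> \<sigma> v = (if \<sigma> u = \<sigma> v then 1 else - 1 / (real q - 1))"
        using T unfolding potts_simplex_def by blast
      moreover have "mono_on_edge \<sigma> {u, v} \<longleftrightarrow> \<sigma> u = \<sigma> v" by (auto simp: mono_on_edge_def)
      ultimately show ?thesis by (simp only: k_def)
    qed
    have "(\<Sum>(u, v)\<in>D. \<sigma> u \<bullet> \<sigma> v) = (\<Sum>p\<in>D. k {fst p, snd p})"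
      using inner by (intro sum.cong) auto
    also have "\<dots> = (\<Sum>e\<in>(\<lambda>p. {fst p, snd p}) ` D. \<Sum>p | p \<in> D \<and> {fst p, snd p} = e. k {fst p, snd p})"
      by (rule sum.image_gen[OF finD])
    also have "(\<lambda>p. {fst p, snd p}) ` D = E" by (auto simp: E_def D_def split_beta)
    \<comment> \<open>Every edge arises from two ordered pairs, which the factor 1 / 2 in the
      Hamiltonian compensates.\<close>
    also have "(\<Sum>e\<in>E. \<Sum>p | p \<in> D \<and> {fst p, snd p} = e. k {fst p, snd p}) = (\<Sum>e\<in>E. 2 * k e)"
    proof (intro sum.cong refl)
      fix e assume "e \<in> E"
      then obtain u v where uv: "e = {u, v}" "(u, v) \<in> D" by (auto simp: E_def D_def)
      then have "(v, u) \<in> D" "u \<noteq> v" using assms(3) by (auto simp: D_def domain_edges_def dist_commute)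
      then have "{p. p \<in> D \<and> {fst p, snd p} = e} = {(u, v), (v, u)}"
        using uv by (auto simp: doubleton_eq_iff)
      then show "(\<Sum>p | p \<in> D \<and> {fst p, snd p} = e. k {fst p, snd p}) = 2 * k e"
        using \<open>u \<noteq> v\<close> uv(1) by (simp add: insert_commute)
    qed
    finally have "- \<beta> * potts_hamiltonian D \<sigma> = (\<Sum>e\<in>E. \<beta> * k e)"
      by (simp add: potts_hamiltonian_def sum_distrib_left[symmetric])
    then have "exp (- \<beta> * potts_hamiltonian D \<sigma>) = (\<Prod>e\<in>E. exp (\<beta> * k e))"
      using finE by (simp add: exp_sum)
    also have "\<dots> = (\<Prod>e\<in>E. exp (- \<beta> / (real q - 1)) * (1 + sqrt q * of_bool (mono_on_edge \<sigma> e)))"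
    proof (intro prod.cong refl)
      fix e
      have "exp \<beta> = exp (- \<beta> / (real q - 1)) * (1 + sqrt q)"
      proof -
        have q1: "real q - 1 > 0" using q_ge_2 by simp
        have "\<beta> + \<beta> / (real q - 1) = \<beta> * real q / (real q - 1)" using q1 by (simp add: field_simps)
        also have "\<dots> = ln (1 + sqrt q)" using q1 q_ge_2 by (simp add: \<beta>_def potts_beta_c_def)
        finally have "\<beta> = - \<beta> / (real q - 1) + ln (1 + sqrt q)" by simp
        then have "exp \<beta> = exp (- \<beta> / (real q - 1) + ln (1 + sqrt q))" by (rule arg_cong)
        also have "\<dots> = exp (- \<beta> / (real q - 1)) * exp (ln (1 + sqrt q))" by (rule exp_add)
        also have "exp (ln (1 + sqrt q)) = 1 + sqrt q" using sqrt_q(2) by (intro exp_ln) linarith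
        finally show ?thesis .
      qed
      then show "exp (\<beta> * k e) = exp (- \<beta> / (real q - 1)) * (1 + sqrt q * of_bool (mono_on_edge \<sigma> e))"
        by (simp add: k_def)
    qed
    also have "\<dots> = \<kappa> * (\<Prod>e\<in>E. 1 + sqrt q * of_bool (mono_on_edge \<sigma> e))"
      by (simp add: prod.distrib \<kappa>_def)
    finally show ?thesis .
  qed
  have \<kappa>: "0 < \<kappa>" by (simp add: \<kappa>_def)
  have "critical_potts_prob q T \<Omega> \<delta> A
      = (\<Sum>\<sigma>\<in>V \<rightarrow>\<^sub>E T. of_bool (A \<sigma>) * exp (- \<beta> * potts_hamiltonian D \<sigma>)) / (\<Sum>\<sigma>\<in>V \<rightarrow>\<^sub>E T. exp (- \<beta> * potts_hamiltonian D \<sigma>))"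
    by (simp add: critical_potts_prob_def potts_expectation_def potts_partition_def V_def D_def \<beta>_def)
  also have "(\<Sum>\<sigma>\<in>V \<rightarrow>\<^sub>E T. of_bool (A \<sigma>) * exp (- \<beta> * potts_hamiltonian D \<sigma>))
      = \<kappa> * (\<Sum>\<sigma>\<in>V \<rightarrow>\<^sub>E T. of_bool (A \<sigma>) * (\<Prod>e\<in>E. 1 + sqrt q * of_bool (mono_on_edge \<sigma> e)))"
    unfolding sum_distrib_left by (intro sum.cong refl) (simp only: weight mult.left_commute)
  also have "(\<Sum>\<sigma>\<in>V \<rightarrow>\<^sub>E T. exp (- \<beta> * potts_hamiltonian D \<sigma>))
      = \<kappa> * (\<Sum>\<sigma>\<in>V \<rightarrow>\<^sub>E T. \<Prod>e\<in>E. 1 + sqrt q * of_bool (mono_on_edge \<sigma> e))"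
    unfolding sum_distrib_left by (intro sum.cong refl weight)
  finally show ?thesis using \<kappa> by simp
qed

text \<open>The free two-point function in any finite volume is at most \<open>G\<close>, so the
  error depends on the distance in lattice units and not on the domain; this makes the estimate
  uniform in the rotation.\<close>

lemma potts_prob_approx:
  fixes T :: "(real ^ 'd) set" and x :: "'i \<Rightarrow> complex"
  assumes T: "potts_simplex q T" and fin: "finite (domain_verts \<Omega> \<delta>)" and \<delta>: "0 < \<delta>"
    and I: "finite I" "\<And>i. i \<in> I \<Longrightarrow> x i \<in> domain_verts \<Omega> \<delta>" "\<And>i. i \<in> I \<Longrightarrow> \<tau> i \<in> T"
    and far: "\<And>i j. \<lbrakk>i \<in> I; j \<in> I; i \<noteq> j\<rbrakk> \<Longrightarrow> r \<le> dist (x i) (x j)" and r: "0 < r" "of_int R * \<delta> \<le> r"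
    and G: "\<And>u v. R \<le> \<bar>fst u - fst v\<bar> + \<bar>snd u - snd v\<bar> \<Longrightarrow> G u v < \<eta>" and "0 \<le> \<eta>"
  shows "\<bar>critical_potts_prob q T \<Omega> \<delta> (\<lambda>\<sigma>. \<forall>i\<in>I. \<sigma> (x i) = \<tau> i) - 1 / q ^ card I\<bar> \<le> (real (card I))\<^sup>2 * \<eta>"
proof -
  define V where "V = domain_verts \<Omega> \<delta>"
  define E where "E = (\<lambda>(x, y). {x, y}) ` domain_edges \<Omega> \<delta>"
  define S where "S = emb \<delta> -` V"
  have inj: "inj (emb \<delta>)" by (rule inj_emb[OF \<delta>])
  have finS: "finite S" unfolding S_def using fin inj by (intro finite_vimageI) (simp add: V_def)
  have range: "lattice_verts \<delta> = range (emb \<delta>)"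
    by (auto simp: lattice_verts_def emb_def image_def)
  have VS: "V = emb \<delta> ` S"
    using range by (auto simp: S_def V_def domain_verts_def)
  have ES: "E = (`) (emb \<delta>) ` lat S"
  proof (intro set_eqI iffI)
    fix e assume "e \<in> E"
    then obtain u v where uv: "e = {u, v}" "u \<in> V" "v \<in> V" "dist u v = \<delta>"
      by (auto simp: E_def domain_edges_def V_def)
    obtain a b where ab: "u = emb \<delta> a" "v = emb \<delta> b" "a \<in> S" "b \<in> S" using uv VS by auto
    then have "{a, b} \<in> lat S" using uv(4) dist_emb_eq[OF \<delta>] by (simp add: lat_edge)
    then show "e \<in> (`) (emb \<delta>) ` lat S" using uv ab by (intro image_eqI[of _ _ "{a, b}"]) auto
  next
    fix e assume "e \<in> (`) (emb \<delta>) ` lat S"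
    then obtain d where d: "d \<in> lat S" "e = emb \<delta> ` d" by blast
    obtain a b where ab: "d = {a, b}" "a \<in> S" "b \<in> S" "ladj a b" using d(1) by (rule lat_cases)
    then have "(emb \<delta> a, emb \<delta> b) \<in> domain_edges \<Omega> \<delta>"
      using dist_emb_eq[OF \<delta>, of a b] by (simp add: domain_edges_def S_def V_def)
    then show "e \<in> E" unfolding E_def using d ab by (intro image_eqI[of _ _ "(emb \<delta> a, emb \<delta> b)"]) auto
  qed
  have gr: "graph V E" unfolding VS ES by (rule graph_image[OF graph_lat[OF finS]])
  have two: "ex V E (\<lambda>\<omega>. of_bool (conn \<omega> (x i) (x j))) \<le> \<eta>" if ij: "i \<in> I" "j \<in> I - {i}" for i j
  proof -
    obtain a b where ab: "x i = emb \<delta> a" "x j = emb \<delta> b" using I(2)[of i] I(2)[of j] ij VS by (auto simp: V_def)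
    have "ex V E (\<lambda>\<omega>. of_bool (conn \<omega> (x i) (x j))) = tp S a b"
      unfolding VS ES ab ex_image[OF inj graph_lat[OF finS]] conn_image[OF inj] tp_def ..
    also have "\<dots> \<le> G a b" by (rule tp_le_G[OF finS])
    also have "\<dots> \<le> \<eta>"
    proof -
      have "of_int R * \<delta> \<le> \<delta> * of_int (\<bar>fst a - fst b\<bar> + \<bar>snd a - snd b\<bar>)"
      proof -
        have "r \<le> dist (emb \<delta> a) (emb \<delta> b)" using far[of i j] ij unfolding ab by blast
        then show ?thesis using r(2) dist_emb_le[OF \<delta>, of a b] by linarith
      qed
      then have "real_of_int R \<le> of_int (\<bar>fst a - fst b\<bar> + \<bar>snd a - snd b\<bar>)"
        using \<delta> by (simp only: mult.commute[of _ \<delta>] mult_le_cancel_left_pos)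
      then show ?thesis using G[of a b] by (simp only: of_int_le_iff) simp
    qed
    finally show ?thesis .
  qed
  have finT: "finite T" "card T = q"
  proof -
    show "card T = q" using T by (simp add: potts_simplex_def)
    then show "finite T" using q_ge_2 by (intro card_ge_0_finite) simp
  qed
  have inj_x: "inj_on x I"
  proof (rule inj_onI)
    fix i j assume "i \<in> I" "j \<in> I" "x i = x j"
    then show "i = j" using far[of i j] r(1) by (cases "i = j") auto
  qed
  have "\<bar>critical_potts_prob q T \<Omega> \<delta> (\<lambda>\<sigma>. \<forall>i\<in>I. \<sigma> (x i) = \<tau> i) - 1 / q ^ card I\<bar>
      \<le> (\<Sum>i\<in>I. \<Sum>j\<in>I - {i}. ex V E (\<lambda>\<omega>. of_bool (conn \<omega> (x i) (x j))))"
    unfolding critical_potts_prob_eq[OF T fin \<delta>] V_def[symmetric] E_def[symmetric]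
    by (rule spin_pinned_approx[OF gr finT I(1) inj_x]) (use I in \<open>auto simp: V_def\<close>)
  also have "\<dots> \<le> (\<Sum>i\<in>I. \<Sum>j\<in>I - {i}. \<eta>)" by (intro sum_mono two)
  also have "\<dots> \<le> (\<Sum>i\<in>I. real (card I) * \<eta>)"
    using I(1) \<open>0 \<le> \<eta>\<close> by (intro sum_mono) (simp add: mult_right_mono card_Diff1_le)
  also have "\<dots> = (real (card I))\<^sup>2 * \<eta>" by (simp add: power2_eq_square)
  finally show ?thesis .
qed

end

section \<open>Comparison of the two domains through their common limit\<close>

theorem corollary1p11:
  fixes q n :: nat and \<epsilon> :: real and \<Omega> :: "complex set"
  assumes "q \<in> {2, 3, 4}"
    and "open \<Omega>" and "connected \<Omega>" and "simply_connected \<Omega>"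
    and "C1_smooth_boundary \<Omega>"
    and "0 < \<epsilon>"
  shows "\<exists>\<delta>\<^sub>0>0. \<forall>T :: (real ^ 'd) set. potts_simplex q T \<longrightarrow>
    (\<forall>\<alpha>\<in>{0..2 * pi}. \<forall>\<delta>. 0 < \<delta> \<and> \<delta> \<le> \<delta>\<^sub>0 \<longrightarrow>
      (\<forall>(\<tau> :: nat \<Rightarrow> real ^ 'd) (x :: nat \<Rightarrow> complex) (y :: nat \<Rightarrow> complex).
        (\<forall>i\<in>{1..n}. \<tau> i \<in> T) \<longrightarrow>
        (\<forall>i\<in>{1..n}. x i \<in> domain_verts \<Omega> \<delta> \<and> \<epsilon> \<le> infdist (x i) (frontier \<Omega>)) \<longrightarrow>
        (\<forall>i\<in>{1..n}. \<forall>j\<in>{1..n}. i \<noteq> j \<longrightarrow> \<epsilon> \<le> dist (x i) (x j)) \<longrightarrow>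
        (\<forall>i\<in>{1..n}. y i \<in> domain_verts (rotate_domain \<alpha> \<Omega>) \<delta> \<and> dist (y i) (cis \<alpha> * x i) \<le> \<delta>) \<longrightarrow>
        \<bar>critical_potts_prob q T \<Omega> \<delta> (\<lambda>\<sigma>. \<forall>i\<in>{1..n}. \<sigma> (x i) = \<tau> i) -
         critical_potts_prob q T (rotate_domain \<alpha> \<Omega>) \<delta> (\<lambda>\<sigma>. \<forall>i\<in>{1..n}. \<sigma> (y i) = \<tau> i)\<bar>
        \<le> \<epsilon> * critical_potts_prob q T \<Omega> \<delta> (\<lambda>\<sigma>. \<forall>i\<in>{1..n}. \<sigma> (x i) = \<tau> i)))"
proof -
  interpret fk q using assms(1) by unfold_locales auto
  define m where "m = 1 / real q ^ n"
  have m: "0 < m" using q_ge_2 by (simp add: m_def)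
  \<comment> \<open>Chosen so that twice the error n^2 \<eta> of each probability is at most
    \<epsilon> (m - n^2 \<eta>), a lower bound for the right-hand side. The added 1 keeps d positive
    for n = 0.\<close>
  define d where "d = (real n ^ 2 + 1) * (2 + \<epsilon>)"
  have d: "0 < d" unfolding d_def using assms(6) by (intro mult_pos_pos add_nonneg_pos) auto
  define \<eta> where "\<eta> = \<epsilon> * m / d"
  have \<eta>: "0 < \<eta>" unfolding \<eta>_def using assms(6) m d by simp
  have small: "real n ^ 2 * \<eta> * (2 + \<epsilon>) \<le> \<epsilon> * m"
  proof -
    have "real n ^ 2 * \<eta> * (2 + \<epsilon>) \<le> (real n ^ 2 + 1) * \<eta> * (2 + \<epsilon>)"
      using \<eta> assms(6) by (intro mult_right_mono) auto
    also have "\<dots> = \<eta> * d" unfolding d_def by (simp only: mult_ac)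
    also have "\<dots> = \<epsilon> * m" unfolding \<eta>_def using d by simp
    finally show ?thesis .
  qed
  obtain R where R: "\<And>u v. R \<le> \<bar>fst u - fst v\<bar> + \<bar>snd u - snd v\<bar> \<Longrightarrow> G u v < \<eta>"
    using G_decay[OF \<eta>] by blast
  define \<rho> :: real where "\<rho> = of_int \<bar>R\<bar> + 1"
  have \<rho>: "0 < \<rho>" "of_int R \<le> \<rho>" by (auto simp: \<rho>_def)
  \<comment> \<open>The first bound keeps the points y i at mutual distance at least \<epsilon> / 2,
    as each differs from a rotated point by at most \<delta>; the second makes R lattice steps no
    longer than \<epsilon> / 2.\<close>
  define \<delta>0 where "\<delta>0 = min (\<epsilon> / 4) (\<epsilon> / (2 * \<rho>))"
  have \<delta>0: "0 < \<delta>0" using assms(6) \<rho> by (simp add: \<delta>0_def)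
  have bdd: "bounded \<Omega>" by (rule C1_smooth_boundary_imp_bounded[OF assms(2,4,5)])
  have main: "\<bar>critical_potts_prob q T \<Omega> \<delta> (\<lambda>\<sigma>. \<forall>i\<in>{1..n}. \<sigma> (x i) = \<tau> i) -
         critical_potts_prob q T (rotate_domain \<alpha> \<Omega>) \<delta> (\<lambda>\<sigma>. \<forall>i\<in>{1..n}. \<sigma> (y i) = \<tau> i)\<bar>
        \<le> \<epsilon> * critical_potts_prob q T \<Omega> \<delta> (\<lambda>\<sigma>. \<forall>i\<in>{1..n}. \<sigma> (x i) = \<tau> i)"
    if T: "potts_simplex q T" and \<delta>: "0 < \<delta>" "\<delta> \<le> \<delta>0"
      and \<tau>: "\<forall>i\<in>{1..n}. \<tau> i \<in> T"
      and x: "\<forall>i\<in>{1..n}. x i \<in> domain_verts \<Omega> \<delta> \<and> \<epsilon> \<le> infdist (x i) (frontier \<Omega>)"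
      and xx: "\<forall>i\<in>{1..n}. \<forall>j\<in>{1..n}. i \<noteq> j \<longrightarrow> \<epsilon> \<le> dist (x i) (x j)"
      and y: "\<forall>i\<in>{1..n}. y i \<in> domain_verts (rotate_domain \<alpha> \<Omega>) \<delta> \<and> dist (y i) (cis \<alpha> * x i) \<le> \<delta>"
    for T :: "(real ^ 'd) set" and \<alpha> \<delta> \<tau> x y
  proof -
    have \<delta>R: "of_int R * \<delta> \<le> \<epsilon> / 2" "\<delta> \<le> \<epsilon> / 4"
    proof -
      have "of_int R * \<delta> \<le> \<rho> * \<delta>" using \<delta>(1) \<rho> by (intro mult_right_mono) auto
      also have "\<dots> \<le> \<rho> * (\<epsilon> / (2 * \<rho>))"
        using \<delta>(2) \<rho> by (intro mult_left_mono) (auto simp: \<delta>0_def)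
      also have "\<dots> = \<epsilon> / 2" using \<rho> by simp
      finally show "of_int R * \<delta> \<le> \<epsilon> / 2" .
      show "\<delta> \<le> \<epsilon> / 4" using \<delta>(2) by (simp add: \<delta>0_def)
    qed
    have bdd': "bounded (rotate_domain \<alpha> \<Omega>)"
    proof -
      obtain b where "\<forall>z\<in>\<Omega>. norm z \<le> b" using bdd by (auto simp: bounded_iff)
      then show ?thesis unfolding bounded_iff rotate_domain_def by (intro exI[of _ b]) (auto simp: norm_mult)
    qed
    have yy: "\<epsilon> / 2 \<le> dist (y i) (y j)" if "i \<in> {1..n}" "j \<in> {1..n}" "i \<noteq> j" for i j
    proof -
      have "dist (cis \<alpha> * x i) (cis \<alpha> * x j) = dist (x i) (x j)"
        by (simp add: dist_norm norm_mult flip: right_diff_distrib)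
      moreover have "dist (cis \<alpha> * x i) (cis \<alpha> * x j)
          \<le> dist (y i) (cis \<alpha> * x i) + dist (y i) (y j) + dist (y j) (cis \<alpha> * x j)"
        by (metis add.commute add.left_commute add_left_mono dist_commute dist_triangle dist_triangle3 order_trans)
      moreover have "\<epsilon> \<le> dist (x i) (x j)" using xx that by blast
      moreover have "dist (y i) (cis \<alpha> * x i) \<le> \<delta>" "dist (y j) (cis \<alpha> * x j) \<le> \<delta>" using y that by blast+
      ultimately show ?thesis using \<delta>R(2) by linarith
    qed
    have xx': "\<epsilon> / 2 \<le> dist (x i) (x j)" if "i \<in> {1..n}" "j \<in> {1..n}" "i \<noteq> j" for i j
    proof -
      have "\<epsilon> \<le> dist (x i) (x j)" using xx that by blast
      then show ?thesis using assms(6) by linarith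
    qed
    have "\<bar>critical_potts_prob q T \<Omega> \<delta> (\<lambda>\<sigma>. \<forall>i\<in>{1..n}. \<sigma> (x i) = \<tau> i) - 1 / q ^ card {1..n}\<bar>
        \<le> (real (card {1..n}))\<^sup>2 * \<eta>"
    proof (rule potts_prob_approx[OF T finite_domain_verts[OF bdd \<delta>(1)] \<delta>(1), where r = "\<epsilon> / 2" and R = R])
      show "x i \<in> domain_verts \<Omega> \<delta>" if "i \<in> {1..n}" for i using x that by blast
      show "\<tau> i \<in> T" if "i \<in> {1..n}" for i using \<tau> that by blast
      show "\<epsilon> / 2 \<le> dist (x i) (x j)" if "i \<in> {1..n}" "j \<in> {1..n}" "i \<noteq> j" for i j
        by (rule xx'[OF that])
      show "G u v < \<eta>" if "R \<le> \<bar>fst u - fst v\<bar> + \<bar>snd u - snd v\<bar>" for u v by (rule R[OF that])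
      show "0 < \<epsilon> / 2" using assms(6) by simp
      show "0 \<le> \<eta>" using \<eta> by simp
    qed (simp, rule \<delta>R(1))
    then have 1: "\<bar>critical_potts_prob q T \<Omega> \<delta> (\<lambda>\<sigma>. \<forall>i\<in>{1..n}. \<sigma> (x i) = \<tau> i) - m\<bar> \<le> real n ^ 2 * \<eta>"
      by (simp only: card_atLeastAtMost diff_Suc_1 m_def of_nat_power)
    have "\<bar>critical_potts_prob q T (rotate_domain \<alpha> \<Omega>) \<delta> (\<lambda>\<sigma>. \<forall>i\<in>{1..n}. \<sigma> (y i) = \<tau> i) - 1 / q ^ card {1..n}\<bar>
        \<le> (real (card {1..n}))\<^sup>2 * \<eta>"
    proof (rule potts_prob_approx[OF T finite_domain_verts[OF bdd' \<delta>(1)] \<delta>(1), where r = "\<epsilon> / 2" and R = R])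
      show "y i \<in> domain_verts (rotate_domain \<alpha> \<Omega>) \<delta>" if "i \<in> {1..n}" for i using y that by blast
      show "\<tau> i \<in> T" if "i \<in> {1..n}" for i using \<tau> that by blast
      show "\<epsilon> / 2 \<le> dist (y i) (y j)" if "i \<in> {1..n}" "j \<in> {1..n}" "i \<noteq> j" for i j
        by (rule yy[OF that])
      show "G u v < \<eta>" if "R \<le> \<bar>fst u - fst v\<bar> + \<bar>snd u - snd v\<bar>" for u v by (rule R[OF that])
      show "0 < \<epsilon> / 2" using assms(6) by simp
      show "0 \<le> \<eta>" using \<eta> by simp
    qed (simp, rule \<delta>R(1))
    then have 2: "\<bar>critical_potts_prob q T (rotate_domain \<alpha> \<Omega>) \<delta> (\<lambda>\<sigma>. \<forall>i\<in>{1..n}. \<sigma> (y i) = \<tau> i) - m\<bar> \<le> real n ^ 2 * \<eta>"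
      by (simp only: card_atLeastAtMost diff_Suc_1 m_def of_nat_power)
    define p where "p = critical_potts_prob q T \<Omega> \<delta> (\<lambda>\<sigma>. \<forall>i\<in>{1..n}. \<sigma> (x i) = \<tau> i)"
    have "\<epsilon> * (m - real n ^ 2 * \<eta>) \<le> \<epsilon> * p"
      using 1 assms(6) unfolding p_def[symmetric] by (intro mult_left_mono) auto
    moreover have "2 * (real n ^ 2 * \<eta>) \<le> \<epsilon> * (m - real n ^ 2 * \<eta>)" using small by (simp add: algebra_simps)
    ultimately show ?thesis using 1 2 unfolding p_def[symmetric] by linarith
  qed
  show ?thesis
    by (intro exI[of _ \<delta>0] conjI \<delta>0 allI ballI impI) (rule main; (elim conjE)?; assumption)
qed

end
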